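(* Let $(X,\triangleleft)$ be a finite quandle. The following conditions are equivalent: (1) the structure group $G(X,\triangleleft)$ is abelian; (2) the quandle $(X,\triangleleft)$ is abelian, and its parameter group $G'(X,\triangleleft)$ is trivial; (3) the quandle $(X,\triangleleft)$ is abelian, and the maximal minors of its parameter matrix $\mathcal{M}(X,\triangleleft)$ are globally coprime (the greatest common divisor of all of them is $1$).
   Context: A quandle is a non-empty set $X$ with a binary operation $\triangleleft$ such that for all $a,b,c$: $(a\triangleleft b)\triangleleft c=(a\triangleleft c)\triangleleft(b\triangleleft c)$; the right translation $-\triangleleft b$ is a bijection of $X$; $a\triangleleft a=a$. Its orbits are the orbits of $X$ under the group generated by all right translations. It is abelian if $(a\triangleleft b)\triangleleft c=(a\triangleleft c)\triangleleft b$ for all $a,b,c$. Its structure group is $G(X,\triangleleft)=\langle g_a,\ a\in X\mid g_ag_b=g_bg_{a\triangleleft b},\ a,b\in X\rangle$. Parameters. Let $r\ge 1$. A parameter collection is a family of integers $M=(m_{i,j})_{1\le j\le i<r}$ with $m_{i,i}\ge 1$ and $0\le m_{j,i}<m_{i,i}$ for $i<j$ (empty if $r=1$). It defines the finite abelian group $G(M)$ generated by pairwise commuting $x_1,\ldots,x_{r-1}$ subject to $x_1^{m_{i,1}}x_2^{m_{i,2}}\cdots x_i^{m_{i,i}}=1$ for $1\le i\le r-1$. Put $x_0:=1$. Given $r$ parameter collections, let $Q(M^{(1)},\ldots,M^{(r)})=G(M^{(1)})\sqcup\cdots\sqcup G(M^{(r)})$, with $x_k^{(i)}$ denoting the element $x_k$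 of $G(M^{(i)})$, and $a\triangleleft b=a\,x_k^{(i)}$ for $a\in G(M^{(i)})$, $b\in G(M^{(i+k)})$, $0\le k<r$ ($i+k$ modulo $r$). This is an abelian quandle with orbits $G(M^{(i)})$. Every finite abelian quandle with ordered orbits $O_1,\ldots,O_r$ is isomorphic, by an isomorphism matching $O_i$ with $G(M^{(i)})$ for all $i$, to $Q(M^{(1)},\ldots,M^{(r)})$ for unique $M^{(1)},\ldots,M^{(r)}$, called its parameters, with entries $m^{(i)}_{j,k}$. Orbits are assumed ordered. The parameter group of a finite abelian quandle is the quotient $G'(X,\triangleleft)=\prod_{i=1}^rG(M^{(i)})\big/\langle x^{(i)}_{j-i}x^{(j)}_{i-j},\ 1\le i<j\le r\rangle$, lower indices being taken modulo $r$ in $\{0,\dots,r-1\}$. The parameter matrix $\mathcal{M}(X,\triangleleft)$ has columns indexed by pairs $(i,j)$ with $1\le i<j\le r$ and rows indexed by pairs $(i,j)$ with $1\le i\le r$, $1\le j<r$ (lexicographic order). Row $(i,j)$ contains $m^{(i)}_{j,k}$ in column $(i,i+k)$ for all $1\le k\le\min\{j,r-i\}$, contains $-m^{(i)}_{j,k}$ in column $(i+k-r,i)$ for all $r-i<k\le j$, and zeroes elsewhere. Its maximal minors are its $\frac{r(r-1)}2\times\frac{r(r-1)}2$ minors (for $r=1$ the matrix is empty and its only maximal minor is $1$). *)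

theory Defs
  imports
    "HOL-Algebra.Bij"
    "HOL-Algebra.Group_Action"
    "HOL-Algebra.Product_Groups"
    "HOL-Algebra.Free_Abelian_Groups"
    "Jordan_Normal_Form.Determinant"
    "Jordan_Normal_Form.DL_Submatrix"
begin

section \<open>Quandles\<close>

text \<open>A quandle is given by its carrier \<open>X\<close> and a binary operation, of which only the values
  on \<open>X\<close> matter. Closure of \<open>X\<close> is part of the bijectivity of the right translations.\<close>

definition quandle :: "'a set \<Rightarrow> ('a \<Rightarrow> 'a \<Rightarrow> 'a) \<Rightarrow> bool" where
  "quandle X tr \<longleftrightarrow>
     X \<noteq> {} \<and>
     (\<forall>a\<in>X. \<forall>b\<in>X. \<forall>c\<in>X. tr (tr a b) c = tr (tr a c) (tr b c)) \<and>
     (\<forall>b\<in>X. bij_betw (\<lambda>a. tr a b) X X) \<and>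
     (\<forall>a\<in>X. tr a a = a)"

definition abelian_quandle :: "'a set \<Rightarrow> ('a \<Rightarrow> 'a \<Rightarrow> 'a) \<Rightarrow> bool" where
  "abelian_quandle X tr \<longleftrightarrow>
     quandle X tr \<and> (\<forall>a\<in>X. \<forall>b\<in>X. \<forall>c\<in>X. tr (tr a b) c = tr (tr a c) b)"

definition right_translations :: "'a set \<Rightarrow> ('a \<Rightarrow> 'a \<Rightarrow> 'a) \<Rightarrow> ('a \<Rightarrow> 'a) set" where
  "right_translations X tr = {(\<lambda>a\<in>X. tr a b) | b. b \<in> X}"

definition quandle_orbits :: "'a set \<Rightarrow> ('a \<Rightarrow> 'a \<Rightarrow> 'a) \<Rightarrow> 'a set set" where
  "quandle_orbits X tr =
     orbits (subgroup_generated (BijGroup X) (right_translations X tr)) X (\<lambda>g. g)"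

definition ordered_orbits ::
  "'a set \<Rightarrow> ('a \<Rightarrow> 'a \<Rightarrow> 'a) \<Rightarrow> nat \<Rightarrow> (nat \<Rightarrow> 'a set) \<Rightarrow> bool" where
  "ordered_orbits X tr r Os \<longleftrightarrow> bij_betw Os {1..r} (quandle_orbits X tr)"


section \<open>The structure group\<close>

text \<open>The group with generators \<open>S\<close> and relations \<open>u = v\<close> for \<open>(u, v) \<in> R\<close> is realised as the
  words in the letters \<open>(s, True)\<close>, standing for \<open>s\<close>, and \<open>(s, False)\<close>, standing for the
  inverse of \<open>s\<close>, modulo the least congruence containing free cancellation and \<open>R\<close>.\<close>

type_synonym 'a word = "('a \<times> bool) list"

inductive word_eq :: "'a set \<Rightarrow> ('a word \<times> 'a word) set \<Rightarrow> 'a word \<Rightarrow> 'a word \<Rightarrow> bool"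
  for S :: "'a set" and R :: "('a word \<times> 'a word) set" where
  refl: "w \<in> lists (S \<times> UNIV) \<Longrightarrow> word_eq S R w w"
| sym: "word_eq S R u v \<Longrightarrow> word_eq S R v u"
| trans: "word_eq S R u v \<Longrightarrow> word_eq S R v w \<Longrightarrow> word_eq S R u w"
| append: "word_eq S R u v \<Longrightarrow> word_eq S R u' v' \<Longrightarrow> word_eq S R (u @ u') (v @ v')"
| cancel: "s \<in> S \<Longrightarrow> word_eq S R [(s, b), (s, \<not> b)] []"
| relation: "(u, v) \<in> R \<Longrightarrow> u \<in> lists (S \<times> UNIV) \<Longrightarrow> v \<in> lists (S \<times> UNIV) \<Longrightarrow> word_eq S R u v"

definition word_rel :: "'a set \<Rightarrow> ('a word \<times> 'a word) set \<Rightarrow> ('a word \<times> 'a word) set" where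
  "word_rel S R = {(u, v). word_eq S R u v}"

definition presented_group :: "'a set \<Rightarrow> ('a word \<times> 'a word) set \<Rightarrow> 'a word set monoid" where
  "presented_group S R =
     \<lparr>carrier = lists (S \<times> UNIV) // word_rel S R,
      monoid.mult = (\<lambda>A B. \<Union>u\<in>A. \<Union>v\<in>B. word_rel S R `` {u @ v}),
      one = word_rel S R `` {[]}\<rparr>"

lemma word_eq_lists:
  "word_eq S R u v \<Longrightarrow> u \<in> lists (S \<times> UNIV) \<and> v \<in> lists (S \<times> UNIV)"
  by (induction rule: word_eq.induct) auto

lemma equiv_word_rel: "equiv (lists (S \<times> UNIV)) (word_rel S R)"
proof (rule equivI)
  show "word_rel S R \<subseteq> lists (S \<times> UNIV) \<times> lists (S \<times> UNIV)"
    using word_eq_lists by (fastforce simp: word_rel_def)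
  show "refl_on (lists (S \<times> UNIV)) (word_rel S R)"
    by (auto simp: refl_on_def word_rel_def intro: word_eq.refl)
  show "Relation.sym (word_rel S R)"
    by (auto simp: sym_def word_rel_def intro: word_eq.sym)
  show "Relation.trans (word_rel S R)"
    by (auto simp: trans_def word_rel_def intro: word_eq.trans)
qed

lemma mult_presented_group:
  assumes "u \<in> lists (S \<times> UNIV)" "v \<in> lists (S \<times> UNIV)"
  shows "(word_rel S R `` {u}) \<otimes>\<^bsub>presented_group S R\<^esub> (word_rel S R `` {v}) = word_rel S R `` {u @ v}"
proof -
  have "word_rel S R `` {y @ w} = word_rel S R `` {z @ w}" "word_rel S R `` {w @ y} = word_rel S R `` {w @ z}"
    if "(y, z) \<in> word_rel S R" "w \<in> lists (S \<times> UNIV)" for y z w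
    using that word_eq.append[OF _ word_eq.refl, of S R y z w]
      word_eq.append[OF word_eq.refl, of w S R y z]
    by (auto simp: word_rel_def intro: word_eq.sym word_eq.trans)
  then have "congruent2 (word_rel S R) (word_rel S R) (\<lambda>u v. word_rel S R `` {u @ v})"
    by (intro congruent2I[OF equiv_word_rel equiv_word_rel]) metis+
  from UN_equiv_class2[OF equiv_word_rel equiv_word_rel this assms] show ?thesis
    by (simp add: presented_group_def)
qed

lemma word_eq_inverse:
  assumes "w \<in> lists (S \<times> UNIV)"
  shows "word_eq S R (rev (map (\<lambda>(s, b). (s, \<not> b)) w) @ w) []"
  using assms
proof (induction w)
  case Nil
  then show ?case by (auto intro: word_eq.refl)
next
  case (Cons x w)
  obtain s b where x: "x = (s, b)" by fastforce
  have s: "s \<in> S" and w: "w \<in> lists (S \<times> UNIV)" using Cons x by auto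
  let ?i = "rev (map (\<lambda>(s, b). (s, \<not> b)) w)"
  have i: "?i \<in> lists (S \<times> UNIV)" using w by (auto simp: in_lists_conv_set)
  have "word_eq S R ([(s, \<not> b), (s, b)] @ w) ([] @ w)"
    using word_eq.append[OF word_eq.cancel[of s S R "\<not> b"] word_eq.refl[OF w]] s by simp
  from word_eq.append[OF word_eq.refl[OF i] this]
  have "word_eq S R (?i @ [(s, \<not> b), (s, b)] @ w) (?i @ w)" by simp
  with Cons.IH w show ?case using word_eq.trans x by fastforce
qed

lemma group_presented_group: "group (presented_group S R)"
proof -
  let ?W = "lists (S \<times> (UNIV :: bool set))"
  have car: "carrier (presented_group S R) = (\<lambda>u. word_rel S R `` {u}) ` ?W"
    by (auto simp: presented_group_def quotient_def)
  have one: "\<one>\<^bsub>presented_group S R\<^esub> = word_rel S R `` {[]}"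
    by (simp add: presented_group_def)
  show ?thesis
  proof (rule groupI)
    fix x assume "x \<in> carrier (presented_group S R)"
    then obtain u where u: "u \<in> ?W" "x = word_rel S R `` {u}" by (auto simp: car)
    let ?i = "rev (map (\<lambda>(s, b). (s, \<not> b)) u)"
    have i: "?i \<in> ?W" using u(1) by (auto simp: in_lists_conv_set)
    have "word_rel S R `` {?i @ u} = word_rel S R `` {[]}"
      by (rule equiv_class_eq[OF equiv_word_rel])
         (use word_eq_inverse[OF u(1)] in \<open>simp add: word_rel_def\<close>)
    then have "(word_rel S R `` {?i}) \<otimes>\<^bsub>presented_group S R\<^esub> x = \<one>\<^bsub>presented_group S R\<^esub>"
      using mult_presented_group[OF i u(1)] u(2) one by metis
    then show "\<exists>y\<in>carrier (presented_group S R). y \<otimes>\<^bsub>presented_group S R\<^esub> x = \<one>\<^bsub>presented_group S R\<^esub>"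
      using i car by blast
  next
    fix x y assume "x \<in> carrier (presented_group S R)" "y \<in> carrier (presented_group S R)"
    then obtain u v where u: "u \<in> ?W" "x = word_rel S R `` {u}" and v: "v \<in> ?W" "y = word_rel S R `` {v}"
      by (auto simp: car)
    then show "x \<otimes>\<^bsub>presented_group S R\<^esub> y \<in> carrier (presented_group S R)"
      by (simp add: mult_presented_group car del: in_lists_conv_set)
  next
    fix x y z
    assume "x \<in> carrier (presented_group S R)" "y \<in> carrier (presented_group S R)"
      "z \<in> carrier (presented_group S R)"
    then obtain u v w where "u \<in> ?W" "x = word_rel S R `` {u}" "v \<in> ?W" "y = word_rel S R `` {v}"
      "w \<in> ?W" "z = word_rel S R `` {w}"
      by (auto simp: car)
    then show "x \<otimes>\<^bsub>presented_group S R\<^esub> y \<otimes>\<^bsub>presented_group S R\<^esub> z =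
        x \<otimes>\<^bsub>presented_group S R\<^esub> (y \<otimes>\<^bsub>presented_group S R\<^esub> z)"
      by (simp add: mult_presented_group del: in_lists_conv_set)
  next
    fix x assume "x \<in> carrier (presented_group S R)"
    then obtain u where "u \<in> ?W" "x = word_rel S R `` {u}" by (auto simp: car)
    then show "\<one>\<^bsub>presented_group S R\<^esub> \<otimes>\<^bsub>presented_group S R\<^esub> x = x"
      unfolding one by (simp add: mult_presented_group del: in_lists_conv_set)
  next
    show "\<one>\<^bsub>presented_group S R\<^esub> \<in> carrier (presented_group S R)"
      by (auto simp: car one)
  qed
qed

definition structure_group :: "'a set \<Rightarrow> ('a \<Rightarrow> 'a \<Rightarrow> 'a) \<Rightarrow> 'a word set monoid" where
  "structure_group X tr =
     presented_group X
       {([(a, True), (b, True)], [(b, True), (tr a b, True)]) | a b. a \<in> X \<and> b \<in> X}"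


section \<open>Parameters of finite abelian quandles\<close>

text \<open>A parameter collection is a function \<open>m\<close> on pairs of indices. So that a collection is
  determined by its entries \<open>m i j\<close> with \<open>1 \<le> j \<le> i < r\<close>, all other values are required to
  be \<open>0\<close>.\<close>

definition parameter_collection :: "nat \<Rightarrow> (nat \<Rightarrow> nat \<Rightarrow> int) \<Rightarrow> bool" where
  "parameter_collection r m \<longleftrightarrow>
     (\<forall>i. 1 \<le> i \<and> i < r \<longrightarrow> m i i \<ge> 1) \<and>
     (\<forall>i j. 1 \<le> i \<and> i < j \<and> j < r \<longrightarrow> 0 \<le> m j i \<and> m j i < m i i) \<and>
     (\<forall>i j. \<not> (1 \<le> j \<and> j \<le> i \<and> i < r) \<longrightarrow> m i j = 0)"

text \<open>\<open>G(M)\<close> is the free abelian group on \<open>x\<^sub>1, \<dots>, x\<^bsub>r-1\<^esub>\<close>, written additively as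
  \<open>free_Abelian_group {1..<r}\<close>, modulo the subgroup generated by the relators.\<close>

definition relator :: "(nat \<Rightarrow> nat \<Rightarrow> int) \<Rightarrow> nat \<Rightarrow> (nat \<Rightarrow>\<^sub>0 int)" where
  "relator m i = (\<Sum>k = 1..i. frag_cmul (m i k) (frag_of k))"

definition relator_subgroup :: "nat \<Rightarrow> (nat \<Rightarrow> nat \<Rightarrow> int) \<Rightarrow> (nat \<Rightarrow>\<^sub>0 int) set" where
  "relator_subgroup r m = generate (free_Abelian_group {1..<r}) (relator m ` {1..<r})"

definition param_G :: "nat \<Rightarrow> (nat \<Rightarrow> nat \<Rightarrow> int) \<Rightarrow> (nat \<Rightarrow>\<^sub>0 int) set monoid" where
  "param_G r m = free_Abelian_group {1..<r} Mod relator_subgroup r m"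

definition param_x :: "nat \<Rightarrow> (nat \<Rightarrow> nat \<Rightarrow> int) \<Rightarrow> nat \<Rightarrow> (nat \<Rightarrow>\<^sub>0 int) set" where
  "param_x r m k =
     (if k = 0 then \<one>\<^bsub>param_G r m\<^esub>
      else relator_subgroup r m #>\<^bsub>free_Abelian_group {1..<r}\<^esub> frag_of k)"

text \<open>The difference \<open>j - i\<close> modulo \<open>r\<close>, as an element of \<open>{0..<r}\<close>.\<close>

definition diff_mod :: "nat \<Rightarrow> nat \<Rightarrow> nat \<Rightarrow> nat" where
  "diff_mod r j i = nat ((int j - int i) mod int r)"

text \<open>In the following, \<open>M i\<close> is the \<open>i\<close>-th parameter collection, for \<open>1 \<le> i \<le> r\<close>.\<close>

definition param_Q_carrier ::
  "nat \<Rightarrow> (nat \<Rightarrow> nat \<Rightarrow> nat \<Rightarrow> int) \<Rightarrow> (nat \<times> (nat \<Rightarrow>\<^sub>0 int) set) set" where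
  "param_Q_carrier r M = (SIGMA i:{1..r}. carrier (param_G r (M i)))"

definition param_Q_op ::
  "nat \<Rightarrow> (nat \<Rightarrow> nat \<Rightarrow> nat \<Rightarrow> int) \<Rightarrow>
   nat \<times> (nat \<Rightarrow>\<^sub>0 int) set \<Rightarrow> nat \<times> (nat \<Rightarrow>\<^sub>0 int) set \<Rightarrow> nat \<times> (nat \<Rightarrow>\<^sub>0 int) set" where
  "param_Q_op r M =
     (\<lambda>(i, a) (j, b). (i, a \<otimes>\<^bsub>param_G r (M i)\<^esub> param_x r (M i) (diff_mod r j i)))"

definition quandle_iso ::
  "'a set \<Rightarrow> ('a \<Rightarrow> 'a \<Rightarrow> 'a) \<Rightarrow> 'b set \<Rightarrow> ('b \<Rightarrow> 'b \<Rightarrow> 'b) \<Rightarrow> ('a \<Rightarrow> 'b) \<Rightarrow> bool" where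
  "quandle_iso X tr Y tr' f \<longleftrightarrow>
     bij_betw f X Y \<and> (\<forall>a\<in>X. \<forall>b\<in>X. f (tr a b) = tr' (f a) (f b))"

definition are_parameters ::
  "'a set \<Rightarrow> ('a \<Rightarrow> 'a \<Rightarrow> 'a) \<Rightarrow> nat \<Rightarrow> (nat \<Rightarrow> 'a set) \<Rightarrow> (nat \<Rightarrow> nat \<Rightarrow> nat \<Rightarrow> int) \<Rightarrow> bool" where
  "are_parameters X tr r Os M \<longleftrightarrow>
     (\<forall>i\<in>{1..r}. parameter_collection r (M i)) \<and>
     (\<forall>i. i \<notin> {1..r} \<longrightarrow> M i = (\<lambda>_ _. 0)) \<and>
     (\<exists>f. quandle_iso X tr (param_Q_carrier r M) (param_Q_op r M) f \<and>
          (\<forall>i\<in>{1..r}. f ` Os i = {i} \<times> carrier (param_G r (M i))))"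

text \<open>For a finite abelian quandle with ordered orbits \<open>Os 1, \<dots>, Os r\<close> such parameters exist and
  are unique.\<close>

definition parameters ::
  "'a set \<Rightarrow> ('a \<Rightarrow> 'a \<Rightarrow> 'a) \<Rightarrow> nat \<Rightarrow> (nat \<Rightarrow> 'a set) \<Rightarrow> (nat \<Rightarrow> nat \<Rightarrow> nat \<Rightarrow> int)" where
  "parameters X tr r Os = (THE M. are_parameters X tr r Os M)"


section \<open>The parameter group\<close>

definition param_product ::
  "nat \<Rightarrow> (nat \<Rightarrow> nat \<Rightarrow> nat \<Rightarrow> int) \<Rightarrow> (nat \<Rightarrow> (nat \<Rightarrow>\<^sub>0 int) set) monoid" where
  "param_product r M = product_group {1..r} (\<lambda>i. param_G r (M i))"

text \<open>\<open>param_emb r M i k\<close> is \<open>x\<^sub>k\<close> of the \<open>i\<close>-th factor, viewed as an element of the product.\<close>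

definition param_emb ::
  "nat \<Rightarrow> (nat \<Rightarrow> nat \<Rightarrow> nat \<Rightarrow> int) \<Rightarrow> nat \<Rightarrow> nat \<Rightarrow> (nat \<Rightarrow> (nat \<Rightarrow>\<^sub>0 int) set)" where
  "param_emb r M i k =
     (\<lambda>l\<in>{1..r}. if l = i then param_x r (M i) k else \<one>\<^bsub>param_G r (M l)\<^esub>)"

definition parameter_group ::
  "nat \<Rightarrow> (nat \<Rightarrow> nat \<Rightarrow> nat \<Rightarrow> int) \<Rightarrow> (nat \<Rightarrow> (nat \<Rightarrow>\<^sub>0 int) set) set monoid" where
  "parameter_group r M =
     param_product r M Mod
       generate (param_product r M)
         {param_emb r M i (diff_mod r j i) \<otimes>\<^bsub>param_product r M\<^esub> param_emb r M j (diff_mod r i j)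
           | i j. 1 \<le> i \<and> i < j \<and> j \<le> r}"


section \<open>The parameter matrix\<close>

text \<open>The lexicographically ordered lists of column and row labels.\<close>

definition col_labels :: "nat \<Rightarrow> (nat \<times> nat) list" where
  "col_labels r = [(i, j). i \<leftarrow> [1..<r+1], j \<leftarrow> [i+1..<r+1]]"

definition row_labels :: "nat \<Rightarrow> (nat \<times> nat) list" where
  "row_labels r = [(i, j). i \<leftarrow> [1..<r+1], j \<leftarrow> [1..<r]]"

text \<open>The entry in row \<open>(i, j)\<close> and column \<open>(c, d)\<close>, where \<open>c < d\<close>. Column \<open>(c, d)\<close> is
  \<open>(i, i+k)\<close> iff \<open>c = i\<close> and \<open>k = d - i\<close>, and it is \<open>(i+k-r, i)\<close> iff \<open>d = i\<close> and
  \<open>k = c + r - i\<close>.\<close>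

definition param_entry ::
  "nat \<Rightarrow> (nat \<Rightarrow> nat \<Rightarrow> nat \<Rightarrow> int) \<Rightarrow> nat \<times> nat \<Rightarrow> nat \<times> nat \<Rightarrow> int" where
  "param_entry r M = (\<lambda>(i, j) (c, d).
     if c = i \<and> 1 \<le> d - i \<and> d - i \<le> min j (r - i) then M i j (d - i)
     else if d = i \<and> r - i < c + r - i \<and> c + r - i \<le> j then - M i j (c + r - i)
     else 0)"

definition parameter_matrix :: "nat \<Rightarrow> (nat \<Rightarrow> nat \<Rightarrow> nat \<Rightarrow> int) \<Rightarrow> int mat" where
  "parameter_matrix r M =
     mat (length (row_labels r)) (length (col_labels r))
       (\<lambda>(p, q). param_entry r M (row_labels r ! p) (col_labels r ! q))"

definition minors :: "nat \<Rightarrow> int mat \<Rightarrow> int set" where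
  "minors k A =
     {det (submatrix A I J) | I J.
        I \<subseteq> {..<dim_row A} \<and> J \<subseteq> {..<dim_col A} \<and> card I = k \<and> card J = k}"

end

(* Write L for the lattice spanned by the rows of the parameter matrix in the free abelian group on
   its columns. Each of the three conditions, for an abelian quandle, says that L is everything.

   For the structure group, the commutators of generators g_a, g_b are central, bimultiplicative
   and depend only on the orbits i, j of a, b; moving a point around its orbit shows that they
   satisfy the relations of L, so they vanish if L is full. Conversely, the group with underlying
   set Z^r x (Z^columns / L) and multiplication twisted by the cocycle
   (u, u') |-> sum over i < j of u_i u'_j e_(i,j) receives a homomorphism from the structure group
   under which the commutator of orbits i < j becomes e_(i,j); if the structure group is abelian,
   all e_(i,j) lie in L.

   The parameter group is the quotient of Z^columns by L, because its relators identify x_(i-j) of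
   the j-th factor with the inverse of x_(j-i) of the i-th factor. Finally L is full iff the
   parameter matrix has an integral left inverse: expanding the determinant of the product
   multilinearly in the rows expresses 1 as a combination of maximal minors, and conversely the
   adjugate of each maximal square submatrix shows that its determinant multiplies everything
   into L.

   That the parameters exist and are unique is existence and uniqueness of the Hermite normal form
   of the stabilisers of the orbits in Z^(r-1). *)
theory Submission
  imports Defs "HOL-Computational_Algebra.Group_Closure"
begin

\<comment> \<open>The groups G(M) are quotients, so each map out of them would need an argument
  about representatives. Instead the orbits are parametrised by exponent vectors in Z^(r-1)
  (\<open>quandle_chart\<close>), maps are defined on these vectors, and the relators enter only
  through congruences modulo a lattice. That commutators depend only on orbits comes from
  conjugation: g_b conjugates g_a into the generator of \<open>tr a b\<close>, and in an abelian
  quandle \<open>tr a b\<close> depends on b only through its orbit. Hence generators from one orbit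
  differ by central factors. The twisted group is never built as a group: its two coordinates are
  computed by recursion on words (\<open>word_degree\<close>, \<open>charge\<close>). The cocycle
  counts, with signs, the pairs of letters in which the smaller orbit index comes first, so
  exchanging adjacent generators from orbits i < j changes it by e_(i,j). That a commutative
  structure group forces the quandle to be abelian rests on another invariant: words act on X by
  right translations, and compatibility with the defining relation is exactly
  self-distributivity.\<close>
alias lookup = Poly_Mapping.lookup
alias keys = Poly_Mapping.keys

section \<open>Maximal minors and left inverses\<close>

lemma submatrix_carrier:
  assumes "I \<subseteq> {..<dim_row A}" "J \<subseteq> {..<dim_col A}"
  shows "submatrix A I J \<in> carrier_mat (card I) (card J)"
proof -
  have "{i. i < dim_row A \<and> i \<in> I} = I" "{j. j < dim_col A \<and> j \<in> J} = J" using assms by auto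
  then show ?thesis by (auto simp: submatrix_def)
qed

lemma pick_lessThan: "q < n \<Longrightarrow> pick {..<n} q = q"
  using pick_reduce_set[of q n UNIV] by (simp add: pick_UNIV lessThan_def)

text \<open>If P is the 0/1 matrix that selects the rows in I, then P A is the square submatrix S,
  and adj(S) P is a left inverse of A up to the factor det S.\<close>

lemma scaled_one_left_multiple_if_minor:
  fixes A :: "int mat"
  assumes A: "A \<in> carrier_mat R n" and d: "d \<in> minors n A"
  shows "\<exists>B\<in>carrier_mat n R. B * A = d \<cdot>\<^sub>m 1\<^sub>m n"
proof -
  from d A obtain I J where IJ: "I \<subseteq> {..<R}" "J \<subseteq> {..<n}" "card I = n" "card J = n"
    and d_eq: "d = det (submatrix A I J)"
    by (auto simp: minors_def)
  \<comment> \<open>There are only n columns, so a minor of size n uses all of them.\<close>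
  have J: "J = {..<n}"
    using IJ(2,4) by (simp add: card_subset_eq)
  define S where "S = submatrix A I J"
  have S: "S \<in> carrier_mat n n"
    using submatrix_carrier[of I A J] IJ A by (auto simp: S_def)
  have pick: "pick I q < R" if "q < n" for q
    using pick_in_set_le[of q I] IJ that by auto
  define P :: "int mat" where "P = mat n R (\<lambda>(q, p). if p = pick I q then 1 else 0)"
  have P: "P \<in> carrier_mat n R" by (simp add: P_def)
  have "P * A = S"
  proof (rule eq_matI)
    fix q j assume "q < dim_row S" "j < dim_col S"
    then have q: "q < n" and j: "j < n" using S by auto
    have "(P * A) $$ (q, j) = (\<Sum>p\<in>{0..<R}. (if p = pick I q then 1 else 0) * A $$ (p, j))"
      using q j A by (simp add: P_def scalar_prod_def)
    also have "\<dots> = (\<Sum>p\<in>{0..<R}. if p = pick I q then A $$ (p, j) else 0)"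
      by (rule sum.cong) auto
    also have "\<dots> = A $$ (pick I q, j)" using pick[OF q] by simp
    also have "\<dots> = S $$ (q, j)"
    proof -
      have "{i. i < dim_row A \<and> i \<in> I} = I" "{j. j < dim_col A \<and> j \<in> J} = J" using IJ A by auto
      then show ?thesis
        using q j IJ pick_lessThan[OF j] J by (simp add: S_def submatrix_index)
    qed
    finally show "(P * A) $$ (q, j) = S $$ (q, j)" .
  qed (use S P A in auto)
  then have "(adj_mat S * P) * A = d \<cdot>\<^sub>m 1\<^sub>m n"
    using adj_mat[OF S] P A d_eq S_def by (simp add: assoc_mult_mat[of _ n n _ R _ n])
  moreover have "adj_mat S * P \<in> carrier_mat n R" using adj_mat(1)[OF S] P by simp
  ultimately show ?thesis by blast
qed

text \<open>The rows listed by f are those of a submatrix in another order, so the two determinants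
  agree up to the sign of a permutation.\<close>

lemma det_selected_rows_minor:
  fixes A :: "int mat"
  assumes A: "A \<in> carrier_mat R n" and f: "\<And>i. i < n \<Longrightarrow> f i < R" and inj: "inj_on f {0..<n}"
  shows "\<exists>d\<in>minors n A. d dvd det (mat n n (\<lambda>(i, j). A $$ (f i, j)))"
proof -
  define I where "I = f ` {0..<n}"
  have cI: "card I = n" unfolding I_def using inj by (simp add: card_image)
  have IR: "I \<subseteq> {..<R}" using f by (auto simp: I_def)
  have fin: "finite I" by (simp add: I_def)
  define S where "S = submatrix A I {..<n}"
  have S: "S \<in> carrier_mat n n"
    using submatrix_carrier[of I A "{..<n}"] IR A cI by (auto simp: S_def)
  have Sm: "det S \<in> minors n A"
    unfolding minors_def S_def using IR cI A by fastforce
  \<comment> \<open>The rank of \<open>f i\<close> in I is its row number in the submatrix. The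
    identity beyond n makes p a permutation in the sense of \<open>permutes\<close>.\<close>
  define p where "p i = (if i < n then card {a\<in>I. a < f i} else i)" for i
  have pick: "pick I (p i) = f i" if "i < n" for i
    using pick_card_in_set[of "f i" I] that by (auto simp: p_def I_def)
  have plt: "p i < n" if "i < n" for i
  proof -
    have "{a\<in>I. a < f i} \<subset> I" using that by (auto simp: I_def)
    then have "card {a\<in>I. a < f i} < card I" using fin by (rule psubset_card_mono[rotated])
    then show ?thesis using that cI by (simp add: p_def)
  qed
  have "inj_on p {0..<n}"
  proof (rule inj_onI)
    fix i j assume "i \<in> {0..<n}" "j \<in> {0..<n}" "p i = p j"
    then have "f i = f j" using pick by (metis atLeastLessThan_iff)
    then show "i = j" using inj \<open>i \<in> _\<close> \<open>j \<in> _\<close> by (meson inj_onD)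
  qed
  then have "p ` {0..<n} = {0..<n}"
    using plt by (intro endo_inj_surj) auto
  then have "bij_betw p {0..<n} {0..<n}"
    using \<open>inj_on p _\<close> by (simp add: bij_betw_def)
  then have p: "p permutes {0..<n}"
    by (rule bij_imp_permutes) (auto simp: p_def)
  have "mat n n (\<lambda>(i, j). A $$ (f i, j)) = mat n n (\<lambda>(i, j). S $$ (p i, j))"
  proof (rule eq_matI)
    fix i j
    assume "i < dim_row (mat n n (\<lambda>(i, j). S $$ (p i, j)))"
      "j < dim_col (mat n n (\<lambda>(i, j). S $$ (p i, j)))"
    then have i: "i < n" and j: "j < n" by auto
    have "{i. i < dim_row A \<and> i \<in> I} = I" "{j. j < dim_col A \<and> j \<in> {..<n}} = {..<n}" using IR A by auto
    then have "S $$ (p i, j) = A $$ (f i, j)"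
      using plt[OF i] j cI pick[OF i] pick_lessThan[OF j] by (simp add: S_def submatrix_index)
    then show "mat n n (\<lambda>(i, j). A $$ (f i, j)) $$ (i, j) = mat n n (\<lambda>(i, j). S $$ (p i, j)) $$ (i, j)"
      using i j by simp
  qed auto
  then have "det S dvd det (mat n n (\<lambda>(i, j). A $$ (f i, j)))"
    using det_permute_rows[OF S p] by simp
  then show ?thesis using Sm by blast
qed

text \<open>Forward: the integers d for which d times the identity is a left multiple of A form a
  subgroup of the integers; it contains the minors, hence their gcd. Backward: each term of the
  multilinear expansion either has a repeated row and vanishes, or is a multiple of a minor.\<close>

lemma Gcd_minors_eq_1_iff:
  fixes A :: "int mat"
  assumes A: "A \<in> carrier_mat R n"
  shows "Gcd (minors n A) = 1 \<longleftrightarrow> (\<exists>B\<in>carrier_mat n R. B * A = 1\<^sub>m n)"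
proof
  assume G: "Gcd (minors n A) = 1"
  define D where "D = {d. \<exists>B\<in>carrier_mat n R. B * A = d \<cdot>\<^sub>m 1\<^sub>m n}"
  have "d \<in> D" if "d \<in> group_closure (minors n A)" for d
    using that
  proof induction
    case (base s)
    have "0\<^sub>m n R * A = 0 \<cdot>\<^sub>m 1\<^sub>m n" using A by auto
    then have "0 \<in> D" unfolding D_def using zero_carrier_mat by blast
    then show ?case
      using base scaled_one_left_multiple_if_minor[OF A] by (auto simp: D_def)
  next
    case (diff s t)
    then obtain B B' where B: "B \<in> carrier_mat n R" "B * A = s \<cdot>\<^sub>m 1\<^sub>m n"
      and B': "B' \<in> carrier_mat n R" "B' * A = t \<cdot>\<^sub>m 1\<^sub>m n"
      by (auto simp: D_def)
    have "(B - B') * A = (s - t) \<cdot>\<^sub>m 1\<^sub>m n"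
      using B B' A by (subst minus_mult_distrib_mat) (auto simp: algebra_simps)
    moreover have "B - B' \<in> carrier_mat n R" using B(1) B'(1) by auto
    ultimately show ?case unfolding D_def by blast
  qed
  moreover have "1 \<in> group_closure (minors n A)"
    using Gcd_in_group_closure[of "minors n A"] G by simp
  ultimately have "1 \<in> D" by blast
  then obtain B where "B \<in> carrier_mat n R" "B * A = 1 \<cdot>\<^sub>m 1\<^sub>m n" by (auto simp: D_def)
  moreover have "(1::int) \<cdot>\<^sub>m 1\<^sub>m n = 1\<^sub>m n" by (rule eq_matI) auto
  ultimately show "\<exists>B\<in>carrier_mat n R. B * A = 1\<^sub>m n" by auto
next
  assume "\<exists>B\<in>carrier_mat n R. B * A = 1\<^sub>m n"
  then obtain B where B: "B \<in> carrier_mat n R" and BA: "B * A = 1\<^sub>m n" by blast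
  let ?g = "Gcd (minors n A)"
  \<comment> \<open>Row i of the product is the combination of the rows of A with coefficients from
    row i of B; \<open>det_linear_rows_sum\<close> expands exactly this shape.\<close>
  have "B * A = mat\<^sub>r n n (\<lambda>i. finsum_vec TYPE(int) n (\<lambda>k. B $$ (i, k) \<cdot>\<^sub>v row A k) {0..<R})"
    by (rule eq_matI)
       (use A B in \<open>auto simp: scalar_prod_def index_finsum_vec intro!: sum.cong\<close>)
  then have "1 = det (mat\<^sub>r n n (\<lambda>i. finsum_vec TYPE(int) n (\<lambda>k. B $$ (i, k) \<cdot>\<^sub>v row A k) {0..<R}))"
    using BA by (metis det_one)
  also have "\<dots> = (\<Sum>f \<in> {f. (\<forall>i\<in>{0..<n}. f i \<in> {0..<R}) \<and> (\<forall>i. i \<notin> {0..<n} \<longrightarrow> f i = i)}.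
      det (mat\<^sub>r n n (\<lambda>i. B $$ (i, f i) \<cdot>\<^sub>v row A (f i))))"
    by (rule det_linear_rows_sum) (use A in auto)
  also have "?g dvd \<dots>"
  proof (rule dvd_sum)
    fix f assume "f \<in> {f. (\<forall>i\<in>{0..<n}. f i \<in> {0..<R}) \<and> (\<forall>i. i \<notin> {0..<n} \<longrightarrow> f i = i)}"
    then have f: "f i < R" if "i < n" for i using that by auto
    have eq: "det (mat\<^sub>r n n (\<lambda>i. B $$ (i, f i) \<cdot>\<^sub>v row A (f i))) =
        (\<Prod>i = 0..<n. B $$ (i, f i)) * det (mat\<^sub>r n n (\<lambda>i. row A (f i)))"
      by (rule det_rows_mul) (use A f in auto)
    have m: "mat\<^sub>r n n (\<lambda>i. row A (f i)) = mat n n (\<lambda>(i, j). A $$ (f i, j))"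
      using A f by (intro eq_matI) auto
    have "?g dvd det (mat n n (\<lambda>(i, j). A $$ (f i, j)))"
    proof (cases "inj_on f {0..<n}")
      case True
      then show ?thesis using det_selected_rows_minor[OF A f] by (meson Gcd_dvd dvd_trans)
    next
      case False
      then obtain i j where "i < n" "j < n" "i \<noteq> j" "f i = f j" by (auto simp: inj_on_def)
      then have "det (mat n n (\<lambda>(i, j). A $$ (f i, j))) = 0"
        by (intro det_identical_rows[of _ n i j]) (auto intro!: eq_vecI)
      then show ?thesis by simp
    qed
    then show "?g dvd det (mat\<^sub>r n n (\<lambda>i. B $$ (i, f i) \<cdot>\<^sub>v row A (f i)))"
      unfolding eq m by simp
  qed
  finally show "?g = 1" by (simp add: zdvd1_eq)
qed

section \<open>Hermite normal form of a subgroup of finite index\<close>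

lemma group_closure_least:
  assumes "v \<in> group_closure S" "S \<subseteq> K" "0 \<in> K" "\<And>a b. a \<in> K \<Longrightarrow> b \<in> K \<Longrightarrow> a - b \<in> K"
  shows "v \<in> K"
  using assms(1) by induction (use assms(2-4) in auto)

lemma frag_cmul_closed:
  assumes "0 \<in> K" "\<And>a b. a \<in> K \<Longrightarrow> b \<in> K \<Longrightarrow> a - b \<in> K" "v \<in> K"
  shows "frag_cmul c v \<in> K"
  by (rule frag_closure_minus_cmul[where P = "\<lambda>v. v \<in> K"]) (use assms in auto)

lemma group_closure_frag_cmul:
  "v \<in> group_closure S \<Longrightarrow> frag_cmul c v \<in> group_closure S"
  by (rule frag_cmul_closed) (auto intro: group_closure.diff)

lemma group_closure_sum_in:
  "(\<And>i. i \<in> I \<Longrightarrow> f i \<in> group_closure S) \<Longrightarrow> sum f I \<in> group_closure S"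
  by (induction I rule: infinite_finite_induct) (auto intro: group_closure_add)

text \<open>The coefficients are indexed by I and not by the image, so repeated values of f do no
  harm; rows of a matrix may coincide.\<close>

lemma group_closure_image_frag:
  assumes "finite I" "v \<in> group_closure (f ` I)"
  shows "\<exists>c. v = (\<Sum>k\<in>I. frag_cmul (c k) (f k))"
  using assms(2)
proof induction
  case (base s)
  then consider "s = 0" | k where "k \<in> I" "s = f k" by auto
  then show ?case
  proof cases
    case 1
    then show ?thesis by (intro exI[of _ "\<lambda>_. 0"]) simp
  next
    case 2
    have "(\<Sum>l\<in>I. frag_cmul (if l = k then 1 else 0) (f l)) = (\<Sum>l\<in>I. if l = k then f k else 0)"
      by (rule sum.cong) auto
    then show ?thesis using 2 assms(1) by (intro exI[of _ "\<lambda>l. if l = k then 1 else 0"]) simp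
  qed
next
  case (diff s t)
  then obtain c c' where "s = (\<Sum>k\<in>I. frag_cmul (c k) (f k))" "t = (\<Sum>k\<in>I. frag_cmul (c' k) (f k))"
    by blast
  then have "s - t = (\<Sum>k\<in>I. frag_cmul (c k - c' k) (f k))"
    by (simp add: frag_cmul_diff_distrib sum_subtractf)
  then show ?case by (rule exI[of _ "\<lambda>k. c k - c' k"])
qed

text \<open>The bridge from the group record to plain addition of finitely supported functions, in
  which all lattice computations take place.\<close>

lemma generate_free_Abelian_group:
  assumes "S \<subseteq> carrier (free_Abelian_group I)"
  shows "generate (free_Abelian_group I) S = group_closure S"
proof
  interpret group "free_Abelian_group I" by simp
  have sub: "subgroup (generate (free_Abelian_group I) S) (free_Abelian_group I)"
    using assms by (rule generate_is_subgroup)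
  show "generate (free_Abelian_group I) S \<subseteq> group_closure S"
  proof
    fix v assume "v \<in> generate (free_Abelian_group I) S"
    then show "v \<in> group_closure S"
    proof induction
      case (inv h)
      then have "inv\<^bsub>free_Abelian_group I\<^esub> h = - h" using assms by auto
      then show ?case using inv by (simp add: group_closure.base)
    qed (auto intro: group_closure.base group_closure_add)
  qed
  show "group_closure S \<subseteq> generate (free_Abelian_group I) S"
  proof
    fix v assume "v \<in> group_closure S"
    then show "v \<in> generate (free_Abelian_group I) S"
    proof (rule group_closure_least)
      fix a b
      assume a: "a \<in> generate (free_Abelian_group I) S" and b: "b \<in> generate (free_Abelian_group I) S"
      then have "a \<otimes>\<^bsub>free_Abelian_group I\<^esub> inv\<^bsub>free_Abelian_group I\<^esub> b \<in> generate (free_Abelian_group I) S"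
        using sub by (meson subgroup.m_closed subgroup.m_inv_closed)
      moreover have "Poly_Mapping.keys b \<subseteq> I"
        using subgroup.mem_carrier[OF sub b] by simp
      ultimately show "a - b \<in> generate (free_Abelian_group I) S" by simp
    qed (use generate.one[of "free_Abelian_group I" S] in \<open>auto intro: generate.incl\<close>)
  qed
qed

lemma keys_diff_subset: "keys a \<subseteq> S \<Longrightarrow> keys b \<subseteq> S \<Longrightarrow> keys (a - b) \<subseteq> S"
  by (rule order_trans[OF keys_diff]) simp

lemma keys_add_subset: "keys a \<subseteq> S \<Longrightarrow> keys b \<subseteq> S \<Longrightarrow> keys (a + b) \<subseteq> S"
  by (rule order_trans[OF Poly_Mapping.keys_add]) simp

lemma keys_frag_cmul_subset: "keys a \<subseteq> S \<Longrightarrow> keys (frag_cmul c a) \<subseteq> S"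
  by (rule order_trans[OF keys_cmul])

lemma lookup_relator:
  "lookup (relator m j) k = (if 1 \<le> k \<and> k \<le> j then m j k else 0)"
proof -
  have "lookup (relator m j) k = (\<Sum>l = 1..j. if l = k then m j k else 0)"
    unfolding relator_def lookup_sum
    by (rule sum.cong) (auto simp: lookup_frag_of)
  then show ?thesis by auto
qed

lemma keys_relator: "keys (relator m j) \<subseteq> {1..j}"
  using lookup_relator[of m j] by (auto simp: in_keys_iff split: if_splits)

lemma relator_subgroup_eq:
  "relator_subgroup r m = group_closure (relator m ` {1..<r})"
  unfolding relator_subgroup_def
  by (rule generate_free_Abelian_group) (use keys_relator in force)

lemma relator_subgroup_keys: "v \<in> relator_subgroup r m \<Longrightarrow> keys v \<subseteq> {1..<r}"
  unfolding relator_subgroup_eq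
proof (induction rule: group_closure.induct)
  case (base s)
  then show ?case using keys_relator[of m] by fastforce
next
  case (diff s t)
  then show ?case by (simp add: keys_diff_subset)
qed

section \<open>Uniqueness and existence of the normal form\<close>

lemma parameter_collectionD:
  assumes "parameter_collection r m"
  shows "1 \<le> i \<Longrightarrow> i < r \<Longrightarrow> m i i \<ge> 1"
    and "1 \<le> i \<Longrightarrow> i < j \<Longrightarrow> j < r \<Longrightarrow> 0 \<le> m j i"
    and "1 \<le> i \<Longrightarrow> i < j \<Longrightarrow> j < r \<Longrightarrow> m j i < m i i"
    and "\<not> (1 \<le> j \<and> j \<le> i \<and> i < r) \<Longrightarrow> m i j = 0"
  using assms unfolding parameter_collection_def by blast+

text \<open>The relators are triangular: those before i have no coordinate i, and those after i have
  coefficient 0 by assumption.\<close>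

lemma lookup_relator_combination:
  assumes m: "parameter_collection r m" and i: "1 \<le> i" "i < r"
    and c: "\<And>k. i < k \<Longrightarrow> k < r \<Longrightarrow> c k = 0"
  shows "lookup (\<Sum>k\<in>{1..<r}. frag_cmul (c k) (relator m k)) i = c i * m i i"
proof -
  have "lookup (\<Sum>k\<in>{1..<r}. frag_cmul (c k) (relator m k)) i = (\<Sum>k\<in>{1..<r}. c k * lookup (relator m k) i)"
    by (simp add: lookup_sum)
  also have "\<dots> = (\<Sum>k\<in>{1..<r}. if k = i then c i * m i i else 0)"
    by (rule sum.cong) (use i c in \<open>auto simp: lookup_relator\<close>)
  finally show ?thesis using i by simp
qed

text \<open>A lattice vector supported on 1, ..., i is a combination of the first i relators alone,
  and of these only the i-th reaches coordinate i.\<close>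

lemma diagonal_dvd_leading_coeff:
  assumes m: "parameter_collection r m" and v: "v \<in> relator_subgroup r m" "keys v \<subseteq> {1..i}"
    and i: "1 \<le> i" "i < r"
  shows "m i i dvd lookup v i"
proof -
  obtain c where c: "v = (\<Sum>k\<in>{1..<r}. frag_cmul (c k) (relator m k))"
    using group_closure_image_frag[of "{1..<r}" v "relator m"] v(1) by (auto simp: relator_subgroup_eq)
  have "c k = 0" if "i < k" "k < r" for k
  proof (rule ccontr)
    assume "c k \<noteq> 0"
    \<comment> \<open>The last relator l > i with a nonzero coefficient would leave c_l m_(l,l),
      which is nonzero, in coordinate l, outside the support of v.\<close>
    define T where "T = {k. i < k \<and> k < r \<and> c k \<noteq> 0}"
    have T: "finite T" "T \<noteq> {}" using that \<open>c k \<noteq> 0\<close> by (auto simp: T_def)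
    define l where "l = Max T"
    have "l \<in> T" using Max_in[OF T] by (simp add: l_def)
    then have l: "i < l" "l < r" "c l \<noteq> 0" by (auto simp: T_def)
    have "c k = 0" if "l < k" "k < r" for k
    proof (rule ccontr)
      assume "c k \<noteq> 0"
      then have "k \<in> T" using that l by (auto simp: T_def)
      then have "k \<le> l" using T by (simp add: l_def)
      then show False using that by simp
    qed
    then have "lookup v l = c l * m l l"
      using lookup_relator_combination[OF m] i l by (simp add: c)
    moreover have "m l l \<ge> 1" using parameter_collectionD(1)[OF m, of l] i l by simp
    ultimately have "lookup v l \<noteq> 0" using l by auto
    then show False using v(2) l by (auto simp: in_keys_iff)
  qed
  then show ?thesis using lookup_relator_combination[OF m i] by (simp add: c)
qed

text \<open>The diagonal entries divide each other. If the rows j differ, the last differing column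
  l carries the leading coefficient of their difference; it is a multiple of \<open>m l l\<close>,
  yet both entries lie between 0 and \<open>m l l\<close> - 1.\<close>

lemma parameter_collection_unique:
  assumes m: "parameter_collection r m" and m': "parameter_collection r m'"
    and eq: "relator_subgroup r m = relator_subgroup r m'"
  shows "m = m'"
proof -
  have rel: "relator m i \<in> relator_subgroup r m" "relator m' i \<in> relator_subgroup r m'" if "1 \<le> i" "i < r" for i
    using that by (auto simp: relator_subgroup_eq intro!: group_closure.base)
  have diag: "m i i = m' i i" if i: "1 \<le> i" "i < r" for i
  proof -
    have "m i i dvd lookup (relator m' i) i"
      by (rule diagonal_dvd_leading_coeff[OF m _ keys_relator i]) (use rel i eq in auto)
    moreover have "m' i i dvd lookup (relator m i) i"
      by (rule diagonal_dvd_leading_coeff[OF m' _ keys_relator i]) (use rel i eq in auto)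
    moreover have "m i i \<ge> 0" "m' i i \<ge> 0"
      using parameter_collectionD(1)[OF m i] parameter_collectionD(1)[OF m' i] by simp_all
    ultimately show ?thesis using i by (simp add: lookup_relator zdvd_antisym_nonneg)
  qed
  have "m j i = m' j i" if i: "1 \<le> i" "i < j" and j: "j < r" for i j
  proof (rule ccontr)
    assume "m j i \<noteq> m' j i"
    define T where "T = {i. 1 \<le> i \<and> i < j \<and> m j i \<noteq> m' j i}"
    have T: "finite T" "T \<noteq> {}" using i \<open>m j i \<noteq> m' j i\<close> by (auto simp: T_def)
    define l where "l = Max T"
    have "l \<in> T" using Max_in[OF T] by (simp add: l_def)
    then have l: "1 \<le> l" "l < j" "m j l \<noteq> m' j l" by (auto simp: T_def)
    let ?w = "relator m j - relator m' j"
    have "m j k = m' j k" if "l < k" "k \<le> j" for k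
    proof (cases "k = j")
      case False
      show ?thesis
      proof (rule ccontr)
        assume "m j k \<noteq> m' j k"
        then have "k \<in> T" using that l False by (auto simp: T_def)
        then have "k \<le> l" using T by (simp add: l_def)
        then show False using that by simp
      qed
    qed (use diag i j in auto)
    then have keys: "keys ?w \<subseteq> {1..l}"
      by (auto simp: in_keys_iff lookup_minus lookup_relator split: if_splits) (metis linorder_not_less)
    have "?w \<in> relator_subgroup r m"
      using rel[of j] eq i j unfolding relator_subgroup_eq by (auto intro: group_closure.diff)
    from diagonal_dvd_leading_coeff[OF m this keys] have "m l l dvd m j l - m' j l"
      using l j by (simp add: lookup_minus lookup_relator)
    moreover have "\<bar>m j l - m' j l\<bar> < m l l"
      using parameter_collectionD(2,3)[OF m l(1,2) j] parameter_collectionD(2,3)[OF m' l(1,2) j]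
        diag[of l] l(1,2) j by linarith
    ultimately show False using dvd_imp_le_int[of "m j l - m' j l" "m l l"] l by linarith
  qed
  then have "m j i = m' j i" for i j
    using diag[of i] parameter_collectionD(4)[OF m, of i j] parameter_collectionD(4)[OF m', of i j]
    by (metis le_less)
  then show ?thesis by blast
qed

text \<open>For each i, choose in K a vector supported on 1, ..., i with least positive leading
  coefficient; the finite order of each x_i modulo K guarantees one. Division with remainder shows
  that it divides all other leading coefficients. The entries left of the diagonal are then reduced
  by subtracting multiples of earlier vectors.\<close>

lemma parameter_collection_exists:
  assumes K0: "0 \<in> K" and Kd: "\<And>a b. a \<in> K \<Longrightarrow> b \<in> K \<Longrightarrow> a - b \<in> K"
    and Kk: "\<And>v. v \<in> K \<Longrightarrow> keys v \<subseteq> {1..<r}"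
    and fin: "\<And>i. 1 \<le> i \<Longrightarrow> i < r \<Longrightarrow> \<exists>n>0. frag_cmul n (frag_of i) \<in> K"
  shows "\<exists>m. parameter_collection r m \<and> relator_subgroup r m = K"
proof -
  have Kc: "frag_cmul c v \<in> K" if "v \<in> K" for c v
    using frag_cmul_closed[OF K0 Kd that] .
  have Ka: "a + b \<in> K" if "a \<in> K" "b \<in> K" for a b
    using Kd[OF that(1) Kd[OF K0 that(2)]] by simp
  have "\<exists>p\<in>K. keys p \<subseteq> {1..i} \<and> lookup p i \<ge> 1 \<and> (\<forall>v\<in>K. keys v \<subseteq> {1..i} \<longrightarrow> lookup p i dvd lookup v i)"
    if i: "1 \<le> i" "i < r" for i
  proof -
    define Q where "Q n \<longleftrightarrow> n > 0 \<and> (\<exists>v\<in>K. keys v \<subseteq> {1..i} \<and> lookup v i = int n)" for n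
    obtain n where n: "n > 0" "frag_cmul n (frag_of i) \<in> K" using fin[OF i] by blast
    have "Q (nat n)"
      unfolding Q_def using n i by (auto intro!: bexI[of _ "frag_cmul n (frag_of i)"] simp: keys_cmul_iff lookup_frag_of)
    then have least: "Q (LEAST n. Q n)" by (rule LeastI)
    define d where "d = (LEAST n. Q n)"
    from least obtain p where d: "d > 0" and p: "p \<in> K" "keys p \<subseteq> {1..i}" "lookup p i = int d"
      unfolding d_def[symmetric] by (auto simp: Q_def)
    have "int d dvd lookup v i" if v: "v \<in> K" "keys v \<subseteq> {1..i}" for v
    proof (rule ccontr)
      assume nd: "\<not> int d dvd lookup v i"
      let ?w = "v - frag_cmul (lookup v i div int d) p"
      have w: "lookup ?w i = lookup v i mod int d"
        using p by (simp add: lookup_minus minus_div_mult_eq_mod)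
      have "lookup v i mod int d \<noteq> 0" "lookup v i mod int d \<ge> 0" "lookup v i mod int d < int d"
        using nd d by (auto simp: dvd_eq_mod_eq_0)
      moreover have "?w \<in> K" using v p by (intro Kd Kc)
      moreover have "keys ?w \<subseteq> {1..i}"
        using v p by (intro keys_diff_subset keys_frag_cmul_subset)
      ultimately have "Q (nat (lookup v i mod int d))" and lt: "nat (lookup v i mod int d) < d"
        unfolding Q_def using w by auto
      then have "d \<le> nat (lookup v i mod int d)" unfolding d_def by (blast intro: Least_le)
      then show False using lt by simp
    qed
    then show ?thesis using d p by (intro bexI[of _ p]) auto
  qed
  then have "\<forall>i\<in>{1..<r}. \<exists>p. p \<in> K \<and> keys p \<subseteq> {1..i} \<and> lookup p i \<ge> 1 \<and>
      (\<forall>v\<in>K. keys v \<subseteq> {1..i} \<longrightarrow> lookup p i dvd lookup v i)"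
    by (auto simp: Bex_def)
  from bchoice[OF this] obtain p where "\<forall>i\<in>{1..<r}. p i \<in> K \<and> keys (p i) \<subseteq> {1..i} \<and>
      lookup (p i) i \<ge> 1 \<and> (\<forall>v\<in>K. keys v \<subseteq> {1..i} \<longrightarrow> lookup (p i) i dvd lookup v i)" ..
  then have p: "p i \<in> K" "keys (p i) \<subseteq> {1..i}" "lookup (p i) i \<ge> 1"
    and pd: "\<And>v. v \<in> K \<Longrightarrow> keys v \<subseteq> {1..i} \<Longrightarrow> lookup (p i) i dvd lookup v i"
    if "1 \<le> i" "i < r" for i
    using that by auto
  define d where "d i = lookup (p i) i" for i
  \<comment> \<open>Reduction runs leftwards from the diagonal, and t counts the columns already
    done. Subtracting a multiple of \<open>p i\<close> changes only columns up to i, so the finished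
    ones on its right stay reduced.\<close>
  have "\<exists>v\<in>K. keys v \<subseteq> {1..j} \<and> lookup v j = d j \<and>
      (\<forall>i. 1 \<le> i \<and> j \<le> i + t \<and> i < j \<longrightarrow> 0 \<le> lookup v i \<and> lookup v i < d i)"
    if j: "1 \<le> j" "j < r" for j t
  proof (induction t)
    case 0
    then show ?case using p[OF j] by (intro bexI[of _ "p j"]) (auto simp: d_def)
  next
    case (Suc t)
    then obtain v where v: "v \<in> K" "keys v \<subseteq> {1..j}" "lookup v j = d j"
      "\<And>i. 1 \<le> i \<Longrightarrow> j \<le> i + t \<Longrightarrow> i < j \<Longrightarrow> 0 \<le> lookup v i \<and> lookup v i < d i" by blast
    show ?case
    proof (cases "Suc t < j")
      case False
      then have "j \<le> i + t" if "1 \<le> i" for i using that by simp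
      then show ?thesis using v by (intro bexI[of _ v]) auto
    next
      case True
      define i where "i = j - Suc t"
      have i: "1 \<le> i" "i < r" "i < j" using True j by (auto simp: i_def)
      note pi = p[OF i(1,2)]
      let ?w = "v - frag_cmul (lookup v i div d i) (p i)"
      have "?w \<in> K" using v pi by (intro Kd Kc)
      moreover have "keys ?w \<subseteq> {1..j}"
        using v pi i by (intro keys_diff_subset keys_frag_cmul_subset) auto
      moreover have "lookup (p i) k = 0" if "i < k" for k
        using pi(2) that by (auto simp: in_keys_iff subset_iff)
      then have wk: "lookup ?w k = lookup v k" if "i < k" for k
        using that by (simp add: lookup_minus)
      moreover have wi: "lookup ?w i = lookup v i mod d i"
        by (simp add: lookup_minus d_def minus_div_mult_eq_mod)
      moreover have red: "0 \<le> lookup v i mod d i" "lookup v i mod d i < d i" using pi(3) by (auto simp: d_def)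
      ultimately show ?thesis
        using v i
      proof (intro bexI[of _ ?w] conjI allI impI)
        fix k assume k: "1 \<le> k \<and> j \<le> k + Suc t \<and> k < j"
        have "0 \<le> lookup ?w k \<and> lookup ?w k < d k"
        proof (cases "k = i")
          case True
          then show ?thesis using wi red by metis
        next
          case False
          then have "i < k" "j \<le> k + t" using k unfolding i_def by linarith+
          then show ?thesis using wk[of k] v(4)[of k] k by metis
        qed
        then show "0 \<le> lookup ?w k" "lookup ?w k < d k" by blast+
      qed auto
    qed
  qed
  \<comment> \<open>With t = r the condition \<open>j \<le> i + t\<close> holds for every column, so
    the whole row is reduced.\<close>
  from this[of _ r] have "\<forall>j\<in>{1..<r}. \<exists>v. v \<in> K \<and> keys v \<subseteq> {1..j} \<and> lookup v j = d j \<and>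
      (\<forall>i. 1 \<le> i \<and> i < j \<longrightarrow> 0 \<le> lookup v i \<and> lookup v i < d i)"
    by (fastforce simp: Bex_def)
  from bchoice[OF this] obtain \<rho> where "\<forall>j\<in>{1..<r}. \<rho> j \<in> K \<and> keys (\<rho> j) \<subseteq> {1..j} \<and>
      lookup (\<rho> j) j = d j \<and> (\<forall>i. 1 \<le> i \<and> i < j \<longrightarrow> 0 \<le> lookup (\<rho> j) i \<and> lookup (\<rho> j) i < d i)" ..
  then have rho: "\<rho> j \<in> K" "keys (\<rho> j) \<subseteq> {1..j}" "lookup (\<rho> j) j = d j"
    and rho_red: "\<And>i. 1 \<le> i \<Longrightarrow> i < j \<Longrightarrow> 0 \<le> lookup (\<rho> j) i \<and> lookup (\<rho> j) i < d i"
    if "1 \<le> j" "j < r" for j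
    using that by auto
  define m where "m j i = (if 1 \<le> i \<and> i \<le> j \<and> j < r then lookup (\<rho> j) i else 0)" for j i
  have rel: "relator m j = \<rho> j" if "1 \<le> j" "j < r" for j
  proof (rule poly_mapping_eqI)
    fix k
    show "lookup (relator m j) k = lookup (\<rho> j) k"
      using rho(2)[OF that] that by (auto simp: lookup_relator m_def in_keys_iff subset_iff)
  qed
  have mc: "parameter_collection r m"
    unfolding parameter_collection_def using rho(3) rho_red p(3) by (auto simp: m_def d_def)
  \<comment> \<open>Elimination from the top: the leading coefficient of v is a multiple of
    \<open>d (Suc i)\<close>, so subtracting a multiple of the row shortens the support.\<close>
  have span: "v \<in> relator_subgroup r m" if "v \<in> K" "keys v \<subseteq> {1..i}" "i < r" for v i
    using that
  proof (induction i arbitrary: v)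
    case 0
    then have "v = 0" by (simp add: keys_eq_empty)
    then show ?case by (simp add: relator_subgroup_eq)
  next
    case (Suc i)
    have i: "1 \<le> Suc i" by simp
    note rhoi = rho[OF i Suc.prems(3)]
    obtain q where q: "lookup v (Suc i) = d (Suc i) * q"
      using pd[OF i Suc.prems(3,1,2)] by (auto simp: d_def)
    let ?w = "v - frag_cmul q (\<rho> (Suc i))"
    have "?w \<in> K" using Suc.prems rhoi by (intro Kd Kc)
    moreover have "keys ?w \<subseteq> {1..i}"
    proof
      fix k assume k: "k \<in> keys ?w"
      then have "k \<in> {1..Suc i}"
        using keys_diff_subset[OF Suc.prems(2) keys_frag_cmul_subset[OF rhoi(2)]] by blast
      moreover have "k \<noteq> Suc i" using k q rhoi by (auto simp: in_keys_iff lookup_minus)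
      ultimately show "k \<in> {1..i}" by auto
    qed
    ultimately have "?w \<in> relator_subgroup r m" using Suc by auto
    moreover have "\<rho> (Suc i) \<in> relator_subgroup r m"
      using rel[OF i Suc.prems(3)] Suc.prems(3) by (force simp: relator_subgroup_eq intro!: group_closure.base)
    ultimately have "?w + frag_cmul q (\<rho> (Suc i)) \<in> relator_subgroup r m"
      unfolding relator_subgroup_eq by (intro group_closure_add group_closure_frag_cmul)
    then show ?case by simp
  qed
  have "K \<subseteq> relator_subgroup r m"
  proof
    fix v assume v: "v \<in> K"
    show "v \<in> relator_subgroup r m"
    proof (cases r)
      case 0
      then have "v = 0" using Kk[OF v] by (simp add: keys_eq_empty)
      then show ?thesis by (simp add: relator_subgroup_eq)
    next
      case (Suc n)
      then have "{1..<r} = {1..n}" by auto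
      then show ?thesis using Kk[OF v] span[OF v, of n] Suc by simp
    qed
  qed
  moreover have "relator_subgroup r m \<subseteq> K"
    unfolding relator_subgroup_eq
    by (rule subsetI, erule group_closure_least) (use rel rho(1) K0 Kd in auto)
  ultimately show ?thesis using mc by blast
qed

section \<open>Quandles with parameters\<close>

declare One_nat_def [simp del]

section \<open>The groups G(M) as cosets of exponent vectors\<close>

lemma relator_subgroup_0: "0 \<in> relator_subgroup r m"
  by (simp add: relator_subgroup_eq)

lemma relator_subgroup_diff:
  "a \<in> relator_subgroup r m \<Longrightarrow> b \<in> relator_subgroup r m \<Longrightarrow> a - b \<in> relator_subgroup r m"
  by (simp add: relator_subgroup_eq group_closure.diff)

lemma relator_subgroup_add:
  "a \<in> relator_subgroup r m \<Longrightarrow> b \<in> relator_subgroup r m \<Longrightarrow> a + b \<in> relator_subgroup r m"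
  by (simp add: relator_subgroup_eq group_closure_add)

lemma relator_subgroup_normal: "relator_subgroup r m \<lhd> free_Abelian_group {1..<r}"
proof (rule group.normalI)
  have "relator m ` {1..<r} \<subseteq> carrier (free_Abelian_group {1..<r})"
    using keys_relator[of m] by force
  then show "subgroup (relator_subgroup r m) (free_Abelian_group {1..<r})"
    unfolding relator_subgroup_def by (intro group.generate_is_subgroup) simp_all
  show "\<forall>x\<in>carrier (free_Abelian_group {1..<r}).
      relator_subgroup r m #>\<^bsub>free_Abelian_group {1..<r}\<^esub> x =
      x <#\<^bsub>free_Abelian_group {1..<r}\<^esub> relator_subgroup r m"
    by (auto simp: r_coset_def l_coset_def add.commute)
qed simp

definition relator_coset :: "nat \<Rightarrow> (nat \<Rightarrow> nat \<Rightarrow> int) \<Rightarrow> (nat \<Rightarrow>\<^sub>0 int) \<Rightarrow> (nat \<Rightarrow>\<^sub>0 int) set" where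
  "relator_coset r m v = relator_subgroup r m #>\<^bsub>free_Abelian_group {1..<r}\<^esub> v"

lemma in_relator_coset_iff: "w \<in> relator_coset r m v \<longleftrightarrow> w - v \<in> relator_subgroup r m"
  by (force simp: relator_coset_def r_coset_def)

lemma relator_coset_eq_iff:
  "relator_coset r m v = relator_coset r m w \<longleftrightarrow> v - w \<in> relator_subgroup r m"
proof
  assume "relator_coset r m v = relator_coset r m w"
  moreover have "v \<in> relator_coset r m v" by (simp add: in_relator_coset_iff relator_subgroup_0)
  ultimately show "v - w \<in> relator_subgroup r m" by (simp add: in_relator_coset_iff)
next
  assume vw: "v - w \<in> relator_subgroup r m"
  have "x - v \<in> relator_subgroup r m \<longleftrightarrow> x - w \<in> relator_subgroup r m" for x
    using relator_subgroup_add[OF _ vw, of "x - v"] relator_subgroup_diff[OF _ vw, of "x - w"] by auto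
  then show "relator_coset r m v = relator_coset r m w"
    by (auto simp: in_relator_coset_iff)
qed

lemma carrier_param_G: "carrier (param_G r m) = relator_coset r m ` {v. keys v \<subseteq> {1..<r}}"
  unfolding param_G_def FactGroup_def RCOSETS_def relator_coset_def by auto

lemma group_param_G: "group (param_G r m)"
  unfolding param_G_def by (rule normal.factorgroup_is_group[OF relator_subgroup_normal])

lemma mult_param_G:
  assumes "keys v \<subseteq> {1..<r}" "keys w \<subseteq> {1..<r}"
  shows "relator_coset r m v \<otimes>\<^bsub>param_G r m\<^esub> relator_coset r m w = relator_coset r m (v + w)"
  using normal.rcos_sum[OF relator_subgroup_normal, of v r w m] assms
  by (simp add: param_G_def FactGroup_def relator_coset_def)

lemma one_param_G: "\<one>\<^bsub>param_G r m\<^esub> = relator_coset r m 0"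
  by (simp add: param_G_def FactGroup_def relator_coset_def r_coset_def)

text \<open>Lifts \<open>param_x\<close> to exponent vectors, including the convention x_0 =
  1.\<close>

definition step :: "nat \<Rightarrow> (nat \<Rightarrow>\<^sub>0 int)" where
  "step k = (if k = 0 then 0 else frag_of k)"

lemma param_x_eq: "param_x r m k = relator_coset r m (step k)"
  by (simp add: param_x_def step_def one_param_G relator_coset_def[of r m "frag_of k"])

lemma diff_mod_less: "r \<ge> 1 \<Longrightarrow> diff_mod r j i < r"
  by (simp add: diff_mod_def nat_less_iff)

lemma keys_step: "k < r \<Longrightarrow> keys (step k) \<subseteq> {1..<r}"
  by (simp add: step_def)

lemma keys_step_diff_mod: "i \<in> {1..r} \<Longrightarrow> keys (step (diff_mod r j i)) \<subseteq> {1..<r}"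
  by (rule keys_step) (auto intro: diff_mod_less)

text \<open>The orbit index i + k modulo r, with representatives 1, ..., r rather than 0, ..., r -
  1. For fixed i it is inverse to the difference \<open>diff_mod r j i\<close>.\<close>

definition shift :: "nat \<Rightarrow> nat \<Rightarrow> nat \<Rightarrow> nat" where
  "shift r i k = (if i + k \<le> r then i + k else i + k - r)"

lemma diff_mod_eq:
  assumes "i \<in> {1..r}" "j \<in> {1..r}"
  shows "diff_mod r j i = (if i \<le> j then j - i else j + r - i)"
proof (cases "i \<le> j")
  case True
  then have "(int j - int i) mod int r = int j - int i" using assms by (intro mod_pos_pos_trivial) auto
  then show ?thesis using True by (simp add: diff_mod_def)
next
  case False
  have "(int j - int i) mod int r = (int j - int i + int r) mod int r" by simp
  also have "\<dots> = int j - int i + int r" using False assms by (intro mod_pos_pos_trivial) auto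
  finally show ?thesis using False assms by (simp add: diff_mod_def)
qed

lemma shift_diff_mod: "i \<in> {1..r} \<Longrightarrow> j \<in> {1..r} \<Longrightarrow> shift r i (diff_mod r j i) = j"
  by (auto simp: diff_mod_eq shift_def)

lemma shift_in: "i \<in> {1..r} \<Longrightarrow> k < r \<Longrightarrow> shift r i k \<in> {1..r}"
  by (auto simp: shift_def)

lemma diff_mod_shift: "i \<in> {1..r} \<Longrightarrow> k < r \<Longrightarrow> diff_mod r (shift r i k) i = k"
  using shift_in[of i r k] by (subst diff_mod_eq) (auto simp: shift_def)

lemma diff_mod_self: "diff_mod r i i = 0"
  by (simp add: diff_mod_def)

lemma singleton_times_image: "{i} \<times> h ` A = (\<lambda>v. (i, h v)) ` A"
  by auto

text \<open>An isomorphism onto Q(M_1, ..., M_r), read backwards and composed with the projections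
  from Z^(r-1) to the groups G(M_i): \<open>pt i v\<close> is the point of the i-th orbit with
  exponent vector v. Points have many coordinates, and \<open>pt_eq_iff\<close> says how they
  differ.\<close>

locale quandle_chart =
  fixes X :: "'a set" and tr :: "'a \<Rightarrow> 'a \<Rightarrow> 'a" and r :: nat
    and M :: "nat \<Rightarrow> nat \<Rightarrow> nat \<Rightarrow> int" and pt :: "nat \<Rightarrow> (nat \<Rightarrow>\<^sub>0 int) \<Rightarrow> 'a"
  assumes collection: "i \<in> {1..r} \<Longrightarrow> parameter_collection r (M i)"
    and pt_in: "i \<in> {1..r} \<Longrightarrow> keys v \<subseteq> {1..<r} \<Longrightarrow> pt i v \<in> X"
    and pt_surj: "x \<in> X \<Longrightarrow> \<exists>i\<in>{1..r}. \<exists>v. keys v \<subseteq> {1..<r} \<and> x = pt i v"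
    and pt_eq_iff: "i \<in> {1..r} \<Longrightarrow> j \<in> {1..r} \<Longrightarrow> keys v \<subseteq> {1..<r} \<Longrightarrow> keys w \<subseteq> {1..<r} \<Longrightarrow>
      pt i v = pt j w \<longleftrightarrow> i = j \<and> v - w \<in> relator_subgroup r (M i)"
    and pt_op: "i \<in> {1..r} \<Longrightarrow> j \<in> {1..r} \<Longrightarrow> keys v \<subseteq> {1..<r} \<Longrightarrow> keys w \<subseteq> {1..<r} \<Longrightarrow>
      tr (pt i v) (pt j w) = pt i (v + step (diff_mod r j i))"

lemma chart_if_are_parameters:
  assumes ap: "are_parameters X tr r Os M" and Os: "\<And>i. i \<in> {1..r} \<Longrightarrow> Os i \<subseteq> X"
    and closed: "\<And>a b. a \<in> X \<Longrightarrow> b \<in> X \<Longrightarrow> tr a b \<in> X"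
  shows "\<exists>pt. quandle_chart X tr r M pt \<and> (\<forall>i\<in>{1..r}. Os i = pt i ` {v. keys v \<subseteq> {1..<r}})"
proof -
  from ap obtain f where iso: "quandle_iso X tr (param_Q_carrier r M) (param_Q_op r M) f"
    and fO: "\<forall>i\<in>{1..r}. f ` Os i = {i} \<times> carrier (param_G r (M i))"
    unfolding are_parameters_def by meson
  then have bij: "bij_betw f X (param_Q_carrier r M)"
    and op: "\<And>a b. a \<in> X \<Longrightarrow> b \<in> X \<Longrightarrow> f (tr a b) = param_Q_op r M (f a) (f b)"
    unfolding quandle_iso_def by auto
  have coll: "\<And>i. i \<in> {1..r} \<Longrightarrow> parameter_collection r (M i)"
    using ap unfolding are_parameters_def by simp
  define g where "g = inv_into X f"
  define pt where "pt i v = g (i, relator_coset r (M i) v)" for i v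
  have Q: "(i, relator_coset r (M i) v) \<in> param_Q_carrier r M" if "i \<in> {1..r}" "keys v \<subseteq> {1..<r}" for i v
    using that by (auto simp: param_Q_carrier_def carrier_param_G)
  have f_pt: "f (pt i v) = (i, relator_coset r (M i) v)" and pt_X: "pt i v \<in> X"
    if "i \<in> {1..r}" "keys v \<subseteq> {1..<r}" for i v
    using bij_betw_inv_into_right[OF bij Q[OF that]] bij_betw_apply[OF bij_betw_inv_into[OF bij] Q[OF that]]
    by (auto simp: pt_def g_def)
  have g_f: "g (f x) = x" if "x \<in> X" for x
    using bij_betw_inv_into_left[OF bij that] by (simp add: g_def)
  have "quandle_chart X tr r M pt"
  proof
    fix i and v :: "nat \<Rightarrow>\<^sub>0 int" assume iv: "i \<in> {1..r}" "keys v \<subseteq> {1..<r}"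
    show "pt i v \<in> X" using pt_X[OF iv] .
  next
    fix x assume x: "x \<in> X"
    then have "f x \<in> param_Q_carrier r M" using bij_betw_apply[OF bij] by blast
    then obtain i v where iv: "i \<in> {1..r}" "keys v \<subseteq> {1..<r}" "f x = (i, relator_coset r (M i) v)"
      by (auto simp: param_Q_carrier_def carrier_param_G)
    then have "x = pt i v" using g_f[OF x] by (simp add: pt_def)
    then show "\<exists>i\<in>{1..r}. \<exists>v. keys v \<subseteq> {1..<r} \<and> x = pt i v" using iv by blast
  next
    fix i j and v w :: "nat \<Rightarrow>\<^sub>0 int" assume i: "i \<in> {1..r}" and j: "j \<in> {1..r}" and v: "keys v \<subseteq> {1..<r}" and w: "keys w \<subseteq> {1..<r}"
    have "pt i v = pt j w \<longleftrightarrow> f (pt i v) = f (pt j w)"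
      using g_f[OF pt_X[OF i v]] g_f[OF pt_X[OF j w]] by metis
    then show "pt i v = pt j w \<longleftrightarrow> i = j \<and> v - w \<in> relator_subgroup r (M i)"
      using f_pt[OF i v] f_pt[OF j w] by (simp add: relator_coset_eq_iff cong: conj_cong)
    let ?s = "step (diff_mod r j i)"
    have s: "keys ?s \<subseteq> {1..<r}" using keys_step_diff_mod[OF i] .
    then have vs: "keys (v + ?s) \<subseteq> {1..<r}" using v by (intro keys_add_subset)
    have "f (tr (pt i v) (pt j w)) = f (pt i (v + ?s))"
      using op[OF pt_X[OF i v] pt_X[OF j w]] mult_param_G[OF v s, of "M i"]
      by (simp add: f_pt[OF i v] f_pt[OF j w] f_pt[OF i vs] param_Q_op_def param_x_eq)
    then show "tr (pt i v) (pt j w) = pt i (v + ?s)"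
      using g_f[OF closed[OF pt_X[OF i v] pt_X[OF j w]]] g_f[OF pt_X[OF i vs]] by metis
  qed (rule coll)
  moreover have "Os i = pt i ` {v. keys v \<subseteq> {1..<r}}" if i: "i \<in> {1..r}" for i
  proof -
    have "g ` f ` Os i = Os i" using g_f Os[OF i] by (force simp: image_image)
    then have "Os i = g ` ({i} \<times> carrier (param_G r (M i)))" using fO i by simp
    also have "{i} \<times> carrier (param_G r (M i)) = (\<lambda>v. (i, relator_coset r (M i) v)) ` {v. keys v \<subseteq> {1..<r}}"
      by (simp only: carrier_param_G singleton_times_image)
    also have "g ` \<dots> = pt i ` {v. keys v \<subseteq> {1..<r}}"
      unfolding image_image pt_def ..
    finally show ?thesis .
  qed
  ultimately show ?thesis by blast
qed

context quandle_chart
begin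

lemma are_parameters_if_orbits:
  assumes zero: "\<And>i. i \<notin> {1..r} \<Longrightarrow> M i = (\<lambda>_ _. 0)"
    and Os: "\<And>i. i \<in> {1..r} \<Longrightarrow> Os i = pt i ` {v. keys v \<subseteq> {1..<r}}"
  shows "are_parameters X tr r Os M"
proof -
  \<comment> \<open>Any representative of the coset will do, since \<open>pt i\<close> is constant
    on cosets by \<open>pt_eq_iff\<close>.\<close>
  define g where "g = (\<lambda>(i, c). pt i (SOME v. keys v \<subseteq> {1..<r} \<and> relator_coset r (M i) v = c))"
  have g: "g (i, relator_coset r (M i) v) = pt i v" if i: "i \<in> {1..r}" and v: "keys v \<subseteq> {1..<r}" for i v
  proof -
    define w where "w = (SOME w. keys w \<subseteq> {1..<r} \<and> relator_coset r (M i) w = relator_coset r (M i) v)"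
    have "keys w \<subseteq> {1..<r} \<and> relator_coset r (M i) w = relator_coset r (M i) v"
      unfolding w_def by (rule someI[of _ v]) (simp add: v)
    then have "pt i w = pt i v" using pt_eq_iff[OF i i _ v] by (simp add: relator_coset_eq_iff)
    then show ?thesis by (simp add: g_def w_def)
  qed
  have Q: "\<exists>i\<in>{1..r}. \<exists>v. keys v \<subseteq> {1..<r} \<and> q = (i, relator_coset r (M i) v)" if "q \<in> param_Q_carrier r M" for q
    using that by (auto simp: param_Q_carrier_def carrier_param_G)
  have Q': "(i, relator_coset r (M i) v) \<in> param_Q_carrier r M" if "i \<in> {1..r}" "keys v \<subseteq> {1..<r}" for i v
    using that by (auto simp: param_Q_carrier_def carrier_param_G)
  have inj: "inj_on g (param_Q_carrier r M)"
  proof (rule inj_onI)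
    fix p q assume p: "p \<in> param_Q_carrier r M" and q: "q \<in> param_Q_carrier r M" and eq: "g p = g q"
    obtain i v where i: "i \<in> {1..r}" "keys v \<subseteq> {1..<r}" and p': "p = (i, relator_coset r (M i) v)"
      using Q[OF p] by blast
    obtain j w where j: "j \<in> {1..r}" "keys w \<subseteq> {1..<r}" and q': "q = (j, relator_coset r (M j) w)"
      using Q[OF q] by blast
    have "pt i v = pt j w" using eq g i j p' q' by simp
    then show "p = q" using pt_eq_iff[OF i(1) j(1) i(2) j(2)] by (auto simp: p' q' relator_coset_eq_iff[THEN iffD2])
  qed
  have "g ` param_Q_carrier r M = X"
  proof
    show "g ` param_Q_carrier r M \<subseteq> X"
    proof
      fix x assume "x \<in> g ` param_Q_carrier r M"
      then obtain q where q: "q \<in> param_Q_carrier r M" "x = g q" by blast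
      from Q[OF q(1)] obtain i v where "i \<in> {1..r}" "keys v \<subseteq> {1..<r}" "q = (i, relator_coset r (M i) v)"
        by blast
      then show "x \<in> X" using g pt_in q(2) by simp
    qed
    show "X \<subseteq> g ` param_Q_carrier r M"
    proof
      fix x assume "x \<in> X"
      from pt_surj[OF this] obtain i v where iv: "i \<in> {1..r}" "keys v \<subseteq> {1..<r}" "x = pt i v" by blast
      then have "x = g (i, relator_coset r (M i) v)" using g by simp
      then show "x \<in> g ` param_Q_carrier r M" using Q'[OF iv(1,2)] by blast
    qed
  qed
  with inj have bij: "bij_betw g (param_Q_carrier r M) X" by (simp add: bij_betw_def)
  define f where "f = inv_into (param_Q_carrier r M) g"
  have bij_f: "bij_betw f X (param_Q_carrier r M)" unfolding f_def by (rule bij_betw_inv_into[OF bij])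
  have f_pt: "f (pt i v) = (i, relator_coset r (M i) v)" if "i \<in> {1..r}" "keys v \<subseteq> {1..<r}" for i v
    using bij_betw_inv_into_left[OF bij Q'[OF that]] g[OF that] by (simp add: f_def)
  have "f (tr a b) = param_Q_op r M (f a) (f b)" if a: "a \<in> X" and b: "b \<in> X" for a b
  proof -
    obtain i v where i: "i \<in> {1..r}" and v: "keys v \<subseteq> {1..<r}" and a': "a = pt i v" using pt_surj[OF a] by blast
    obtain j w where j: "j \<in> {1..r}" and w: "keys w \<subseteq> {1..<r}" and b': "b = pt j w" using pt_surj[OF b] by blast
    let ?s = "step (diff_mod r j i)"
    have s: "keys ?s \<subseteq> {1..<r}" using keys_step_diff_mod[OF i] .
    then have vs: "keys (v + ?s) \<subseteq> {1..<r}" using v by (intro keys_add_subset)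
    show ?thesis
      using mult_param_G[OF v s, of "M i"]
      by (simp add: a' b' pt_op[OF i j v w] f_pt[OF i v] f_pt[OF j w] f_pt[OF i vs] param_Q_op_def param_x_eq)
  qed
  moreover have "f ` Os i = {i} \<times> carrier (param_G r (M i))" if i: "i \<in> {1..r}" for i
  proof -
    have "f ` Os i = (\<lambda>v. (i, relator_coset r (M i) v)) ` {v. keys v \<subseteq> {1..<r}}"
      unfolding Os[OF i] image_image by (rule image_cong) (auto simp: f_pt[OF i])
    then show ?thesis by (simp only: carrier_param_G singleton_times_image)
  qed
  ultimately show ?thesis
    unfolding are_parameters_def quandle_iso_def using bij_f collection zero by metis
qed

end

text \<open>Adding an exponent vector has a meaning independent of the chart: x_k acts on orbit i as
  translation by any point of orbit i + k, and both charts have the same orbits. So a vector that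
  fixes points of orbit i in one chart fixes them in the other.\<close>

lemma chart_relator_subgroup_subset:
  assumes c: "quandle_chart X tr r M pt" and c': "quandle_chart X tr r M' pt'"
    and Os: "\<And>i. i \<in> {1..r} \<Longrightarrow> pt i ` {v. keys v \<subseteq> {1..<r}} = pt' i ` {v. keys v \<subseteq> {1..<r}}"
    and i: "i \<in> {1..r}"
  shows "relator_subgroup r (M i) \<subseteq> relator_subgroup r (M' i)"
proof
  interpret c: quandle_chart X tr r M pt by (rule c)
  interpret c': quandle_chart X tr r M' pt' by (rule c')
  have other: "\<exists>w'. keys w' \<subseteq> {1..<r} \<and> pt j w = pt' j w'" if "j \<in> {1..r}" "keys w \<subseteq> {1..<r}" for j w
  proof -
    have "pt j w \<in> pt' j ` {v. keys v \<subseteq> {1..<r}}" using Os[OF that(1)] that(2) by blast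
    then show ?thesis by blast
  qed
  \<comment> \<open>Two variables w and w' occur because the charts may have different base points
    in the same orbit.\<close>
  have translate: "\<forall>w w'. keys w \<subseteq> {1..<r} \<longrightarrow> keys w' \<subseteq> {1..<r} \<longrightarrow> pt i w = pt' i w' \<longrightarrow> pt i (w + v) = pt' i (w' + v)"
    if "keys v \<subseteq> {1..<r}" for v
  proof (rule free_Abelian_group_induct[OF that], goal_cases)
    case 1
    then show ?case by simp
  next
    case (2 v v')
    show ?case
    proof (intro allI impI)
      fix w w' assume w: "keys w \<subseteq> {1..<r}" and w': "keys w' \<subseteq> {1..<r}" and eq: "pt i w = pt' i w'"
      have kv: "keys (w + v - v') \<subseteq> {1..<r}" "keys (w' + v - v') \<subseteq> {1..<r}" "keys (w + v) \<subseteq> {1..<r}" "keys (w' + v) \<subseteq> {1..<r}"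
        using 2 w w' by (simp_all add: keys_diff_subset keys_add_subset)
      \<comment> \<open>Subtraction is reduced to addition: the intermediate point gets some
        coordinates u in the second chart, and adding v' to them must give the point already
        known.\<close>
      obtain u where u: "keys u \<subseteq> {1..<r}" "pt i (w + v - v') = pt' i u" using other[OF i kv(1)] by blast
      have uv: "keys (u + v') \<subseteq> {1..<r}" using u 2 by (intro keys_add_subset)
      have "pt i (w + v) = pt' i (u + v')" using 2 u kv by (metis diff_add_cancel)
      moreover have "pt i (w + v) = pt' i (w' + v)" using 2 w w' eq by blast
      ultimately have "u + v' - (w' + v) \<in> relator_subgroup r (M' i)"
        using c'.pt_eq_iff[OF i i uv kv(4)] by simp
      then have "pt' i u = pt' i (w' + v - v')"
        using c'.pt_eq_iff[OF i i u(1) kv(2)] by (simp add: algebra_simps)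
      then show "pt i (w + (v - v')) = pt' i (w' + (v - v'))" using u by (simp add: add_diff_eq)
    qed
  next
    case (3 k)
    let ?j = "shift r i k"
    have j: "?j \<in> {1..r}" and k: "k < r" "k > 0" using 3 shift_in[OF i, of k] by auto
    have z: "keys (0::nat \<Rightarrow>\<^sub>0 int) \<subseteq> {1..<r}" by simp
    obtain u where u: "keys u \<subseteq> {1..<r}" "pt ?j 0 = pt' ?j u" using other[OF j z] by blast
    have s: "step (diff_mod r ?j i) = frag_of k" using diff_mod_shift[OF i k(1)] k by (simp add: step_def)
    show ?case
    proof (intro allI impI)
      fix w w' assume w: "keys w \<subseteq> {1..<r}" and w': "keys w' \<subseteq> {1..<r}" and eq: "pt i w = pt' i w'"
      show "pt i (w + frag_of k) = pt' i (w' + frag_of k)"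
        using c.pt_op[OF i j w z] c'.pt_op[OF i j w' u(1)] eq u(2) s by metis
    qed
  qed
  fix v assume v: "v \<in> relator_subgroup r (M i)"
  then have kv: "keys v \<subseteq> {1..<r}" by (rule relator_subgroup_keys)
  obtain w where w: "keys w \<subseteq> {1..<r}" "pt i 0 = pt' i w" using other[OF i, of 0] by auto
  have wv: "keys (w + v) \<subseteq> {1..<r}" using w kv by (intro keys_add_subset)
  have "pt i (0 + v) = pt' i (w + v)" using translate[OF kv] w by (metis Poly_Mapping.keys_zero empty_subsetI)
  moreover have "pt i v = pt i 0" using c.pt_eq_iff[OF i i kv, of 0] v by simp
  ultimately have "pt' i (w + v) = pt' i w" using w by simp
  then show "v \<in> relator_subgroup r (M' i)" using c'.pt_eq_iff[OF i i wv w(1)] by simp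
qed

lemma chart_parameters_unique:
  assumes c: "quandle_chart X tr r M pt" and c': "quandle_chart X tr r M' pt'"
    and Os: "\<And>i. i \<in> {1..r} \<Longrightarrow> pt i ` {v. keys v \<subseteq> {1..<r}} = pt' i ` {v. keys v \<subseteq> {1..<r}}"
    and i: "i \<in> {1..r}"
  shows "M i = M' i"
proof (rule parameter_collection_unique)
  show "relator_subgroup r (M i) = relator_subgroup r (M' i)"
    using chart_relator_subgroup_subset[OF c c' Os i] chart_relator_subgroup_subset[OF c' c Os[symmetric] i] by blast
qed (use quandle_chart.collection[OF c i] quandle_chart.collection[OF c' i] in auto)

section \<open>Existence of parameters\<close>

lemma (in group) centralizer_subgroup:
  assumes "S \<subseteq> carrier G"
  shows "subgroup {y \<in> carrier G. \<forall>x\<in>S. x \<otimes> y = y \<otimes> x} G"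
proof (rule subgroupI)
  show "{y \<in> carrier G. \<forall>x\<in>S. x \<otimes> y = y \<otimes> x} \<noteq> {}"
    using assms by (auto intro!: exI[of _ \<one>])
next
  fix a assume a: "a \<in> {y \<in> carrier G. \<forall>x\<in>S. x \<otimes> y = y \<otimes> x}"
  have "x \<otimes> inv a = inv a \<otimes> x" if "x \<in> S" for x
  proof -
    have xa: "x \<in> carrier G" "a \<in> carrier G" "x \<otimes> a = a \<otimes> x" using that a assms by auto
    have "x \<otimes> inv a = inv a \<otimes> (a \<otimes> x) \<otimes> inv a" using xa(1,2) by (simp add: m_assoc[symmetric])
    also have "\<dots> = inv a \<otimes> x" using xa by (simp add: xa(3)[symmetric] m_assoc)
    finally show ?thesis .
  qed
  then show "inv a \<in> {y \<in> carrier G. \<forall>x\<in>S. x \<otimes> y = y \<otimes> x}" using a by simp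
next
  fix a b
  assume a: "a \<in> {y \<in> carrier G. \<forall>x\<in>S. x \<otimes> y = y \<otimes> x}"
    and b: "b \<in> {y \<in> carrier G. \<forall>x\<in>S. x \<otimes> y = y \<otimes> x}"
  have "x \<otimes> (a \<otimes> b) = a \<otimes> b \<otimes> x" if "x \<in> S" for x
  proof -
    have "x \<in> carrier G" "a \<in> carrier G" "b \<in> carrier G" "x \<otimes> a = a \<otimes> x" "x \<otimes> b = b \<otimes> x"
      using that a b assms by auto
    then show ?thesis by (metis m_assoc)
  qed
  then show "a \<otimes> b \<in> {y \<in> carrier G. \<forall>x\<in>S. x \<otimes> y = y \<otimes> x}" using a b by simp
qed auto

text \<open>The centraliser argument is used twice: first everything generated commutes with S, and
  then with everything generated.\<close>

lemma (in group) comm_group_subgroup_generated: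
  assumes S: "S \<subseteq> carrier G" and comm: "\<And>x y. x \<in> S \<Longrightarrow> y \<in> S \<Longrightarrow> x \<otimes> y = y \<otimes> x"
  shows "comm_group (subgroup_generated G S)"
proof (rule group.group_comm_groupI)
  fix x y assume "x \<in> carrier (subgroup_generated G S)" and "y \<in> carrier (subgroup_generated G S)"
  moreover have "carrier (subgroup_generated G S) = generate G S"
    using S by (simp add: carrier_subgroup_generated Int_absorb1)
  ultimately have x: "x \<in> generate G S" and y: "y \<in> generate G S" by auto
  have "generate G S \<subseteq> {y \<in> carrier G. \<forall>x\<in>S. x \<otimes> y = y \<otimes> x}"
    using S comm by (intro generate_subgroup_incl centralizer_subgroup[OF S]) auto
  then have gen: "g \<in> carrier G" "s \<in> S \<Longrightarrow> s \<otimes> g = g \<otimes> s" if "g \<in> generate G S" for g s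
    using that by auto
  have "generate G S \<subseteq> {z \<in> carrier G. \<forall>x\<in>generate G S. x \<otimes> z = z \<otimes> x}"
  proof (rule generate_subgroup_incl)
    show "S \<subseteq> {z \<in> carrier G. \<forall>x\<in>generate G S. x \<otimes> z = z \<otimes> x}"
      using S gen(2)[symmetric] by blast
    show "subgroup {z \<in> carrier G. \<forall>x\<in>generate G S. x \<otimes> z = z \<otimes> x} G"
      using gen(1) by (intro centralizer_subgroup) blast
  qed
  then show "x \<otimes>\<^bsub>subgroup_generated G S\<^esub> y = y \<otimes>\<^bsub>subgroup_generated G S\<^esub> x"
    using x y by auto
qed simp

section \<open>Translations and orbits of a finite abelian quandle\<close>

locale abelian_quandle_orbits =
  fixes X :: "'a set" and tr :: "'a \<Rightarrow> 'a \<Rightarrow> 'a" and r :: nat and Os :: "nat \<Rightarrow> 'a set"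
  assumes abelian: "abelian_quandle X tr" and finite_X: "finite X"
    and orbits: "ordered_orbits X tr r Os"
begin

definition transl :: "'a \<Rightarrow> 'a \<Rightarrow> 'a" where
  "transl b = (\<lambda>a\<in>X. tr a b)"

definition transl_group :: "('a \<Rightarrow> 'a) monoid" where
  "transl_group = subgroup_generated (BijGroup X) (right_translations X tr)"

lemma bij_tr: "b \<in> X \<Longrightarrow> bij_betw (\<lambda>a. tr a b) X X"
  and tr_distrib: "a \<in> X \<Longrightarrow> b \<in> X \<Longrightarrow> c \<in> X \<Longrightarrow> tr (tr a b) c = tr (tr a c) (tr b c)"
  and tr_idem: "a \<in> X \<Longrightarrow> tr a a = a"
  and tr_comm: "a \<in> X \<Longrightarrow> b \<in> X \<Longrightarrow> c \<in> X \<Longrightarrow> tr (tr a b) c = tr (tr a c) b"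
  using abelian by (auto simp: abelian_quandle_def quandle_def)

lemma tr_closed: "a \<in> X \<Longrightarrow> b \<in> X \<Longrightarrow> tr a b \<in> X"
  using bij_betw_apply[OF bij_tr] by simp

lemma transl_apply: "a \<in> X \<Longrightarrow> transl b a = tr a b"
  by (simp add: transl_def)

lemma transl_Bij: "b \<in> X \<Longrightarrow> transl b \<in> Bij X"
  using bij_tr[of b] by (auto simp: Bij_def transl_def bij_betw_restrict_eq)

lemma right_translations_eq: "right_translations X tr = transl ` X"
  by (auto simp: right_translations_def transl_def)

lemma carrier_BijGroup: "carrier (BijGroup X) = Bij X"
  by (simp add: BijGroup_def)

lemma mult_BijGroup: "f \<in> Bij X \<Longrightarrow> g \<in> Bij X \<Longrightarrow> x \<in> X \<Longrightarrow> (f \<otimes>\<^bsub>BijGroup X\<^esub> g) x = f (g x)"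
  by (simp add: BijGroup_def compose_def)

lemma one_BijGroup: "x \<in> X \<Longrightarrow> \<one>\<^bsub>BijGroup X\<^esub> x = x"
  by (simp add: BijGroup_def)

lemma Bij_apply: "f \<in> Bij X \<Longrightarrow> x \<in> X \<Longrightarrow> f x \<in> X"
  using Bij_imp_funcset by blast

lemma inv_BijGroup_apply:
  assumes "f \<in> Bij X" "x \<in> X"
  shows "(inv\<^bsub>BijGroup X\<^esub> f) (f x) = x"
proof -
  interpret group "BijGroup X" by (rule group_BijGroup)
  have "(inv\<^bsub>BijGroup X\<^esub> f) \<in> Bij X" using assms inv_closed carrier_BijGroup by blast
  then have "(inv\<^bsub>BijGroup X\<^esub> f) (f x) = (inv\<^bsub>BijGroup X\<^esub> f \<otimes>\<^bsub>BijGroup X\<^esub> f) x"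
    using assms by (simp add: mult_BijGroup)
  also have "\<dots> = x" using assms by (simp add: carrier_BijGroup one_BijGroup)
  finally show ?thesis .
qed

lemma carrier_transl_group: "carrier transl_group = generate (BijGroup X) (transl ` X)"
proof -
  have "transl ` X \<subseteq> carrier (BijGroup X)" using transl_Bij by (auto simp: carrier_BijGroup)
  then show ?thesis
    by (simp add: transl_group_def carrier_subgroup_generated right_translations_eq Int_absorb1)
qed

lemma transl_group_Bij: "g \<in> carrier transl_group \<Longrightarrow> g \<in> Bij X"
  using group.carrier_subgroup_generated_subset[OF group_BijGroup, of X "right_translations X tr"]
  by (auto simp: transl_group_def carrier_BijGroup)

lemma transl_group_apply: "g \<in> carrier transl_group \<Longrightarrow> x \<in> X \<Longrightarrow> g x \<in> X"
  using transl_group_Bij Bij_apply by blast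

lemma transl_in: "b \<in> X \<Longrightarrow> transl b \<in> carrier transl_group"
  by (simp add: carrier_transl_group generate.incl)

lemma mult_transl_group:
  "f \<in> carrier transl_group \<Longrightarrow> g \<in> carrier transl_group \<Longrightarrow> x \<in> X \<Longrightarrow> (f \<otimes>\<^bsub>transl_group\<^esub> g) x = f (g x)"
  using mult_BijGroup transl_group_Bij by (simp add: transl_group_def)

lemma one_transl_group: "x \<in> X \<Longrightarrow> \<one>\<^bsub>transl_group\<^esub> x = x"
  by (simp add: transl_group_def one_BijGroup)

lemma comm_group_transl_group: "comm_group transl_group"
proof -
  interpret group "BijGroup X" by (rule group_BijGroup)
  show ?thesis unfolding transl_group_def
  proof (rule comm_group_subgroup_generated)
    show "right_translations X tr \<subseteq> carrier (BijGroup X)"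
      using transl_Bij by (auto simp: carrier_BijGroup right_translations_eq)
    fix f g assume "f \<in> right_translations X tr" "g \<in> right_translations X tr"
    then obtain b c where b: "b \<in> X" "f = transl b" and c: "c \<in> X" "g = transl c"
      by (auto simp: right_translations_eq)
    have fg: "f \<in> Bij X" "g \<in> Bij X" using b c transl_Bij by auto
    show "f \<otimes>\<^bsub>BijGroup X\<^esub> g = g \<otimes>\<^bsub>BijGroup X\<^esub> f"
    proof (rule extensionalityI)
      show "f \<otimes>\<^bsub>BijGroup X\<^esub> g \<in> extensional X" "g \<otimes>\<^bsub>BijGroup X\<^esub> f \<in> extensional X"
        using m_closed[of f g] m_closed[of g f] fg Bij_imp_extensional by (auto simp: carrier_BijGroup)
      fix x assume "x \<in> X"
      then show "(f \<otimes>\<^bsub>BijGroup X\<^esub> g) x = (g \<otimes>\<^bsub>BijGroup X\<^esub> f) x"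
        using b c fg tr_comm[of x b c] tr_closed by (simp add: mult_BijGroup transl_apply)
    qed
  qed
qed

sublocale transl_group: comm_group transl_group by (rule comm_group_transl_group)

lemma inv_transl_group_apply:
  assumes "g \<in> carrier transl_group" "x \<in> X"
  shows "(inv\<^bsub>transl_group\<^esub> g) (g x) = x" "g ((inv\<^bsub>transl_group\<^esub> g) x) = x"
  using assms mult_transl_group[of "inv\<^bsub>transl_group\<^esub> g" g x] mult_transl_group[of g "inv\<^bsub>transl_group\<^esub> g" x]
  by (simp_all add: one_transl_group)

lemma quandle_orbits_eq: "quandle_orbits X tr = (\<lambda>x. {g x | g. g \<in> carrier transl_group}) ` X"
  unfolding quandle_orbits_def orbits_def orbit_def transl_group_def[symmetric] by blast

definition base :: "nat \<Rightarrow> 'a" where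
  "base i = (SOME b. b \<in> X \<and> Os i = {g b | g. g \<in> carrier transl_group})"

lemma base: "base i \<in> X" "Os i = {g (base i) | g. g \<in> carrier transl_group}" if "i \<in> {1..r}"
proof -
  have "Os i \<in> quandle_orbits X tr"
    using orbits that by (auto simp: ordered_orbits_def bij_betw_def)
  then have "\<exists>b. b \<in> X \<and> Os i = {g b | g. g \<in> carrier transl_group}"
    by (auto simp: quandle_orbits_eq)
  then have "base i \<in> X \<and> Os i = {g (base i) | g. g \<in> carrier transl_group}"
    unfolding base_def by (rule someI_ex)
  then show "base i \<in> X" "Os i = {g (base i) | g. g \<in> carrier transl_group}" by auto
qed

lemma in_own_orbit: "x \<in> X \<Longrightarrow> x \<in> {g x | g. g \<in> carrier transl_group}"
  by (intro CollectI exI[of _ "\<one>\<^bsub>transl_group\<^esub>"]) (simp add: one_transl_group)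

lemma base_in_orbit: "i \<in> {1..r} \<Longrightarrow> base i \<in> Os i"
  using base in_own_orbit by simp

lemma orbit_subset: "i \<in> {1..r} \<Longrightarrow> x \<in> Os i \<Longrightarrow> x \<in> X"
  using base transl_group_apply by auto

lemma orbit_eq:
  assumes i: "i \<in> {1..r}" and x: "x \<in> Os i"
  shows "Os i = {g x | g. g \<in> carrier transl_group}"
proof -
  obtain h where h: "h \<in> carrier transl_group" "x = h (base i)" using base[OF i] x by blast
  have "g x = (g \<otimes>\<^bsub>transl_group\<^esub> h) (base i)" if "g \<in> carrier transl_group" for g
    using that h base(1)[OF i] by (simp add: mult_transl_group)
  moreover have "g (base i) = (g \<otimes>\<^bsub>transl_group\<^esub> inv\<^bsub>transl_group\<^esub> h) x" if "g \<in> carrier transl_group" for g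
    using that h base(1)[OF i] transl_group_apply by (simp add: mult_transl_group inv_transl_group_apply)
  ultimately show ?thesis
    unfolding base(2)[OF i]
    using h(1) by (intro subset_antisym subsetI; clarify) (metis transl_group.m_closed transl_group.inv_closed)+
qed

lemma orbit_invariant:
  "i \<in> {1..r} \<Longrightarrow> x \<in> Os i \<Longrightarrow> g \<in> carrier transl_group \<Longrightarrow> g x \<in> Os i"
  using orbit_eq[of i x] by blast

lemma orbits_cover:
  assumes "x \<in> X"
  shows "\<exists>i\<in>{1..r}. x \<in> Os i"
proof -
  have "{g x | g. g \<in> carrier transl_group} \<in> quandle_orbits X tr"
    using assms by (simp add: quandle_orbits_eq)
  moreover have "quandle_orbits X tr = Os ` {1..r}"
    using orbits by (simp add: ordered_orbits_def bij_betw_def)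
  ultimately have "{g x | g. g \<in> carrier transl_group} \<in> Os ` {1..r}" by simp
  then show ?thesis
  proof (rule imageE)
    fix i assume i: "{g x | g. g \<in> carrier transl_group} = Os i" "i \<in> {1..r}"
    have "x \<in> Os i" using in_own_orbit[OF assms] unfolding i(1) .
    then show ?thesis using i(2) by blast
  qed
qed

lemma orbits_disjoint:
  assumes "i \<in> {1..r}" "j \<in> {1..r}" "x \<in> Os i" "x \<in> Os j"
  shows "i = j"
proof -
  have "Os i = Os j" using orbit_eq[of i x] orbit_eq[of j x] assms by simp
  then show ?thesis using orbits assms by (auto simp: ordered_orbits_def bij_betw_def dest: inj_onD)
qed

text \<open>Self-distributivity turns \<open>tr (tr d b) c\<close> into
  \<open>tr (tr d c) (tr b c)\<close>, commutativity of translations turns it into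
  \<open>tr (tr d c) b\<close>. As \<open>tr d c\<close> runs through X, translation by
  \<open>tr b c\<close> equals translation by b.\<close>

lemma transl_invariant:
  assumes "g \<in> carrier transl_group" "b \<in> X"
  shows "transl (g b) = transl b"
  using assms unfolding carrier_transl_group
proof (induction arbitrary: b)
  case one
  then show ?case by (simp add: one_BijGroup)
next
  case (incl h)
  then obtain c where c: "c \<in> X" "h = transl c" by blast
  have "tr a (tr b c) = tr a b" if a: "a \<in> X" for a
  proof -
    obtain d where d: "d \<in> X" "a = tr d c"
      using bij_tr[OF c(1)] a by (force simp: bij_betw_def)
    then show ?thesis using tr_distrib[of d b c] tr_comm[of d b c] c incl.prems by simp
  qed
  then show ?case using c incl.prems by (auto simp: transl_def fun_eq_iff)
next
  case (inv h)
  then obtain c where c: "c \<in> X" "h = transl c" by blast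
  have h: "h \<in> Bij X" using c transl_Bij by simp
  let ?b = "(inv\<^bsub>BijGroup X\<^esub> h) b"
  obtain d where d: "d \<in> X" "b = h d"
    using h inv.prems by (auto simp: Bij_def bij_betw_def)
  have "transl (h d) = transl d"
  proof -
    have "tr a (tr d c) = tr a d" if a: "a \<in> X" for a
    proof -
      obtain e where e: "e \<in> X" "a = tr e c"
        using bij_tr[OF c(1)] a by (force simp: bij_betw_def)
      then show ?thesis using tr_distrib[of e d c] tr_comm[of e d c] c d by simp
    qed
    then show ?thesis using c d by (auto simp: transl_def fun_eq_iff)
  qed
  then show ?case using d inv_BijGroup_apply[OF h d(1)] by simp
next
  case (eng h1 h2)
  have "h1 \<in> Bij X" "h2 \<in> Bij X"
    using eng.hyps transl_group_Bij by (auto simp: carrier_transl_group)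
  then show ?case using eng Bij_apply by (simp add: mult_BijGroup)
qed

lemma transl_orbit:
  assumes i: "i \<in> {1..r}" and a: "a \<in> Os i" and b: "b \<in> Os i"
  shows "transl a = transl b"
proof -
  obtain g where "g \<in> carrier transl_group" "b = g a" using orbit_eq[OF i a] b by blast
  then show ?thesis using transl_invariant orbit_subset[OF i a] by simp
qed

text \<open>Translation by b is translation by a, which fixes a by idempotence. This is why an orbit
  needs only r - 1 generators and why x_0 is 1.\<close>

lemma transl_same_orbit:
  assumes "i \<in> {1..r}" "a \<in> Os i" "b \<in> Os i"
  shows "transl b a = a"
  using transl_orbit[of i b a] assms orbit_subset tr_idem by (simp add: transl_apply)

text \<open>The action of Z^(r-1) attached to orbit i: x_k acts as translation by orbit i + k. The
  choice of \<open>base\<close> does not affect it, by \<open>transl_orbit\<close>.\<close>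

definition act_hom :: "nat \<Rightarrow> (nat \<Rightarrow>\<^sub>0 int) \<Rightarrow> 'a \<Rightarrow> 'a" where
  "act_hom i = (SOME h. h \<in> hom (free_Abelian_group {1..<r}) transl_group \<and>
     (\<forall>k\<in>{1..<r}. h (frag_of k) = transl (base (shift r i k))))"

lemma act_hom:
  assumes i: "i \<in> {1..r}"
  shows "act_hom i \<in> hom (free_Abelian_group {1..<r}) transl_group"
    and "k \<in> {1..<r} \<Longrightarrow> act_hom i (frag_of k) = transl (base (shift r i k))"
proof -
  have "(\<lambda>k. transl (base (shift r i k))) ` {1..<r} \<subseteq> carrier transl_group"
    using transl_in base shift_in[OF i] by auto
  then obtain h where "h \<in> hom (free_Abelian_group {1..<r}) transl_group"
    "\<And>k. k \<in> {1..<r} \<Longrightarrow> h (frag_of k) = transl (base (shift r i k))"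
    using transl_group.free_Abelian_group_universal by blast
  then have "\<exists>h. h \<in> hom (free_Abelian_group {1..<r}) transl_group \<and>
     (\<forall>k\<in>{1..<r}. h (frag_of k) = transl (base (shift r i k)))" by blast
  from someI_ex[OF this]
  show "act_hom i \<in> hom (free_Abelian_group {1..<r}) transl_group"
    "k \<in> {1..<r} \<Longrightarrow> act_hom i (frag_of k) = transl (base (shift r i k))"
    by (auto simp: act_hom_def)
qed

lemma act_hom_in: "i \<in> {1..r} \<Longrightarrow> keys v \<subseteq> {1..<r} \<Longrightarrow> act_hom i v \<in> carrier transl_group"
  using act_hom(1)[of i] by (simp add: hom_def Pi_def)

lemma act_add:
  assumes "i \<in> {1..r}" "keys v \<subseteq> {1..<r}" "keys w \<subseteq> {1..<r}" "x \<in> X"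
  shows "act_hom i (v + w) x = act_hom i v (act_hom i w x)"
proof -
  have "act_hom i (v + w) = act_hom i v \<otimes>\<^bsub>transl_group\<^esub> act_hom i w"
    using hom_mult[OF act_hom(1)[OF assms(1)], of v w] assms by simp
  then show ?thesis using assms act_hom_in by (simp add: mult_transl_group)
qed

lemma act_0:
  assumes "i \<in> {1..r}" "x \<in> X"
  shows "act_hom i 0 x = x"
proof -
  have "act_hom i 0 = \<one>\<^bsub>transl_group\<^esub>"
    using hom_one[OF act_hom(1)[OF assms(1)]] transl_group.group_axioms by simp
  then show ?thesis using assms by (simp add: one_transl_group)
qed

lemma act_minus:
  assumes "i \<in> {1..r}" "keys v \<subseteq> {1..<r}" "x \<in> X"
  shows "act_hom i v (act_hom i (- v) x) = x" "act_hom i (- v) (act_hom i v x) = x"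
  using act_add[of i v "- v" x] act_add[of i "- v" v x] act_0[of i x] assms by simp_all

lemma act_apply: "i \<in> {1..r} \<Longrightarrow> keys v \<subseteq> {1..<r} \<Longrightarrow> x \<in> X \<Longrightarrow> act_hom i v x \<in> X"
  using act_hom_in transl_group_apply by blast

lemma act_orbit: "i \<in> {1..r} \<Longrightarrow> keys v \<subseteq> {1..<r} \<Longrightarrow> x \<in> Os i \<Longrightarrow> act_hom i v x \<in> Os i"
  using act_hom_in orbit_invariant by blast

lemma act_step:
  assumes i: "i \<in> {1..r}" and j: "j \<in> {1..r}" and a: "a \<in> Os i" and b: "b \<in> Os j"
  shows "act_hom i (step (diff_mod r j i)) a = tr a b"
proof -
  have aX: "a \<in> X" using orbit_subset i a by blast
  show ?thesis
  proof (cases "i = j")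
    case True
    then show ?thesis
      using transl_same_orbit[OF i a, of b] b aX i by (simp add: diff_mod_self step_def act_0 transl_apply)
  next
    case False
    have "diff_mod r j i \<noteq> 0" "diff_mod r j i < r" using diff_mod_eq[OF i j] False i j by auto
    then have "act_hom i (step (diff_mod r j i)) = transl (base j)"
      using act_hom(2)[OF i, of "diff_mod r j i"] shift_diff_mod[OF i j] by (simp add: step_def)
    also have "\<dots> = transl b" using transl_orbit[OF j base_in_orbit[OF j] b] .
    finally show ?thesis using aX by (simp add: transl_apply)
  qed
qed

text \<open>On orbit i each translation is some x_k or, for points of orbit i itself, the identity.
  Hence Z^(r-1) acts transitively on the orbit, which makes the chart surjective.\<close>

lemma transl_group_act:
  assumes i: "i \<in> {1..r}" and g: "g \<in> carrier transl_group"
  shows "\<exists>v. keys v \<subseteq> {1..<r} \<and> (\<forall>a\<in>Os i. g a = act_hom i v a)"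
  using g unfolding carrier_transl_group
proof induction
  case one
  then show ?case using i act_0 one_BijGroup orbit_subset by (intro exI[of _ 0]) simp
next
  case (incl h)
  then obtain c where c: "c \<in> X" "h = transl c" by blast
  obtain j where j: "j \<in> {1..r}" "c \<in> Os j" using orbits_cover[OF c(1)] by blast
  have "h a = act_hom i (step (diff_mod r j i)) a" if "a \<in> Os i" for a
    using act_step[OF i j(1) that j(2)] c orbit_subset[OF i that] by (simp add: transl_apply)
  then show ?case using keys_step_diff_mod[OF i] by blast
next
  case (inv h)
  then obtain c where c: "c \<in> X" "h = transl c" by blast
  obtain j where j: "j \<in> {1..r}" "c \<in> Os j" using orbits_cover[OF c(1)] by blast
  let ?v = "step (diff_mod r j i)"
  have v: "keys ?v \<subseteq> {1..<r}" using keys_step_diff_mod[OF i] .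
  then have mv: "keys (- ?v) \<subseteq> {1..<r}" by simp
  have "(inv\<^bsub>BijGroup X\<^esub> h) a = act_hom i (- ?v) a" if a: "a \<in> Os i" for a
  proof -
    let ?b = "act_hom i (- ?v) a"
    have b: "?b \<in> Os i" using act_orbit[OF i mv a] .
    have "h ?b = act_hom i ?v ?b"
      using act_step[OF i j(1) b j(2)] c orbit_subset[OF i b] by (simp add: transl_apply)
    then have "h ?b = a" using act_minus[OF i v] orbit_subset[OF i a] by simp
    then show ?thesis using inv_BijGroup_apply[of h ?b] c transl_Bij orbit_subset[OF i b] by metis
  qed
  then show ?case using mv by blast
next
  case (eng h1 h2)
  then obtain v w where v: "keys v \<subseteq> {1..<r}" "\<forall>a\<in>Os i. h1 a = act_hom i v a"
    and w: "keys w \<subseteq> {1..<r}" "\<forall>a\<in>Os i. h2 a = act_hom i w a" by blast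
  have h: "h1 \<in> Bij X" "h2 \<in> Bij X"
    using eng.hyps transl_group_Bij by (auto simp: carrier_transl_group)
  have "(h1 \<otimes>\<^bsub>BijGroup X\<^esub> h2) a = act_hom i (v + w) a" if a: "a \<in> Os i" for a
    using a v w h act_orbit[OF i w(1) a] act_add[OF i v(1) w(1)] orbit_subset[OF i a] by (simp add: mult_BijGroup)
  then show ?case using keys_add_subset[OF v(1) w(1)] by blast
qed

text \<open>The lattice whose Hermite normal form gives the i-th parameter collection.\<close>

definition stab :: "nat \<Rightarrow> (nat \<Rightarrow>\<^sub>0 int) set" where
  "stab i = {v. keys v \<subseteq> {1..<r} \<and> act_hom i v (base i) = base i}"

lemma act_base_eq_iff:
  assumes i: "i \<in> {1..r}" and v: "keys v \<subseteq> {1..<r}" and w: "keys w \<subseteq> {1..<r}"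
  shows "act_hom i v (base i) = act_hom i w (base i) \<longleftrightarrow> v - w \<in> stab i"
proof -
  have b: "base i \<in> X" using base[OF i] by blast
  have vw: "keys (v - w) \<subseteq> {1..<r}" and mw: "keys (- w) \<subseteq> {1..<r}" using v w by (simp_all add: keys_diff_subset)
  have "act_hom i (v - w) (base i) = act_hom i (- w) (act_hom i v (base i))"
    using act_add[OF i mw v b] by simp
  moreover have "act_hom i (- w) x = base i \<longleftrightarrow> x = act_hom i w (base i)" if "x \<in> X" for x
    using act_minus[OF i w that] act_minus[OF i w b] by auto
  ultimately show ?thesis using vw act_apply[OF i v b] by (simp add: stab_def)
qed

lemma stab_parameters:
  assumes i: "i \<in> {1..r}"
  shows "\<exists>m. parameter_collection r m \<and> relator_subgroup r m = stab i"
proof (rule parameter_collection_exists)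
  have b: "base i \<in> X" using base[OF i] by blast
  show z: "0 \<in> stab i" using act_0[OF i b] by (simp add: stab_def)
  show "keys v \<subseteq> {1..<r}" if "v \<in> stab i" for v using that by (simp add: stab_def)
  show "v - w \<in> stab i" if v: "v \<in> stab i" and w: "w \<in> stab i" for v w
  proof -
    have "act_hom i v (base i) = act_hom i w (base i)" using v w by (simp add: stab_def)
    then show ?thesis using act_base_eq_iff[OF i, of v w] v w by (simp add: stab_def)
  qed
  show "\<exists>n>0. frag_cmul n (frag_of k) \<in> stab i" if k: "1 \<le> k" "k < r" for k
  proof -
    \<comment> \<open>Pigeonhole: X is finite, so two multiples of x_k move the base point to the
      same place, and their difference stabilises it.\<close>
    let ?f = "\<lambda>n::nat. act_hom i (frag_cmul (int n) (frag_of k)) (base i)"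
    have key: "keys (frag_cmul n (frag_of k)) \<subseteq> {1..<r}" for n
      using k by (intro keys_frag_cmul_subset) simp
    have "range ?f \<subseteq> X" using act_apply[OF i key b] by blast
    then have "finite (range ?f)" using finite_X finite_subset by blast
    then have "\<not> inj ?f" using finite_imageD infinite_UNIV_nat by blast
    then obtain n n' where "?f n = ?f n'" "n < n'"
      unfolding inj_def by (metis linorder_neqE_nat)
    then have "frag_cmul (int n') (frag_of k) - frag_cmul (int n) (frag_of k) \<in> stab i"
      using act_base_eq_iff[OF i key key, of "int n'" "int n"] by simp
    then have "frag_cmul (int n' - int n) (frag_of k) \<in> stab i" by (simp add: frag_cmul_diff_distrib)
    then show ?thesis using \<open>n < n'\<close> by (intro exI[of _ "int n' - int n"]) simp
  qed
qed

lemma chart_exists: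
  "\<exists>M pt. (\<forall>i. i \<notin> {1..r} \<longrightarrow> M i = (\<lambda>_ _. 0)) \<and> quandle_chart X tr r M pt \<and>
    (\<forall>i\<in>{1..r}. Os i = pt i ` {v. keys v \<subseteq> {1..<r}})"
proof -
  \<comment> \<open>The value 0 outside the orbit indices is the one that
    \<open>are_parameters\<close> prescribes; it makes M unique as a function.\<close>
  define M where "M i = (if i \<in> {1..r} then SOME m. parameter_collection r m \<and> relator_subgroup r m = stab i
    else (\<lambda>_ _. 0))" for i
  have M: "parameter_collection r (M i)" "relator_subgroup r (M i) = stab i" if "i \<in> {1..r}" for i
    using someI_ex[OF stab_parameters[OF that]] that by (auto simp: M_def)
  define pt where "pt i v = act_hom i v (base i)" for i v
  have Os_pt: "Os i = pt i ` {v. keys v \<subseteq> {1..<r}}" if i: "i \<in> {1..r}" for i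
  proof
    show "Os i \<subseteq> pt i ` {v. keys v \<subseteq> {1..<r}}"
    proof
      fix x assume "x \<in> Os i"
      then obtain g where g: "g \<in> carrier transl_group" "x = g (base i)" using base[OF i] by blast
      obtain v where "keys v \<subseteq> {1..<r}" "\<forall>a\<in>Os i. g a = act_hom i v a"
        using transl_group_act[OF i g(1)] by blast
      then show "x \<in> pt i ` {v. keys v \<subseteq> {1..<r}}"
        using g base_in_orbit[OF i] by (auto simp: pt_def)
    qed
    show "pt i ` {v. keys v \<subseteq> {1..<r}} \<subseteq> Os i"
      using act_orbit[OF i _ base_in_orbit[OF i]] by (auto simp: pt_def)
  qed
  have pt_Os: "pt i v \<in> Os i" if "i \<in> {1..r}" "keys v \<subseteq> {1..<r}" for i v
    using Os_pt[OF that(1)] that(2) by blast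
  have "quandle_chart X tr r M pt"
  proof
    fix i assume "i \<in> {1..r}"
    then show "parameter_collection r (M i)" using M by blast
  next
    fix i and v :: "nat \<Rightarrow>\<^sub>0 int" assume "i \<in> {1..r}" "keys v \<subseteq> {1..<r}"
    then show "pt i v \<in> X" using pt_Os orbit_subset by blast
  next
    fix x assume "x \<in> X"
    from orbits_cover[OF this] show "\<exists>i\<in>{1..r}. \<exists>v. keys v \<subseteq> {1..<r} \<and> x = pt i v"
      using Os_pt by blast
  next
    fix i j and v w :: "nat \<Rightarrow>\<^sub>0 int"
    assume i: "i \<in> {1..r}" and j: "j \<in> {1..r}" and v: "keys v \<subseteq> {1..<r}" and w: "keys w \<subseteq> {1..<r}"
    show "pt i v = pt j w \<longleftrightarrow> i = j \<and> v - w \<in> relator_subgroup r (M i)"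
    proof (cases "i = j")
      case True
      then show ?thesis using act_base_eq_iff[OF i v w] M(2)[OF i] by (simp add: pt_def)
    next
      case False
      then show ?thesis using orbits_disjoint[OF i j pt_Os[OF i v]] pt_Os[OF j w] by metis
    qed
    let ?s = "step (diff_mod r j i)"
    have "tr (pt i v) (pt j w) = act_hom i ?s (pt i v)"
      using act_step[OF i j pt_Os[OF i v] pt_Os[OF j w]] by simp
    also have "\<dots> = act_hom i (?s + v) (base i)"
      using act_add[OF i keys_step_diff_mod[OF i] v] base[OF i] by (simp add: pt_def)
    finally show "tr (pt i v) (pt j w) = pt i (v + ?s)" by (simp add: pt_def add.commute)
  qed
  then show ?thesis using Os_pt by (intro exI[of _ M] exI[of _ pt]) (simp add: M_def)
qed

text \<open>Justifies the definite description in \<open>parameters\<close>: any other solution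
  yields a chart with the same orbits, so its collections agree by uniqueness of the normal
  form.\<close>

lemma are_parameters_parameters: "are_parameters X tr r Os (parameters X tr r Os)"
proof -
  obtain M pt where zero: "\<And>i. i \<notin> {1..r} \<Longrightarrow> M i = (\<lambda>_ _. 0)" and c: "quandle_chart X tr r M pt"
    and Os: "\<And>i. i \<in> {1..r} \<Longrightarrow> Os i = pt i ` {v. keys v \<subseteq> {1..<r}}"
    using chart_exists by blast
  have ap: "are_parameters X tr r Os M"
    using quandle_chart.are_parameters_if_orbits[OF c zero Os] .
  have "M' = M" if ap': "are_parameters X tr r Os M'" for M'
  proof
    fix i
    obtain pt' where c': "quandle_chart X tr r M' pt'"
      and Os': "\<forall>i\<in>{1..r}. Os i = pt' i ` {v. keys v \<subseteq> {1..<r}}"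
      using chart_if_are_parameters[OF ap' _ tr_closed] orbit_subset by blast
    show "M' i = M i"
    proof (cases "i \<in> {1..r}")
      case True
      then show ?thesis using chart_parameters_unique[OF c' c] Os Os' by metis
    next
      case False
      then show ?thesis using zero ap' by (simp add: are_parameters_def)
    qed
  qed
  with ap show ?thesis unfolding parameters_def by (rule theI)
qed

lemma chart_parameters: "\<exists>pt. quandle_chart X tr r (parameters X tr r Os) pt"
  using chart_if_are_parameters[OF are_parameters_parameters _ tr_closed] orbit_subset by blast

end

section \<open>The structure group\<close>

abbreviation structure_relations :: "'a set \<Rightarrow> ('a \<Rightarrow> 'a \<Rightarrow> 'a) \<Rightarrow> ('a word \<times> 'a word) set" where
  "structure_relations X tr \<equiv> {([(a, True), (b, True)], [(b, True), (tr a b, True)]) | a b. a \<in> X \<and> b \<in> X}"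

section \<open>A commutative structure group makes the quandle abelian\<close>

lemma word_eq_if_comm_structure_group:
  assumes comm: "comm_group (structure_group X tr)" and b: "b \<in> X" and c: "c \<in> X"
  shows "word_eq X (structure_relations X tr) [(b, True), (c, True)] [(c, True), (b, True)]"
proof -
  let ?R = "structure_relations X tr"
  let ?cl = "\<lambda>w. word_rel X ?R `` {w}"
  have l: "[(x, True)] \<in> lists (X \<times> UNIV)" "[(x, True), (y, True)] \<in> lists (X \<times> UNIV)"
    if "x \<in> X" "y \<in> X" for x y using that by auto
  have G: "structure_group X tr = presented_group X ?R" by (simp add: structure_group_def)
  have car: "?cl [(x, True)] \<in> carrier (structure_group X tr)" if "x \<in> X" for x
    unfolding G using l that by (simp add: presented_group_def quotientI)
  have "?cl [(b, True)] \<otimes>\<^bsub>structure_group X tr\<^esub> ?cl [(c, True)] =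
      ?cl [(c, True)] \<otimes>\<^bsub>structure_group X tr\<^esub> ?cl [(b, True)]"
    using comm_groupE(4)[OF comm car[OF b] car[OF c]] .
  then have "?cl [(b, True), (c, True)] = ?cl [(c, True), (b, True)]"
    unfolding G using mult_presented_group[OF l(1)[OF b b] l(1)[OF c c], of ?R]
      mult_presented_group[OF l(1)[OF c c] l(1)[OF b b], of ?R] by simp
  from eq_equiv_class[OF this equiv_word_rel l(2)[OF c b]] show ?thesis
    by (simp add: word_rel_def)
qed

fun letter_act :: "'a set \<Rightarrow> ('a \<Rightarrow> 'a \<Rightarrow> 'a) \<Rightarrow> 'a \<times> bool \<Rightarrow> 'a \<Rightarrow> 'a" where
  "letter_act X tr (b, True) x = tr x b"
| "letter_act X tr (b, False) x = inv_into X (\<lambda>a. tr a b) x"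

lemma fold_letter_act_in:
  assumes q: "quandle X tr" and "w \<in> lists (X \<times> UNIV)" "x \<in> X"
  shows "fold (letter_act X tr) w x \<in> X"
  using assms(2,3)
proof (induction w arbitrary: x rule: list.induct)
  case (Cons l w)
  obtain b e where l: "l = (b, e)" by fastforce
  have b: "b \<in> X" using Cons.prems l by auto
  then have bij: "bij_betw (\<lambda>a. tr a b) X X" using q by (auto simp: quandle_def)
  have "letter_act X tr l x \<in> X"
    using bij_betw_apply[OF bij Cons.prems(2)] bij_betw_apply[OF bij_betw_inv_into[OF bij] Cons.prems(2)]
    by (cases e) (auto simp: l)
  then show ?case using Cons by simp
qed simp

text \<open>The first letter acts first, so the words a b and b (a tr b) send x to the two sides of
  self-distributivity; inverse letters cancel because translations are bijections.\<close>

lemma fold_letter_act_word_eq: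
  assumes q: "quandle X tr" and "word_eq X (structure_relations X tr) u v" "x \<in> X"
  shows "fold (letter_act X tr) u x = fold (letter_act X tr) v x"
  using assms(2,3)
proof (induction arbitrary: x rule: word_eq.induct)
  case (append u v u' v')
  have "u \<in> lists (X \<times> UNIV)" using word_eq_lists append.hyps by blast
  from append.IH(2)[OF fold_letter_act_in[OF q this append.prems]] append.IH(1)[OF append.prems]
  show ?case by simp
next
  case (cancel s b)
  have bij: "bij_betw (\<lambda>a. tr a s) X X" using q cancel by (auto simp: quandle_def)
  show ?case
    using bij_betw_inv_into_left[OF bij cancel.prems] bij_betw_inv_into_right[OF bij cancel.prems]
    by (cases b) auto
next
  case (relation u v)
  then show ?case using q by (auto simp: quandle_def)
qed auto

lemma abelian_quandle_if_comm_structure_group: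
  assumes q: "quandle X tr" and comm: "comm_group (structure_group X tr)"
  shows "abelian_quandle X tr"
  unfolding abelian_quandle_def
proof (intro conjI ballI q)
  fix a b c assume "a \<in> X" "b \<in> X" "c \<in> X"
  then show "tr (tr a b) c = tr (tr a c) b"
    using fold_letter_act_word_eq[OF q word_eq_if_comm_structure_group[OF comm]] by fastforce
qed

section \<open>The free abelian group on the columns\<close>

definition pairs :: "nat \<Rightarrow> (nat \<times> nat) set" where
  "pairs r = {(i, j). 1 \<le> i \<and> i < j \<and> j \<le> r}"

lemma finite_pairs: "finite (pairs r)"
  by (rule finite_subset[of _ "{1..r} \<times> {1..r}"]) (auto simp: pairs_def)

text \<open>The image of \<open>x\<^bsub>j-i\<^esub>\<close> of the \<open>i\<close>-th factor in the free abelian group on the columns of the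
  parameter matrix: the relators of the parameter group identify it with the inverse of
  \<open>x\<^bsub>i-j\<^esub>\<close> of the \<open>j\<close>-th factor.\<close>

definition edge :: "nat \<Rightarrow> nat \<Rightarrow> (nat \<times> nat \<Rightarrow>\<^sub>0 int)" where
  "edge i j = (if i < j then frag_of (i, j) else if j < i then - frag_of (j, i) else 0)"

lemma edge_swap: "edge j i = - edge i j"
  by (auto simp: edge_def)

lemma keys_edge: "i \<in> {1..r} \<Longrightarrow> j \<in> {1..r} \<Longrightarrow> keys (edge i j) \<subseteq> pairs r"
  by (auto simp: edge_def pairs_def)

text \<open>Sends x_k of the i-th factor to its image \<open>edge i (shift r i k)\<close>. The rows
  of the parameter matrix turn out to be the images of the relators.\<close>

definition edge_map :: "nat \<Rightarrow> nat \<Rightarrow> (nat \<Rightarrow>\<^sub>0 int) \<Rightarrow> (nat \<times> nat \<Rightarrow>\<^sub>0 int)" where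
  "edge_map r i = frag_extend (\<lambda>k. edge i (shift r i k))"

lemma edge_map_0 [simp]: "edge_map r i 0 = 0"
  and edge_map_add: "edge_map r i (v + w) = edge_map r i v + edge_map r i w"
  and edge_map_diff: "edge_map r i (v - w) = edge_map r i v - edge_map r i w"
  by (simp_all add: edge_map_def frag_extend_add frag_extend_diff)

lemma edge_map_frag_of: "edge_map r i (frag_of k) = edge i (shift r i k)"
  by (simp add: edge_map_def)

lemma edge_map_step:
  assumes "i \<in> {1..r}" "j \<in> {1..r}"
  shows "edge_map r i (step (diff_mod r j i)) = edge i j"
proof (cases "i = j")
  case True
  then show ?thesis by (simp add: diff_mod_self step_def edge_def)
next
  case False
  then have "diff_mod r j i \<noteq> 0" using diff_mod_eq[OF assms] assms by auto
  then show ?thesis by (simp add: step_def edge_map_frag_of shift_diff_mod[OF assms])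
qed

lemma keys_edge_map:
  assumes "i \<in> {1..r}" "keys v \<subseteq> {1..<r}"
  shows "keys (edge_map r i v) \<subseteq> pairs r"
proof -
  have "keys (edge i (shift r i k)) \<subseteq> pairs r" if "k \<in> keys v" for k
  proof (rule keys_edge[OF assms(1) shift_in[OF assms(1)]])
    show "k < r" using that assms(2) by auto
  qed
  then show ?thesis
    unfolding edge_map_def by (intro order_trans[OF keys_frag_extend] UN_least)
qed

text \<open>The lattice spanned by the rows of the parameter matrix.\<close>

definition row_lattice :: "nat \<Rightarrow> (nat \<Rightarrow> nat \<Rightarrow> nat \<Rightarrow> int) \<Rightarrow> (nat \<times> nat \<Rightarrow>\<^sub>0 int) set" where
  "row_lattice r M = group_closure ((\<lambda>(i, j). edge_map r i (relator (M i) j)) ` ({1..r} \<times> {1..<r}))"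

definition row_lattice_full :: "nat \<Rightarrow> (nat \<Rightarrow> nat \<Rightarrow> nat \<Rightarrow> int) \<Rightarrow> bool" where
  "row_lattice_full r M \<longleftrightarrow> (\<forall>p\<in>pairs r. frag_of p \<in> row_lattice r M)"

lemma row_lattice_0: "0 \<in> row_lattice r M"
  and row_lattice_diff: "v \<in> row_lattice r M \<Longrightarrow> w \<in> row_lattice r M \<Longrightarrow> v - w \<in> row_lattice r M"
  and row_lattice_add: "v \<in> row_lattice r M \<Longrightarrow> w \<in> row_lattice r M \<Longrightarrow> v + w \<in> row_lattice r M"
  and row_lattice_minus: "v \<in> row_lattice r M \<Longrightarrow> - v \<in> row_lattice r M"
  by (simp_all add: row_lattice_def group_closure.diff group_closure_add)

lemma edge_map_relator_subgroup:
  assumes "i \<in> {1..r}" "v \<in> relator_subgroup r (M i)"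
  shows "edge_map r i v \<in> row_lattice r M"
  using assms(2) unfolding relator_subgroup_eq
proof induction
  case (base s)
  then consider "s = 0" | j where "j \<in> {1..<r}" "s = relator (M i) j" by blast
  then show ?case
  proof cases
    case 1
    then show ?thesis by (simp add: row_lattice_0)
  next
    case 2
    have "(i, j) \<in> {1..r} \<times> {1..<r}" using 2 assms by simp
    then have "(\<lambda>(i, j). edge_map r i (relator (M i) j)) (i, j) \<in> row_lattice r M"
      unfolding row_lattice_def by (intro group_closure.base insertI2 imageI)
    then show ?thesis using 2 by simp
  qed
next
  case (diff s t)
  then show ?case by (simp add: edge_map_diff row_lattice_diff)
qed

text \<open>The cocycle of the twisted group. Bilinearity gives the cocycle identity; since only i <
  j contributes, its failure to be symmetric on the unit vectors of orbits i < j is e_(i,j).\<close>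

definition cross :: "nat \<Rightarrow> (nat \<Rightarrow> int) \<Rightarrow> (nat \<Rightarrow> int) \<Rightarrow> (nat \<times> nat \<Rightarrow>\<^sub>0 int)" where
  "cross r f g = (\<Sum>p\<in>pairs r. frag_cmul (f (fst p) * g (snd p)) (frag_of p))"

lemma cross_add_left: "cross r (\<lambda>l. f l + f' l) g = cross r f g + cross r f' g"
  and cross_add_right: "cross r f (\<lambda>l. g l + g' l) = cross r f g + cross r f g'"
  and cross_0_left: "cross r (\<lambda>l. 0) g = 0"
  and cross_0_right: "cross r f (\<lambda>l. 0) = 0"
  by (simp_all add: cross_def algebra_simps frag_cmul_distrib sum.distrib)

lemma cross_single:
  assumes "i \<in> {1..r}" "j \<in> {1..r}"
  shows "cross r (\<lambda>l. if i = l then c else 0) (\<lambda>l. if j = l then d else 0) =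
    (if i < j then frag_cmul (c * d) (frag_of (i, j)) else 0)"
proof -
  have "cross r (\<lambda>l. if i = l then c else 0) (\<lambda>l. if j = l then d else 0) =
      (\<Sum>p\<in>pairs r. if p = (i, j) then frag_cmul (c * d) (frag_of (i, j)) else 0)"
    unfolding cross_def by (rule sum.cong) auto
  then show ?thesis using assms finite_pairs by (simp add: pairs_def)
qed

section \<open>An invariant of words: the twisted central extension\<close>

context quandle_chart
begin

definition index :: "'a \<Rightarrow> nat" where
  "index x = (SOME i. i \<in> {1..r} \<and> (\<exists>v. keys v \<subseteq> {1..<r} \<and> x = pt i v))"

text \<open>One lift among many: it is determined modulo the relators of its orbit, so what is
  computed from it is meaningful modulo the row lattice.\<close>

definition coord :: "'a \<Rightarrow> (nat \<Rightarrow>\<^sub>0 int)" where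
  "coord x = (SOME v. keys v \<subseteq> {1..<r} \<and> x = pt (index x) v)"

lemma index_coord:
  assumes "x \<in> X"
  shows "index x \<in> {1..r}" "keys (coord x) \<subseteq> {1..<r}" "pt (index x) (coord x) = x"
proof -
  have "\<exists>i. i \<in> {1..r} \<and> (\<exists>v. keys v \<subseteq> {1..<r} \<and> x = pt i v)"
    using pt_surj[OF assms] by blast
  from someI_ex[OF this] have i: "index x \<in> {1..r}" "\<exists>v. keys v \<subseteq> {1..<r} \<and> x = pt (index x) v"
    unfolding index_def by simp_all
  from someI_ex[OF i(2)] i(1) show "index x \<in> {1..r}" "keys (coord x) \<subseteq> {1..<r}" "pt (index x) (coord x) = x"
    unfolding coord_def by simp_all
qed

lemma index_pt: "i \<in> {1..r} \<Longrightarrow> keys v \<subseteq> {1..<r} \<Longrightarrow> index (pt i v) = i"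
  using index_coord[OF pt_in] pt_eq_iff[of "index (pt i v)" i "coord (pt i v)" v] by metis

lemma coord_pt:
  assumes "i \<in> {1..r}" "keys v \<subseteq> {1..<r}"
  shows "coord (pt i v) - v \<in> relator_subgroup r (M i)"
  using index_coord[OF pt_in[OF assms]] pt_eq_iff[of i i "coord (pt i v)" v] assms
  by (simp add: index_pt)

lemma tr_eq_pt:
  assumes "a \<in> X" "b \<in> X"
  shows "tr a b = pt (index a) (coord a + step (diff_mod r (index b) (index a)))"
  using pt_op[OF index_coord(1)[OF assms(1)] index_coord(1)[OF assms(2)]
      index_coord(2)[OF assms(1)] index_coord(2)[OF assms(2)]] assms
  by (simp add: index_coord(3))

lemma tr_closed:
  assumes "a \<in> X" "b \<in> X"
  shows "tr a b \<in> X"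
  unfolding tr_eq_pt[OF assms] using assms
  by (intro pt_in keys_add_subset keys_step_diff_mod index_coord)

lemma index_tr:
  assumes "a \<in> X" "b \<in> X"
  shows "index (tr a b) = index a"
  unfolding tr_eq_pt[OF assms] using assms
  by (intro index_pt keys_add_subset keys_step_diff_mod index_coord)

text \<open>The central coordinate of the image of g_x. It is chosen so that translation by a point
  of orbit j adds \<open>edge (index x) j\<close> modulo the row lattice, as the defining relation
  demands.\<close>

definition val :: "'a \<Rightarrow> (nat \<times> nat \<Rightarrow>\<^sub>0 int)" where
  "val x = edge_map r (index x) (coord x)"

lemma val_tr:
  assumes a: "a \<in> X" and b: "b \<in> X"
  shows "val (tr a b) - (val a + edge (index a) (index b)) \<in> row_lattice r M"
proof -
  let ?i = "index a" and ?s = "step (diff_mod r (index b) (index a))"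
  have i: "?i \<in> {1..r}" using index_coord(1)[OF a] .
  have "keys (coord a + ?s) \<subseteq> {1..<r}"
    using a by (intro keys_add_subset keys_step_diff_mod index_coord)
  then have "coord (tr a b) - (coord a + ?s) \<in> relator_subgroup r (M ?i)"
    unfolding tr_eq_pt[OF a b] by (rule coord_pt[OF i])
  from edge_map_relator_subgroup[OF i, of _ M, OF this] show ?thesis
    using edge_map_step[OF i index_coord(1)[OF b]]
    by (simp add: val_def index_tr[OF a b] edge_map_diff edge_map_add)
qed

definition letter_sign :: "bool \<Rightarrow> int" where
  "letter_sign e = (if e then 1 else - 1)"

fun word_degree :: "'a word \<Rightarrow> nat \<Rightarrow> int" where
  "word_degree [] l = 0"
| "word_degree ((a, e) # w) l = (if index a = l then letter_sign e else 0) + word_degree w l"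

text \<open>The central coordinate of the image of a word. An inverse letter contributes just the
  negative of \<open>val a\<close>, because the cocycle vanishes when both arguments are the same
  unit vector.\<close>

fun charge :: "'a word \<Rightarrow> (nat \<times> nat \<Rightarrow>\<^sub>0 int)" where
  "charge [] = 0"
| "charge ((a, e) # w) = frag_cmul (letter_sign e) (val a) +
     cross r (\<lambda>l. if index a = l then letter_sign e else 0) (word_degree w) + charge w"

lemma degree_Nil: "word_degree [] = (\<lambda>l. 0)"
  by (simp add: fun_eq_iff)

lemma degree_append: "word_degree (u @ v) = (\<lambda>l. word_degree u l + word_degree v l)"
proof
  show "word_degree (u @ v) l = word_degree u l + word_degree v l" for l
    by (induction u) auto
qed

lemma charge_append: "charge (u @ v) = charge u + charge v + cross r (word_degree u) (word_degree v)"
proof (induction u)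
  case Nil
  show ?case using cross_0_left[of r "word_degree v"] by simp
next
  case (Cons l u)
  obtain a e where l: "l = (a, e)" by fastforce
  have d: "word_degree (l # u) = (\<lambda>k. (if index a = k then letter_sign e else 0) + word_degree u k)"
    by (simp add: l fun_eq_iff)
  show ?case
    unfolding d cross_add_left append_Cons
    by (simp add: l Cons degree_append cross_add_right)
qed

lemma charge_two:
  assumes "index x \<in> {1..r}" "index y \<in> {1..r}"
  shows "charge [(x, True), (y, True)] =
    val x + (if index x < index y then frag_of (index x, index y) else 0) + val y"
proof -
  have s: "letter_sign True = 1" by (simp add: letter_sign_def)
  have d: "word_degree [(y, True)] = (\<lambda>l. if index y = l then 1 else 0)" by (simp add: fun_eq_iff s)
  show ?thesis
    unfolding charge.simps(2)[of x True] d s cross_single[OF assms]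
    using cross_0_right by (simp add: degree_Nil s)
qed

text \<open>The degree and, modulo the row lattice, the charge of a word only depend on the element of
  the structure group that it represents: they are the coordinates in a central extension
  of the degree group by the quotient of \<open>\<int>\<^bsup>pairs r\<^esup>\<close> by the row lattice.\<close>

lemma word_eq_degree_charge:
  assumes "word_eq X (structure_relations X tr) u v"
  shows "word_degree u = word_degree v \<and> charge u - charge v \<in> row_lattice r M"
  using assms
proof (induction rule: word_eq.induct)
  case (refl w)
  show ?case by (simp add: row_lattice_0)
next
  case (sym u v)
  then show ?case using row_lattice_minus[of "charge u - charge v"] by simp
next
  case (trans u v w)
  then show ?case using row_lattice_add[of "charge u - charge v" r M "charge v - charge w"] by simp
next
  case (append u v u' v')
  then show ?case
    using row_lattice_add[of "charge u - charge v" r M "charge u' - charge v'"]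
    by (simp add: degree_append charge_append algebra_simps)
next
  case (cancel s b)
  have s: "index s \<in> {1..r}" using index_coord(1)[OF cancel] .
  have d: "word_degree [(s, \<not> b)] = (\<lambda>l. if index s = l then letter_sign (\<not> b) else 0)" by (simp add: fun_eq_iff)
  have "word_degree [(s, b), (s, \<not> b)] = word_degree []"
    by (auto simp: fun_eq_iff letter_sign_def)
  moreover have "charge [(s, b), (s, \<not> b)] = 0"
    unfolding charge.simps(2)[of s b] d cross_single[OF s s]
    using cross_0_right by (simp add: degree_Nil letter_sign_def frag_cmul_distrib[symmetric])
  ultimately show ?case by (simp add: row_lattice_0)
next
  case (relation u v)
  then obtain a b where uv: "u = [(a, True), (b, True)]" "v = [(b, True), (tr a b, True)]"
    and a: "a \<in> X" and b: "b \<in> X" by blast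
  have i: "index a \<in> {1..r}" "index b \<in> {1..r}" using a b index_coord(1) by auto
  \<comment> \<open>One word puts orbit i before orbit j, the other j before i. At most one of the
    two cocycle terms is present, and their difference is the signed
    \<open>edge i j\<close>.\<close>
  have "charge u - charge v = - (val (tr a b) - (val a + edge (index a) (index b)))"
    unfolding uv using charge_two[OF i] charge_two[OF i(2), of "tr a b"] i index_tr[OF a b]
    by (auto simp: edge_def)
  then have "charge u - charge v \<in> row_lattice r M"
    using row_lattice_minus[OF val_tr[OF a b]] by simp
  then show ?case by (auto simp: uv index_tr[OF a b] fun_eq_iff)
qed

text \<open>For points in orbits i < j the charges of the two products in opposite order differ by
  exactly e_(i,j), while commutativity forces the difference into the row lattice.\<close>

lemma row_lattice_full_if_comm:
  assumes "comm_group (structure_group X tr)"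
  shows "row_lattice_full r M"
  unfolding row_lattice_full_def
proof
  fix p assume p: "p \<in> pairs r"
  obtain i j where ij: "p = (i, j)" by fastforce
  have i: "i \<in> {1..r}" and j: "j \<in> {1..r}" and "i < j" using p ij by (auto simp: pairs_def)
  let ?a = "pt i 0" and ?b = "pt j 0"
  have a: "?a \<in> X" "index ?a = i" and b: "?b \<in> X" "index ?b = j"
    using pt_in[OF i, of 0] pt_in[OF j, of 0] index_pt[OF i, of 0] index_pt[OF j, of 0] by simp_all
  have "charge [(?a, True), (?b, True)] - charge [(?b, True), (?a, True)] = frag_of p"
    using charge_two[of ?a ?b] charge_two[of ?b ?a] a b i j \<open>i < j\<close> ij by simp
  then show "frag_of p \<in> row_lattice r M"
    using word_eq_degree_charge[OF word_eq_if_comm_structure_group[OF assms a(1) b(1)]] by simp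
qed

end

section \<open>Generators of the structure group\<close>

definition gen :: "'a set \<Rightarrow> ('a \<Rightarrow> 'a \<Rightarrow> 'a) \<Rightarrow> 'a \<Rightarrow> 'a word set" where
  "gen X tr a = word_rel X (structure_relations X tr) `` {[(a, True)]}"

lemma group_structure_group: "group (structure_group X tr)"
  unfolding structure_group_def by (rule group_presented_group)

lemma class_in_structure_group:
  "w \<in> lists (X \<times> UNIV) \<Longrightarrow> word_rel X (structure_relations X tr) `` {w} \<in> carrier (structure_group X tr)"
  by (simp add: structure_group_def presented_group_def quotientI del: in_lists_conv_set)

lemma gen_in: "a \<in> X \<Longrightarrow> gen X tr a \<in> carrier (structure_group X tr)"
  unfolding gen_def by (rule class_in_structure_group) simp

lemma class_append:
  assumes "u \<in> lists (X \<times> UNIV)" "v \<in> lists (X \<times> UNIV)"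
  shows "word_rel X (structure_relations X tr) `` {u @ v} =
    (word_rel X (structure_relations X tr) `` {u}) \<otimes>\<^bsub>structure_group X tr\<^esub> (word_rel X (structure_relations X tr) `` {v})"
  unfolding structure_group_def mult_presented_group[OF assms] ..

lemma gen_relation:
  assumes "a \<in> X" "b \<in> X" "tr a b \<in> X"
  shows "gen X tr a \<otimes>\<^bsub>structure_group X tr\<^esub> gen X tr b = gen X tr b \<otimes>\<^bsub>structure_group X tr\<^esub> gen X tr (tr a b)"
proof -
  have "word_eq X (structure_relations X tr) [(a, True), (b, True)] [(b, True), (tr a b, True)]"
    by (rule word_eq.relation) (use assms in auto)
  then have "word_rel X (structure_relations X tr) `` {[(a, True)] @ [(b, True)]} =
      word_rel X (structure_relations X tr) `` {[(b, True)] @ [(tr a b, True)]}"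
    by (intro equiv_class_eq[OF equiv_word_rel]) (simp add: word_rel_def)
  moreover have "[(x, True)] \<in> lists (X \<times> UNIV)" if "x \<in> X" for x using that by simp
  ultimately show ?thesis
    unfolding gen_def using assms by (simp only: class_append)
qed

text \<open>Replaces induction on words: statements about all elements are proved by exhibiting a
  subgroup that contains the generators.\<close>

lemma structure_group_induct:
  assumes y: "y \<in> carrier (structure_group X tr)"
    and sub: "subgroup H (structure_group X tr)" and gen: "\<And>a. a \<in> X \<Longrightarrow> gen X tr a \<in> H"
  shows "y \<in> H"
proof -
  interpret group "structure_group X tr" by (rule group_structure_group)
  interpret subgroup H "structure_group X tr" by (rule sub)
  let ?cl = "\<lambda>w. word_rel X (structure_relations X tr) `` {w}"
  have one: "?cl [] = \<one>\<^bsub>structure_group X tr\<^esub>"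
    by (simp add: structure_group_def presented_group_def)
  have letter: "?cl [(a, e)] \<in> H" if a: "a \<in> X" for a e
  proof (cases e)
    case True
    then show ?thesis using gen[OF a] by (simp add: gen_def)
  next
    case False
    have l: "[(a, e)] \<in> lists (X \<times> UNIV)" for e using a by simp
    have "word_eq X (structure_relations X tr) [(a, False), (a, True)] []"
      using word_eq.cancel[OF a, of _ False] by simp
    then have "?cl ([(a, False)] @ [(a, True)]) = ?cl []"
      by (intro equiv_class_eq[OF equiv_word_rel]) (simp add: word_rel_def)
    then have "?cl [(a, False)] \<otimes>\<^bsub>structure_group X tr\<^esub> gen X tr a = \<one>\<^bsub>structure_group X tr\<^esub>"
      using class_append[OF l[of False] l[of True], of tr] one unfolding gen_def by simp
    then have "?cl [(a, False)] = inv\<^bsub>structure_group X tr\<^esub> (gen X tr a)"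
      using inv_equality[OF _ gen_in[OF a] class_in_structure_group[OF l]] by simp
    then show ?thesis using gen[OF a] m_inv_closed False by simp
  qed
  have "?cl w \<in> H" if "w \<in> lists (X \<times> UNIV)" for w
    using that
  proof (induction w rule: list.induct)
    case Nil
    show ?case using one one_closed by simp
  next
    case (Cons l w)
    obtain a e where l: "l = (a, e)" by fastforce
    have a: "a \<in> X" and w: "w \<in> lists (X \<times> UNIV)" and le: "[(a, e)] \<in> lists (X \<times> UNIV)"
      using Cons.prems l by auto
    have "?cl (l # w) = ?cl [(a, e)] \<otimes>\<^bsub>structure_group X tr\<^esub> ?cl w"
      using class_append[OF le w] by (simp add: l)
    then show ?case using m_closed[OF letter[OF a] Cons.IH[OF w]] by simp
  qed
  moreover obtain w where "w \<in> lists (X \<times> UNIV)" "y = ?cl w"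
    using y unfolding structure_group_def presented_group_def quotient_def by auto
  ultimately show ?thesis by simp
qed

lemma central_if_commutes_with_gens:
  assumes z: "z \<in> carrier (structure_group X tr)"
    and comm: "\<And>a. a \<in> X \<Longrightarrow> z \<otimes>\<^bsub>structure_group X tr\<^esub> gen X tr a = gen X tr a \<otimes>\<^bsub>structure_group X tr\<^esub> z"
    and y: "y \<in> carrier (structure_group X tr)"
  shows "z \<otimes>\<^bsub>structure_group X tr\<^esub> y = y \<otimes>\<^bsub>structure_group X tr\<^esub> z"
proof -
  interpret group "structure_group X tr" by (rule group_structure_group)
  have "y \<in> {y \<in> carrier (structure_group X tr). \<forall>x\<in>{z}. x \<otimes>\<^bsub>structure_group X tr\<^esub> y = y \<otimes>\<^bsub>structure_group X tr\<^esub> x}"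
    using y by (rule structure_group_induct) (use z comm gen_in in \<open>auto intro!: centralizer_subgroup[of "{z}", simplified]\<close>)
  then show ?thesis by simp
qed

section \<open>Central commutators in the structure group\<close>

context quandle_chart
begin

abbreviation "G \<equiv> structure_group X tr"
abbreviation "g \<equiv> gen X tr"

sublocale G: group G by (rule group_structure_group)

definition center :: "'a word set set" where
  "center = {y \<in> carrier G. \<forall>x\<in>carrier G. x \<otimes>\<^bsub>G\<^esub> y = y \<otimes>\<^bsub>G\<^esub> x}"

lemma subgroup_center: "subgroup center G"
  unfolding center_def by (rule G.centralizer_subgroup) simp

lemma center_in: "z \<in> center \<Longrightarrow> z \<in> carrier G"
  and center_comm: "z \<in> center \<Longrightarrow> x \<in> carrier G \<Longrightarrow> x \<otimes>\<^bsub>G\<^esub> z = z \<otimes>\<^bsub>G\<^esub> x"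
  by (auto simp: center_def)

lemma centerI:
  assumes "z \<in> carrier G" "\<And>a. a \<in> X \<Longrightarrow> z \<otimes>\<^bsub>G\<^esub> g a = g a \<otimes>\<^bsub>G\<^esub> z"
  shows "z \<in> center"
  using central_if_commutes_with_gens[OF assms] assms(1) by (auto simp: center_def)

lemma comm_group_center: "comm_group (G\<lparr>carrier := center\<rparr>)"
proof (rule group.group_comm_groupI)
  show "Group.group (G\<lparr>carrier := center\<rparr>)" using G.subgroup_imp_group[OF subgroup_center] .
qed (auto simp: center_comm center_in)

lemma g_in: "a \<in> X \<Longrightarrow> g a \<in> carrier G"
  by (rule gen_in)

lemma g_relation: "a \<in> X \<Longrightarrow> b \<in> X \<Longrightarrow> g a \<otimes>\<^bsub>G\<^esub> g b = g b \<otimes>\<^bsub>G\<^esub> g (tr a b)"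
  by (rule gen_relation) (auto intro: tr_closed)

lemma tr_index: "a \<in> X \<Longrightarrow> b \<in> X \<Longrightarrow> b' \<in> X \<Longrightarrow> index b = index b' \<Longrightarrow> tr a b = tr a b'"
  by (simp add: tr_eq_pt)

text \<open>g_b and g_b' conjugate every generator g_a to the same element, since
  \<open>tr a b = tr a b'\<close>. So their quotient commutes with all generators.\<close>

lemma same_orbit_ratio:
  assumes b: "b \<in> X" and b': "b' \<in> X" and idx: "index b = index b'"
  shows "\<exists>c\<in>center. g b' = c \<otimes>\<^bsub>G\<^esub> g b"
proof -
  let ?c = "g b' \<otimes>\<^bsub>G\<^esub> inv\<^bsub>G\<^esub> g b"
  have gb: "g b \<in> carrier G" "g b' \<in> carrier G" using b b' g_in by auto
  have "?c \<otimes>\<^bsub>G\<^esub> g a = g a \<otimes>\<^bsub>G\<^esub> ?c" if a: "a \<in> X" for a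
  proof -
    let ?d = "tr a b"
    have car: "g a \<in> carrier G" "g ?d \<in> carrier G" using a b tr_closed g_in by auto
    have 1: "g a \<otimes>\<^bsub>G\<^esub> g b = g b \<otimes>\<^bsub>G\<^esub> g ?d" "g a \<otimes>\<^bsub>G\<^esub> g b' = g b' \<otimes>\<^bsub>G\<^esub> g ?d"
      using g_relation[OF a b] g_relation[OF a b'] tr_index[OF a b b' idx] by simp_all
    have "?c \<otimes>\<^bsub>G\<^esub> g a = g b' \<otimes>\<^bsub>G\<^esub> (inv\<^bsub>G\<^esub> g b \<otimes>\<^bsub>G\<^esub> (g a \<otimes>\<^bsub>G\<^esub> g b)) \<otimes>\<^bsub>G\<^esub> inv\<^bsub>G\<^esub> g b"
      using gb car by (simp add: G.m_assoc)
    also have "\<dots> = g b' \<otimes>\<^bsub>G\<^esub> g ?d \<otimes>\<^bsub>G\<^esub> inv\<^bsub>G\<^esub> g b"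
      unfolding 1(1) using gb car by (simp add: G.m_assoc[symmetric])
    also have "\<dots> = g a \<otimes>\<^bsub>G\<^esub> ?c"
      unfolding 1(2)[symmetric] using gb car by (simp add: G.m_assoc)
    finally show ?thesis .
  qed
  then have "?c \<in> center" using gb by (intro centerI) auto
  moreover have "g b' = ?c \<otimes>\<^bsub>G\<^esub> g b" using gb by (simp add: G.m_assoc)
  ultimately show ?thesis by blast
qed

text \<open>By the defining relation this is the commutator g_a^-1 g_b^-1 g_a g_b of the generators
  at the base points.\<close>

definition commutator :: "nat \<Rightarrow> nat \<Rightarrow> 'a word set" where
  "commutator i j = inv\<^bsub>G\<^esub> g (pt i 0) \<otimes>\<^bsub>G\<^esub> g (tr (pt i 0) (pt j 0))"

lemma commutator_center:
  assumes i: "i \<in> {1..r}" and j: "j \<in> {1..r}"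
  shows "commutator i j \<in> center"
proof -
  let ?a = "pt i 0" and ?b = "pt j 0"
  have a: "?a \<in> X" and b: "?b \<in> X" using pt_in i j by simp_all
  note ab = tr_closed[OF a b]
  obtain c where c: "c \<in> center" "g (tr ?a ?b) = c \<otimes>\<^bsub>G\<^esub> g ?a"
    using same_orbit_ratio[OF a ab index_tr[OF a b, symmetric]] by blast
  have "commutator i j = inv\<^bsub>G\<^esub> g ?a \<otimes>\<^bsub>G\<^esub> (g ?a \<otimes>\<^bsub>G\<^esub> c)"
    unfolding commutator_def c(2) using center_comm[OF c(1) g_in[OF a]] by simp
  also have "\<dots> = c" using center_in[OF c(1)] g_in[OF a] by (simp add: G.m_assoc[symmetric])
  finally show ?thesis using c(1) by simp
qed

text \<open>Replacing a by the base point of its orbit changes g_a by a central factor, and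
  replacing b leaves the translation unchanged; so the commutator at the base points serves for all
  a and b.\<close>

lemma g_tr:
  assumes a: "a \<in> X" and b: "b \<in> X"
  shows "g (tr a b) = g a \<otimes>\<^bsub>G\<^esub> commutator (index a) (index b)"
proof -
  let ?a = "pt (index a) 0" and ?b = "pt (index b) 0"
  have ia: "index a \<in> {1..r}" "index b \<in> {1..r}" using a b index_coord by auto
  have a': "?a \<in> X" "index ?a = index a" and b': "?b \<in> X" "index ?b = index b"
    using pt_in index_pt ia by simp_all
  have tr_b: "tr x b = tr x ?b" if "x \<in> X" for x using tr_index[OF that b b'(1)] b'(2) by simp
  obtain c where c: "c \<in> center" "g a = c \<otimes>\<^bsub>G\<^esub> g ?a"
    using same_orbit_ratio[OF a'(1) a a'(2)] by blast
  note ab = tr_closed[OF a b] and ab' = tr_closed[OF a'(1) b'(1)]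
  have car: "g a \<in> carrier G" "g b \<in> carrier G" "g ?a \<in> carrier G" "g ?b \<in> carrier G" "c \<in> carrier G"
     "g (tr a b) \<in> carrier G" "g (tr ?a ?b) \<in> carrier G"
    using a b a' b' ab ab' g_in center_in c by auto
  have "g b \<otimes>\<^bsub>G\<^esub> g (tr a b) = g a \<otimes>\<^bsub>G\<^esub> g b" using g_relation[OF a b] by simp
  also have "\<dots> = c \<otimes>\<^bsub>G\<^esub> (g ?a \<otimes>\<^bsub>G\<^esub> g b)" using car by (simp add: c(2) G.m_assoc)
  also have "g ?a \<otimes>\<^bsub>G\<^esub> g b = g b \<otimes>\<^bsub>G\<^esub> g (tr ?a ?b)" using g_relation[OF a'(1) b] tr_b[OF a'(1)] by simp
  also have "c \<otimes>\<^bsub>G\<^esub> \<dots> = g b \<otimes>\<^bsub>G\<^esub> (c \<otimes>\<^bsub>G\<^esub> g (tr ?a ?b))"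
    using car center_comm[OF c(1), of "g b"] by (simp add: G.m_assoc[symmetric])
  finally have "g (tr a b) = c \<otimes>\<^bsub>G\<^esub> g (tr ?a ?b)" using car by simp
  also have "g (tr ?a ?b) = g ?a \<otimes>\<^bsub>G\<^esub> commutator (index a) (index b)"
    unfolding commutator_def using car by (simp add: G.m_assoc[symmetric])
  also have "c \<otimes>\<^bsub>G\<^esub> \<dots> = g a \<otimes>\<^bsub>G\<^esub> commutator (index a) (index b)"
    using car center_in[OF commutator_center[OF ia]] by (simp add: c(2) G.m_assoc)
  finally show ?thesis .
qed

lemma commutator_self:
  assumes i: "i \<in> {1..r}"
  shows "commutator i i = \<one>\<^bsub>G\<^esub>"
proof -
  have a: "pt i 0 \<in> X" using pt_in[OF i] by simp
  have "tr (pt i 0) (pt i 0) = pt i 0" using pt_op[OF i i, of 0 0] by (simp add: diff_mod_self step_def)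
  then show ?thesis using g_in[OF a] by (simp add: commutator_def)
qed

lemma commutator_swap:
  assumes i: "i \<in> {1..r}" and j: "j \<in> {1..r}"
  shows "commutator j i = inv\<^bsub>G\<^esub> commutator i j"
proof -
  let ?a = "pt i 0" and ?b = "pt j 0"
  have a: "?a \<in> X" "index ?a = i" and b: "?b \<in> X" "index ?b = j"
    using pt_in index_pt i j by simp_all
  note z = center_in[OF commutator_center[OF i j]] center_in[OF commutator_center[OF j i]]
  note gab = g_in[OF a(1)] g_in[OF b(1)]
  have "g ?a \<otimes>\<^bsub>G\<^esub> g ?b = g ?b \<otimes>\<^bsub>G\<^esub> g ?a \<otimes>\<^bsub>G\<^esub> commutator i j"
    using g_relation[OF a(1) b(1)] g_tr[OF a(1) b(1)] a b gab z by (simp add: G.m_assoc)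
  also have "g ?b \<otimes>\<^bsub>G\<^esub> g ?a = g ?a \<otimes>\<^bsub>G\<^esub> g ?b \<otimes>\<^bsub>G\<^esub> commutator j i"
    using g_relation[OF b(1) a(1)] g_tr[OF b(1) a(1)] a b gab z by (simp add: G.m_assoc)
  finally have "g ?a \<otimes>\<^bsub>G\<^esub> g ?b = g ?a \<otimes>\<^bsub>G\<^esub> g ?b \<otimes>\<^bsub>G\<^esub> (commutator j i \<otimes>\<^bsub>G\<^esub> commutator i j)"
    using gab z by (simp add: G.m_assoc)
  then have "commutator j i \<otimes>\<^bsub>G\<^esub> commutator i j = \<one>\<^bsub>G\<^esub>"
    using G.l_cancel_one'[of "g ?a \<otimes>\<^bsub>G\<^esub> g ?b" "commutator j i \<otimes>\<^bsub>G\<^esub> commutator i j"] gab z by simp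
  then show ?thesis using G.inv_equality z by simp
qed

lemma comm_if_row_lattice_full:
  assumes full: "row_lattice_full r M"
  shows "comm_group G"
proof -
  \<comment> \<open>The universal property of free abelian groups requires a commutative target; the
    center is one, and it contains all commutators.\<close>
  interpret Z: comm_group "G\<lparr>carrier := center\<rparr>" by (rule comm_group_center)
  let ?Z = "G\<lparr>carrier := center\<rparr>" and ?F = "free_Abelian_group (pairs r)"
  have "(\<lambda>(i, j). commutator i j) ` pairs r \<subseteq> carrier ?Z"
    using commutator_center by (auto simp: pairs_def)
  from Z.free_Abelian_group_universal[OF this] obtain h where h: "h \<in> hom ?F ?Z"
    and h_gen: "\<And>p. p \<in> pairs r \<Longrightarrow> h (frag_of p) = (\<lambda>(i, j). commutator i j) p"
    by metis
  have hom_F: "group_hom ?F ?Z h"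
    using h Z.group_axioms by (simp add: group_hom_def group_hom_axioms_def)
  have h_center: "h v \<in> center" if "keys v \<subseteq> pairs r" for v
    using h that by (auto simp: hom_def Pi_def)
  have h_add: "h (v + w) = h v \<otimes>\<^bsub>G\<^esub> h w" if "keys v \<subseteq> pairs r" "keys w \<subseteq> pairs r" for v w
    using hom_mult[OF h, of v w] that by simp
  have h_0: "h 0 = \<one>\<^bsub>G\<^esub>" using group_hom.hom_one[OF hom_F] by simp
  have h_minus: "h (- v) = inv\<^bsub>G\<^esub> h v" if "keys v \<subseteq> pairs r" for v
  proof -
    have "h (- v) \<otimes>\<^bsub>G\<^esub> h v = \<one>\<^bsub>G\<^esub>" using h_add[of "- v" v] that h_0 by simp
    then show ?thesis using G.inv_equality center_in h_center that by (metis keys_minus)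
  qed
  have h_edge: "h (edge i j) = commutator i j" if i: "i \<in> {1..r}" and j: "j \<in> {1..r}" for i j
  proof -
    consider "i < j" | "j < i" | "i = j" by linarith
    then show ?thesis
    proof cases
      case 1
      then show ?thesis using h_gen[of "(i, j)"] i j by (simp add: edge_def pairs_def)
    next
      case 2
      then have "h (edge i j) = inv\<^bsub>G\<^esub> commutator j i"
        using h_gen[of "(j, i)"] h_minus[of "frag_of (j, i)"] i j by (simp add: edge_def pairs_def)
      then show ?thesis using commutator_swap[OF j i] by simp
    next
      case 3
      then show ?thesis using commutator_self[OF i] by (simp add: edge_def h_0)
    qed
  qed
  \<comment> \<open>Bimultiplicativity in the form that is used: moving a point by v along its orbit
    multiplies its generator by the central element attached to v.\<close>
  have translate: "\<forall>w. keys w \<subseteq> {1..<r} \<longrightarrow> g (pt i (w + v)) = g (pt i w) \<otimes>\<^bsub>G\<^esub> h (edge_map r i v)"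
    if i: "i \<in> {1..r}" and v: "keys v \<subseteq> {1..<r}" for i v
  proof (rule free_Abelian_group_induct[OF v], goal_cases)
    case 1
    show ?case using pt_in[OF i] g_in by (simp add: h_0)
  next
    case (2 v v')
    note k = keys_edge_map[OF i 2(1)] keys_edge_map[OF i 2(2)]
    have kd: "keys (edge_map r i (v - v')) \<subseteq> pairs r" by (intro keys_edge_map i keys_diff_subset 2)
    show ?case
    proof (intro allI impI)
      fix w :: "nat \<Rightarrow>\<^sub>0 int" assume w: "keys w \<subseteq> {1..<r}"
      let ?w = "w + (v - v')"
      have kw: "keys ?w \<subseteq> {1..<r}" using w 2 by (intro keys_add_subset keys_diff_subset)
      have car: "g (pt i w) \<in> carrier G" "g (pt i ?w) \<in> carrier G"
        using g_in pt_in i w kw by auto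
      note hz = center_in[OF h_center[OF k(1)]] center_in[OF h_center[OF k(2)]] center_in[OF h_center[OF kd]]
      have "g (pt i ?w) \<otimes>\<^bsub>G\<^esub> h (edge_map r i v') = g (pt i (?w + v'))" by (rule 2(4)[rule_format, OF kw, symmetric])
      also have "?w + v' = w + v" by simp
      also have "g (pt i (w + v)) = g (pt i w) \<otimes>\<^bsub>G\<^esub> h (edge_map r i v)" using 2(3) w by blast
      also have "edge_map r i v = edge_map r i (v - v') + edge_map r i v'" by (simp add: edge_map_diff)
      also have "h \<dots> = h (edge_map r i (v - v')) \<otimes>\<^bsub>G\<^esub> h (edge_map r i v')" by (rule h_add[OF kd k(2)])
      finally show "g (pt i ?w) = g (pt i w) \<otimes>\<^bsub>G\<^esub> h (edge_map r i (v - v'))"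
        using car hz by (simp add: G.m_assoc[symmetric])
    qed
  next
    case (3 k)
    then have k: "k < r" "k \<noteq> 0" by auto
    let ?j = "shift r i k"
    have j: "?j \<in> {1..r}" using shift_in[OF i k(1)] .
    show ?case
    proof (intro allI impI)
      fix w :: "nat \<Rightarrow>\<^sub>0 int" assume w: "keys w \<subseteq> {1..<r}"
      have X: "pt i w \<in> X" "pt ?j 0 \<in> X" using pt_in i j w by simp_all
      have "pt i (w + frag_of k) = tr (pt i w) (pt ?j 0)"
        using pt_op[OF i j w, of 0] k by (simp add: diff_mod_shift[OF i k(1)] step_def)
      then show "g (pt i (w + frag_of k)) = g (pt i w) \<otimes>\<^bsub>G\<^esub> h (edge_map r i (frag_of k))"
        using g_tr[OF X] index_pt[OF i w] index_pt[OF j, of 0] h_edge[OF i j] by (simp add: edge_map_frag_of)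
    qed
  qed
  \<comment> \<open>A relator leads from \<open>pt i 0\<close> back to the same point, so the factor
    picked up on the way is 1.\<close>
  have relator: "h (edge_map r i v) = \<one>\<^bsub>G\<^esub>" if i: "i \<in> {1..r}" and v: "v \<in> relator_subgroup r (M i)" for i v
  proof -
    have kv: "keys v \<subseteq> {1..<r}" using relator_subgroup_keys[OF v] .
    have "pt i v = pt i 0" using pt_eq_iff[OF i i kv, of 0] v by simp
    then have "g (pt i 0) = g (pt i 0) \<otimes>\<^bsub>G\<^esub> h (edge_map r i v)" using translate[OF i kv, rule_format, of 0] by simp
    moreover have "g (pt i 0) \<in> carrier G" using pt_in[OF i, of 0] g_in by simp
    ultimately show ?thesis
      using G.l_cancel_one' center_in[OF h_center[OF keys_edge_map[OF i kv]]] by blast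
  qed
  have kernel: "v \<in> {v. keys v \<subseteq> pairs r \<and> h v = \<one>\<^bsub>G\<^esub>}" if "v \<in> row_lattice r M" for v
    using that unfolding row_lattice_def
  proof (rule group_closure_least)
    have "edge_map r i (relator (M i) j) \<in> {v. keys v \<subseteq> pairs r \<and> h v = \<one>\<^bsub>G\<^esub>}"
      if i: "i \<in> {1..r}" and j: "j \<in> {1..<r}" for i j
    proof -
      have v: "relator (M i) j \<in> relator_subgroup r (M i)"
        unfolding relator_subgroup_eq using j by (intro group_closure.base) blast
      show ?thesis using relator[OF i v] keys_edge_map[OF i relator_subgroup_keys[OF v]] by simp
    qed
    then show "(\<lambda>(i, j). edge_map r i (relator (M i) j)) ` ({1..r} \<times> {1..<r}) \<subseteq> {v. keys v \<subseteq> pairs r \<and> h v = \<one>\<^bsub>G\<^esub>}"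
      by (simp only: image_subset_iff split: prod.split) blast
    show "0 \<in> {v. keys v \<subseteq> pairs r \<and> h v = \<one>\<^bsub>G\<^esub>}" using h_0 by simp
    fix a b assume a: "a \<in> {v. keys v \<subseteq> pairs r \<and> h v = \<one>\<^bsub>G\<^esub>}" and b: "b \<in> {v. keys v \<subseteq> pairs r \<and> h v = \<one>\<^bsub>G\<^esub>}"
    then have "h (a + - b) = \<one>\<^bsub>G\<^esub>" by (subst h_add) (auto simp: h_minus)
    then show "a - b \<in> {v. keys v \<subseteq> pairs r \<and> h v = \<one>\<^bsub>G\<^esub>}" using a b by (simp add: keys_diff_subset)
  qed
  have trivial: "commutator i j = \<one>\<^bsub>G\<^esub>" if i: "i \<in> {1..r}" and j: "j \<in> {1..r}" for i j
  proof -
    have less: "commutator i j = \<one>\<^bsub>G\<^esub>" if "i \<in> {1..r}" "j \<in> {1..r}" "i < j" for i j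
    proof -
      have p: "(i, j) \<in> pairs r" using that by (simp add: pairs_def)
      then have "frag_of (i, j) \<in> row_lattice r M" using full by (simp add: row_lattice_full_def)
      from kernel[OF this] show ?thesis using h_gen[OF p] by simp
    qed
    consider "i < j" | "j < i" | "i = j" by linarith
    then show ?thesis
      using less[OF i j] less[OF j i] commutator_swap[OF j i] commutator_self[OF i] by cases auto
  qed
  have "g a \<in> center" if a: "a \<in> X" for a
  proof (rule centerI[OF g_in[OF a]])
    fix b assume b: "b \<in> X"
    have "g (tr a b) = g a"
      using g_tr[OF a b] trivial index_coord(1)[OF a] index_coord(1)[OF b] g_in[OF a] by simp
    then show "g a \<otimes>\<^bsub>G\<^esub> g b = g b \<otimes>\<^bsub>G\<^esub> g a" using g_relation[OF a b] by simp
  qed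
  then have "y \<in> center" if "y \<in> carrier G" for y
    using structure_group_induct[OF that subgroup_center] by blast
  then show ?thesis
    using center_comm by (intro G.group_comm_groupI) blast
qed

end

section \<open>The parameter group\<close>

lemma (in comm_group) trivial_FactGroup_iff:
  assumes N: "subgroup N G"
  shows "trivial_group (G Mod N) \<longleftrightarrow> N = carrier G"
proof
  have car: "carrier (G Mod N) = (\<lambda>x. N #> x) ` carrier G"
    by (auto simp: FactGroup_def RCOSETS_def)
  have one: "\<one>\<^bsub>G Mod N\<^esub> = N" by (simp add: FactGroup_def)
  show "N = carrier G" if "trivial_group (G Mod N)"
  proof
    show "N \<subseteq> carrier G" using N by (rule subgroup.subset)
    show "carrier G \<subseteq> N"
    proof
      fix x assume x: "x \<in> carrier G"
      then have "N #> x \<in> carrier (G Mod N)" unfolding car by blast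
      then have "N #> x = N" using that by (simp add: trivial_group_def one)
      then show "x \<in> N" using coset_join1 x N by blast
    qed
  qed
  show "trivial_group (G Mod N)" if eq: "N = carrier G"
  proof -
    have "N #> x = N" if "x \<in> carrier G" for x using coset_join2[OF that N] that eq by simp
    then have "carrier (G Mod N) \<subseteq> {\<one>\<^bsub>G Mod N\<^esub>}" unfolding car one by blast
    then show ?thesis
      using group.trivial_group_subset normal.factorgroup_is_group[OF subgroup_imp_normal[OF N]] by blast
  qed
qed

text \<open>Lifts of elements of the product to exponent vectors. The support condition is imposed
  at every index, also outside the orbits, so that it passes to sums without side
  conditions.\<close>

definition family :: "nat \<Rightarrow> (nat \<Rightarrow> (nat \<Rightarrow>\<^sub>0 int)) \<Rightarrow> bool" where
  "family r v \<longleftrightarrow> (\<forall>l. keys (v l) \<subseteq> {1..<r})"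

definition family_class ::
  "nat \<Rightarrow> (nat \<Rightarrow> nat \<Rightarrow> nat \<Rightarrow> int) \<Rightarrow> (nat \<Rightarrow> (nat \<Rightarrow>\<^sub>0 int)) \<Rightarrow> (nat \<Rightarrow> (nat \<Rightarrow>\<^sub>0 int) set)" where
  "family_class r M v = (\<lambda>l\<in>{1..r}. relator_coset r (M l) (v l))"

abbreviation single :: "nat \<Rightarrow> (nat \<Rightarrow>\<^sub>0 int) \<Rightarrow> nat \<Rightarrow> (nat \<Rightarrow>\<^sub>0 int)" where
  "single i v \<equiv> (\<lambda>l. if l = i then v else 0)"

lemma family_single: "keys v \<subseteq> {1..<r} \<Longrightarrow> family r (single i v)"
  by (simp add: family_def)

lemma family_add: "family r v \<Longrightarrow> family r w \<Longrightarrow> family r (\<lambda>l. v l + w l)"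
  and family_diff: "family r v \<Longrightarrow> family r w \<Longrightarrow> family r (\<lambda>l. v l - w l)"
  and family_minus: "family r v \<Longrightarrow> family r (\<lambda>l. - v l)"
  by (simp_all add: family_def keys_add_subset keys_diff_subset)

lemma carrier_param_product: "carrier (param_product r M) = family_class r M ` {v. family r v}"
proof
  show "family_class r M ` {v. family r v} \<subseteq> carrier (param_product r M)"
    by (auto simp: param_product_def family_class_def family_def carrier_param_G)
  show "carrier (param_product r M) \<subseteq> family_class r M ` {v. family r v}"
  proof
    fix x assume x: "x \<in> carrier (param_product r M)"
    then have "\<forall>l\<in>{1..r}. \<exists>v. keys v \<subseteq> {1..<r} \<and> x l = relator_coset r (M l) v"
      unfolding param_product_def carrier_product_group carrier_param_G by (auto dest!: PiE_mem)
    from bchoice[OF this] obtain v where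
      v: "\<forall>l\<in>{1..r}. keys (v l) \<subseteq> {1..<r} \<and> x l = relator_coset r (M l) (v l)" ..
    let ?v = "\<lambda>l. if l \<in> {1..r} then v l else 0"
    have "x \<in> extensional {1..r}" using x by (simp add: param_product_def PiE_def)
    then have "x = family_class r M ?v"
      using v by (auto simp: family_class_def fun_eq_iff extensional_def)
    moreover have "family r ?v" using v by (simp add: family_def)
    ultimately show "x \<in> family_class r M ` {v. family r v}" by blast
  qed
qed

lemma mult_family_class:
  assumes "family r v" "family r w"
  shows "family_class r M v \<otimes>\<^bsub>param_product r M\<^esub> family_class r M w = family_class r M (\<lambda>l. v l + w l)"
  using assms by (auto simp: param_product_def family_class_def fun_eq_iff family_def mult_param_G)

lemma one_param_product: "\<one>\<^bsub>param_product r M\<^esub> = family_class r M (\<lambda>l. 0)"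
  by (simp add: param_product_def family_class_def one_param_G)

lemma group_param_product: "group (param_product r M)"
  unfolding param_product_def by (rule product_group) (rule group_param_G)

lemma comm_group_param_product: "comm_group (param_product r M)"
proof (rule group.group_comm_groupI[OF group_param_product])
  fix x y assume "x \<in> carrier (param_product r M)" "y \<in> carrier (param_product r M)"
  then show "x \<otimes>\<^bsub>param_product r M\<^esub> y = y \<otimes>\<^bsub>param_product r M\<^esub> x"
    unfolding carrier_param_product by (auto simp: mult_family_class add.commute)
qed

lemma inv_family_class:
  assumes "family r v"
  shows "inv\<^bsub>param_product r M\<^esub> family_class r M v = family_class r M (\<lambda>l. - v l)"
proof (rule group.inv_equality[OF group_param_product])
  show "family_class r M (\<lambda>l. - v l) \<otimes>\<^bsub>param_product r M\<^esub> family_class r M v = \<one>\<^bsub>param_product r M\<^esub>"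
    using assms by (simp add: mult_family_class family_minus one_param_product)
qed (use assms family_minus carrier_param_product in blast)+

lemma family_class_eq_iff:
  "family_class r M v = family_class r M w \<longleftrightarrow> (\<forall>l\<in>{1..r}. v l - w l \<in> relator_subgroup r (M l))"
  by (auto simp: family_class_def fun_eq_iff relator_coset_eq_iff[symmetric])

lemma param_emb_eq: "param_emb r M i k = family_class r M (single i (step k))"
  by (auto simp: param_emb_def family_class_def fun_eq_iff param_x_eq one_param_G)

text \<open>The lift of the relator that pairs x_(j-i) of factor i with x_(i-j) of factor j.\<close>

definition kernel_family :: "nat \<Rightarrow> nat \<Rightarrow> nat \<Rightarrow> nat \<Rightarrow> (nat \<Rightarrow>\<^sub>0 int)" where
  "kernel_family r i j = (\<lambda>l. single i (step (diff_mod r j i)) l + single j (step (diff_mod r i j)) l)"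

definition param_kernel :: "nat \<Rightarrow> (nat \<Rightarrow> nat \<Rightarrow> nat \<Rightarrow> int) \<Rightarrow> (nat \<Rightarrow> (nat \<Rightarrow>\<^sub>0 int) set) set" where
  "param_kernel r M = generate (param_product r M)
     {family_class r M (kernel_family r i j) | i j. (i, j) \<in> pairs r}"

lemma family_kernel_family:
  assumes "(i, j) \<in> pairs r"
  shows "family r (kernel_family r i j)"
proof -
  have "i \<in> {1..r}" "j \<in> {1..r}" using assms by (auto simp: pairs_def)
  then show ?thesis unfolding kernel_family_def by (intro family_add family_single keys_step_diff_mod)
qed

lemma subgroup_param_kernel: "subgroup (param_kernel r M) (param_product r M)"
  unfolding param_kernel_def
  by (rule group.generate_is_subgroup[OF group_param_product])
     (use family_kernel_family in \<open>auto simp: carrier_param_product\<close>)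

lemma parameter_group_eq: "parameter_group r M = param_product r M Mod param_kernel r M"
proof -
  have emb: "param_emb r M i (diff_mod r j i) \<otimes>\<^bsub>param_product r M\<^esub> param_emb r M j (diff_mod r i j) =
      family_class r M (kernel_family r i j)" if "(i, j) \<in> pairs r" for i j
  proof -
    have i: "i \<in> {1..r}" and j: "j \<in> {1..r}" using that by (auto simp: pairs_def)
    show ?thesis
      unfolding param_emb_eq kernel_family_def
      by (intro mult_family_class family_single keys_step_diff_mod i j)
  qed
  have "{param_emb r M i (diff_mod r j i) \<otimes>\<^bsub>param_product r M\<^esub> param_emb r M j (diff_mod r i j)
           | i j. 1 \<le> i \<and> i < j \<and> j \<le> r} = {family_class r M (kernel_family r i j) | i j. (i, j) \<in> pairs r}"
    by (intro Collect_cong ex_cong1) (use emb in \<open>auto simp: pairs_def\<close>)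
  then show ?thesis by (simp add: parameter_group_def param_kernel_def)
qed

lemma trivial_parameter_group_iff:
  "trivial_group (parameter_group r M) \<longleftrightarrow> (\<forall>v. family r v \<longrightarrow> family_class r M v \<in> param_kernel r M)"
proof -
  have "param_kernel r M \<subseteq> carrier (param_product r M)"
    using subgroup.subset[OF subgroup_param_kernel] .
  then have "param_kernel r M = carrier (param_product r M) \<longleftrightarrow> (\<forall>v. family r v \<longrightarrow> family_class r M v \<in> param_kernel r M)"
    unfolding carrier_param_product by blast
  then show ?thesis
    unfolding parameter_group_eq comm_group.trivial_FactGroup_iff[OF comm_group_param_product subgroup_param_kernel] .
qed

text \<open>On lifts, the homomorphism from the product to Z^columns that induces the isomorphism of
  the parameter group with the quotient by the row lattice.\<close>

definition family_sum :: "nat \<Rightarrow> (nat \<Rightarrow> (nat \<Rightarrow>\<^sub>0 int)) \<Rightarrow> (nat \<times> nat \<Rightarrow>\<^sub>0 int)" where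
  "family_sum r v = (\<Sum>l\<in>{1..r}. edge_map r l (v l))"

lemma family_sum_add: "family_sum r (\<lambda>l. v l + w l) = family_sum r v + family_sum r w"
  and family_sum_diff: "family_sum r (\<lambda>l. v l - w l) = family_sum r v - family_sum r w"
  by (simp_all add: family_sum_def edge_map_add edge_map_diff sum.distrib sum_subtractf)

lemma edge_map_minus: "edge_map r i (- v) = - edge_map r i v"
  using edge_map_diff[of r i 0 v] by simp

lemma family_sum_minus: "family_sum r (\<lambda>l. - v l) = - family_sum r v"
  by (simp add: family_sum_def edge_map_minus sum_negf)

lemma family_sum_single:
  assumes "i \<in> {1..r}"
  shows "family_sum r (single i v) = edge_map r i v"
proof -
  have "family_sum r (single i v) = (\<Sum>l\<in>{1..r}. if l = i then edge_map r i v else 0)"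
    unfolding family_sum_def by (rule sum.cong) auto
  then show ?thesis using assms by simp
qed

lemma row_lattice_sum:
  "(\<And>i. i \<in> I \<Longrightarrow> f i \<in> row_lattice r M) \<Longrightarrow> sum f I \<in> row_lattice r M"
  unfolding row_lattice_def by (rule group_closure_sum_in)

text \<open>The pairing relators have sum \<open>edge i j + edge j i\<close>, which is 0. The claim
  is about some lift of x: another lift changes the sum by an element of the row lattice.\<close>

lemma param_kernel_family_sum:
  assumes "x \<in> param_kernel r M"
  shows "\<exists>v. family r v \<and> x = family_class r M v \<and> family_sum r v \<in> row_lattice r M"
  using assms unfolding param_kernel_def
proof induction
  case one
  show ?case
    by (intro exI[of _ "\<lambda>l. 0"])
       (simp add: one_param_product family_sum_def row_lattice_0 family_def)
next
  case (incl h)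
  then obtain i j where ij: "(i, j) \<in> pairs r" "h = family_class r M (kernel_family r i j)" by blast
  have i: "i \<in> {1..r}" and j: "j \<in> {1..r}" using ij by (auto simp: pairs_def)
  have "family_sum r (kernel_family r i j) = 0"
    unfolding kernel_family_def family_sum_add family_sum_single[OF i] family_sum_single[OF j]
    using edge_map_step[OF i j] edge_map_step[OF j i] edge_swap[of j i] by simp
  then show ?case
    using ij family_kernel_family[OF ij(1)] row_lattice_0[of r M] by (intro exI[of _ "kernel_family r i j"]) simp
next
  case (inv h)
  then obtain i j where ij: "(i, j) \<in> pairs r" "h = family_class r M (kernel_family r i j)" by blast
  have i: "i \<in> {1..r}" and j: "j \<in> {1..r}" using ij by (auto simp: pairs_def)
  have "family_sum r (kernel_family r i j) = 0"
    unfolding kernel_family_def family_sum_add family_sum_single[OF i] family_sum_single[OF j]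
    using edge_map_step[OF i j] edge_map_step[OF j i] edge_swap[of j i] by simp
  then show ?case
    using ij family_kernel_family[OF ij(1)] row_lattice_0[of r M]
    by (intro exI[of _ "\<lambda>l. - kernel_family r i j l"])
       (simp add: inv_family_class family_sum_minus family_minus)
next
  case (eng h1 h2)
  then obtain v w where v: "family r v" "h1 = family_class r M v" "family_sum r v \<in> row_lattice r M"
    and w: "family r w" "h2 = family_class r M w" "family_sum r w \<in> row_lattice r M" by blast
  then show ?case
    by (intro exI[of _ "\<lambda>l. v l + w l"])
       (simp add: mult_family_class family_sum_add family_add row_lattice_add)
qed

lemma row_lattice_full_if_trivial:
  assumes "trivial_group (parameter_group r M)"
  shows "row_lattice_full r M"
  unfolding row_lattice_full_def
proof
  fix p assume p: "p \<in> pairs r"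
  obtain i j where ij: "p = (i, j)" by fastforce
  have i: "i \<in> {1..r}" and j: "j \<in> {1..r}" and "i < j" using p ij by (auto simp: pairs_def)
  let ?w = "single i (step (diff_mod r j i))"
  have "family r ?w" using i by (intro family_single keys_step_diff_mod)
  then have "family_class r M ?w \<in> param_kernel r M"
    using assms unfolding trivial_parameter_group_iff by blast
  then obtain v where v: "family_class r M ?w = family_class r M v" "family_sum r v \<in> row_lattice r M"
    using param_kernel_family_sum by blast
  \<comment> \<open>Two lifts of the same class differ by relators in each factor, which
    \<open>edge_map\<close> sends into the row lattice.\<close>
  have "family_sum r (\<lambda>l. ?w l - v l) \<in> row_lattice r M"
    unfolding family_sum_def
    by (intro row_lattice_sum edge_map_relator_subgroup) (use v(1) in \<open>auto simp: family_class_eq_iff\<close>)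
  from row_lattice_add[OF this v(2)] have "family_sum r ?w \<in> row_lattice r M"
    by (simp only: family_sum_diff diff_add_cancel)
  moreover have "family_sum r ?w = frag_of p"
    using edge_map_step[OF i j] \<open>i < j\<close> by (simp add: family_sum_single[OF i] edge_def ij)
  ultimately show "frag_of p \<in> row_lattice r M" by simp
qed

text \<open>The inverse direction: e_(i,j) goes back to x_(j-i) of the factor with the smaller index
  i.\<close>

definition family_of :: "nat \<Rightarrow> (nat \<times> nat \<Rightarrow>\<^sub>0 int) \<Rightarrow> nat \<Rightarrow> (nat \<Rightarrow>\<^sub>0 int)" where
  "family_of r u l = frag_extend (\<lambda>(i, j). single i (step (diff_mod r j i)) l) u"

lemma family_of_0 [simp]: "family_of r 0 l = 0"
  and family_of_diff: "family_of r (u - v) l = family_of r u l - family_of r v l"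
  and family_of_minus: "family_of r (- u) l = - family_of r u l"
  by (simp_all add: family_of_def frag_extend_diff frag_extend_minus)

lemma family_of_frag_of: "family_of r (frag_of (i, j)) = single i (step (diff_mod r j i))"
  by (simp add: family_of_def fun_eq_iff)

definition kernel_families :: "nat \<Rightarrow> (nat \<Rightarrow> nat \<Rightarrow> nat \<Rightarrow> int) \<Rightarrow> (nat \<Rightarrow> (nat \<Rightarrow>\<^sub>0 int)) set" where
  "kernel_families r M = {v. family r v \<and> family_class r M v \<in> param_kernel r M}"

lemma kernel_families_diff:
  assumes v: "v \<in> kernel_families r M" and w: "w \<in> kernel_families r M"
  shows "(\<lambda>l. v l - w l) \<in> kernel_families r M"
proof -
  interpret subgroup "param_kernel r M" "param_product r M" by (rule subgroup_param_kernel)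
  have fv: "family r v" "family r w" using v w by (auto simp: kernel_families_def)
  have "family_class r M v \<otimes>\<^bsub>param_product r M\<^esub> inv\<^bsub>param_product r M\<^esub> family_class r M w \<in> param_kernel r M"
    using v w by (simp add: kernel_families_def)
  then show ?thesis
    using fv by (simp add: inv_family_class mult_family_class family_minus family_diff kernel_families_def)
qed

lemma kernel_families_relator:
  assumes "family r v" "\<And>l. l \<in> {1..r} \<Longrightarrow> v l \<in> relator_subgroup r (M l)"
  shows "v \<in> kernel_families r M"
proof -
  have "family_class r M v = \<one>\<^bsub>param_product r M\<^esub>"
    unfolding one_param_product family_class_eq_iff using assms by simp
  then show ?thesis
    using subgroup.one_closed[OF subgroup_param_kernel, of r M] assms by (simp add: kernel_families_def)
qed

lemma kernel_families_0: "(\<lambda>l. 0) \<in> kernel_families r M"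
  by (rule kernel_families_relator) (simp_all add: family_def relator_subgroup_0)

lemma kernel_families_minus: "v \<in> kernel_families r M \<Longrightarrow> (\<lambda>l. - v l) \<in> kernel_families r M"
  using kernel_families_diff[OF kernel_families_0] by simp

lemma kernel_families_add:
  assumes "v \<in> kernel_families r M" "w \<in> kernel_families r M"
  shows "(\<lambda>l. v l + w l) \<in> kernel_families r M"
  using kernel_families_diff[OF assms(1) kernel_families_minus[OF assms(2)]] by simp

lemma kernel_families_kernel_family: "(i, j) \<in> pairs r \<Longrightarrow> kernel_family r i j \<in> kernel_families r M"
  unfolding kernel_families_def param_kernel_def
  using family_kernel_family by (auto intro!: generate.incl)

text \<open>For i < i + k modulo r the round trip is the identity. Otherwise x_k comes back as the
  inverse of its partner in the other factor, and the discrepancy is the negative of a pairing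
  relator.\<close>

lemma family_of_edge_map:
  assumes i: "i \<in> {1..r}" and v: "keys v \<subseteq> {1..<r}"
  shows "(\<lambda>l. family_of r (edge_map r i v) l - single i v l) \<in> kernel_families r M"
proof (rule free_Abelian_group_induct[OF v], goal_cases)
  case 1
  have "(\<lambda>l. family_of r (edge_map r i 0) l - single i 0 l) = (\<lambda>l. 0)" by (simp add: fun_eq_iff)
  then show ?case using kernel_families_0 by simp
next
  case (2 v w)
  have "(\<lambda>l. family_of r (edge_map r i (v - w)) l - single i (v - w) l) =
    (\<lambda>l. (family_of r (edge_map r i v) l - single i v l) - (family_of r (edge_map r i w) l - single i w l))"
    by (simp add: fun_eq_iff edge_map_diff family_of_diff)
  then show ?case using kernel_families_diff[OF 2(3,4)] by simp
next
  case (3 k)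
  then have k: "k < r" "k \<noteq> 0" by auto
  let ?j = "shift r i k"
  have j: "?j \<in> {1..r}" and d: "diff_mod r ?j i = k"
    using shift_in[OF i k(1)] diff_mod_shift[OF i k(1)] by auto
  have ij: "?j \<noteq> i" using d k diff_mod_self by metis
  show ?case
  proof (cases "i < ?j")
    case True
    then have "(\<lambda>l. family_of r (edge_map r i (frag_of k)) l - single i (frag_of k) l) = (\<lambda>l. 0)"
      using k by (simp add: fun_eq_iff edge_map_frag_of edge_def family_of_frag_of d step_def)
    then show ?thesis using kernel_families_0 by simp
  next
    case False
    then have "?j < i" using ij by simp
    then have p: "(?j, i) \<in> pairs r" using i j by (simp add: pairs_def)
    have "(\<lambda>l. family_of r (edge_map r i (frag_of k)) l - single i (frag_of k) l) = (\<lambda>l. - kernel_family r ?j i l)"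
      using \<open>?j < i\<close> k by (auto simp: fun_eq_iff edge_map_frag_of edge_def family_of_minus family_of_frag_of kernel_family_def d step_def)
    then show ?thesis using kernel_families_minus[OF kernel_families_kernel_family[OF p]] by simp
  qed
qed

text \<open>A row comes back, modulo the pairing relators, as the relator it arose from, which is
  trivial in its factor.\<close>

lemma family_of_row_lattice:
  assumes "u \<in> row_lattice r M"
  shows "family_of r u \<in> kernel_families r M"
  using assms unfolding row_lattice_def
proof induction
  case (base u)
  then consider "u = 0" | i j where "i \<in> {1..r}" "j \<in> {1..<r}" "u = edge_map r i (relator (M i) j)" by auto
  then show ?case
  proof cases
    case 1
    have "family_of r 0 = (\<lambda>l. 0)" by (simp add: fun_eq_iff)
    then show ?thesis using kernel_families_0 1 by simp
  next
    case 2
    let ?v = "relator (M i) j"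
    have v: "?v \<in> relator_subgroup r (M i)"
      unfolding relator_subgroup_eq using 2 by (intro group_closure.base) blast
    note kv = relator_subgroup_keys[OF v]
    have "single i ?v \<in> kernel_families r M"
      using v by (intro kernel_families_relator family_single kv) (auto simp: relator_subgroup_0)
    from kernel_families_add[OF family_of_edge_map[OF 2(1) kv] this] show ?thesis by (simp add: 2)
  qed
next
  case (diff s t)
  have "family_of r (s - t) = (\<lambda>l. family_of r s l - family_of r t l)" by (simp add: fun_eq_iff family_of_diff)
  then show ?case using kernel_families_diff[OF diff.IH] by simp
qed

text \<open>If the lattice is full, each \<open>edge_map r i v\<close> lies in it, so the round trip
  puts every vector concentrated in one factor into the kernel; finite sums of these give all
  families.\<close>

lemma trivial_if_row_lattice_full:
  assumes full: "row_lattice_full r M"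
  shows "trivial_group (parameter_group r M)"
proof -
  have all: "u \<in> row_lattice r M" if "keys u \<subseteq> pairs r" for u
    by (rule free_Abelian_group_induct[OF that])
       (use full in \<open>simp_all add: row_lattice_0 row_lattice_diff row_lattice_full_def\<close>)
  have single: "single i v \<in> kernel_families r M" if i: "i \<in> {1..r}" and v: "keys v \<subseteq> {1..<r}" for i v
    using kernel_families_diff[OF family_of_row_lattice[OF all[OF keys_edge_map[OF i v]]] family_of_edge_map[OF i v]]
    by simp
  have "family_class r M v \<in> param_kernel r M" if v: "family r v" for v
  proof -
    have "(\<lambda>l. if l \<in> A then v l else 0) \<in> kernel_families r M" if "finite A" "A \<subseteq> {1..r}" for A
      using that
    proof (induction A rule: finite_induct)
      case empty
      then show ?case using kernel_families_0 by simp
    next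
      case (insert a A)
      have "(\<lambda>l. if l \<in> insert a A then v l else 0) = (\<lambda>l. single a (v a) l + (if l \<in> A then v l else 0))"
        using insert.hyps by (auto simp: fun_eq_iff)
      moreover have "single a (v a) \<in> kernel_families r M"
        using single insert.prems v by (simp add: family_def)
      ultimately show ?case using kernel_families_add insert by simp
    qed
    from this[of "{1..r}"] have "family_class r M (\<lambda>l. if l \<in> {1..r} then v l else 0) \<in> param_kernel r M"
      by (simp add: kernel_families_def)
    moreover have "family_class r M (\<lambda>l. if l \<in> {1..r} then v l else 0) = family_class r M v"
      by (simp add: family_class_def fun_eq_iff)
    ultimately show ?thesis by simp
  qed
  then show ?thesis unfolding trivial_parameter_group_iff by blast
qed

section \<open>The parameter matrix\<close>

lemma set_col_labels: "set (col_labels r) = pairs r"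
  by (force simp: col_labels_def pairs_def)

lemma set_row_labels: "set (row_labels r) = {1..r} \<times> {1..<r}"
  by (force simp: row_labels_def)

lemma distinct_col_labels: "distinct (col_labels r)"
proof -
  \<comment> \<open>Induction on the outer list requires an arbitrary distinct list of first
    components.\<close>
  have "distinct (concat (map (\<lambda>i. map (Pair i) [i+1..<r+1]) ns))" if "distinct ns" for ns
    using that by (induction ns) (auto simp: distinct_map inj_on_def)
  then show ?thesis by (simp add: col_labels_def)
qed

lemma length_col_labels: "length (col_labels r) = r * (r - 1) div 2"
proof -
  have "length (col_labels r) = (\<Sum>i\<leftarrow>[1..<r+1]. r - i)"
    by (simp add: col_labels_def length_concat comp_def)
  also have "\<dots> = (\<Sum>i\<in>{Suc 0..<Suc r}. r - i)"
    unfolding sum_list_distinct_conv_sum_set[OF distinct_upt]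
    by (simp only: set_upt One_nat_def add_Suc_right add_0_right)
  also have "\<dots> = (\<Sum>i<r. r - Suc i)"
    unfolding sum.shift_bounds_Suc_ivl by (simp add: atLeast0LessThan)
  also have "\<dots> = (\<Sum>i<r. i)" by (rule sum.nat_diff_reindex)
  also have "\<dots> = r * (r - 1) div 2"
    by (metis atLeast0LessThan Sum_Ico_nat mult_0 diff_zero)
  finally show ?thesis .
qed

lemma lookup_edge:
  assumes "c < d"
  shows "lookup (edge i s) (c, d) = (if i = c \<and> s = d then 1 else if i = d \<and> s = c then - 1 else 0)"
  using assms by (auto simp: edge_def lookup_minus lookup_frag_of)

lemma edge_map_relator:
  "edge_map r i (relator m j) = (\<Sum>k = 1..j. frag_cmul (m j k) (edge i (shift r i k)))"
  unfolding relator_def edge_map_def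
  by (subst frag_extend_sum) (simp_all add: frag_extend_cmul)

lemma lookup_edge_map_relator:
  assumes i: "i \<in> {1..r}" and j: "j \<in> {1..<r}" and cd: "(c, d) \<in> pairs r"
  shows "lookup (edge_map r i (relator (M i) j)) (c, d) = param_entry r M (i, j) (c, d)"
proof -
  have less: "1 \<le> c" "c < d" "d \<le> r" using cd by (auto simp: pairs_def)
  have "lookup (edge_map r i (relator (M i) j)) (c, d) =
      (\<Sum>k = 1..j. M i j k * lookup (edge i (shift r i k)) (c, d))"
    by (simp add: edge_map_relator lookup_sum)
  \<comment> \<open>Column (c, d) is reached from i = c without wrapping around, at k = d - i, and
    from i = d only after wrapping around, at k = c + r - i; the second case carries the sign of the
    reversed edge.\<close>
  also have "\<dots> = (\<Sum>k = 1..j. (if k = d - i then (if i = c then M i j (d - i) else 0) else 0)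
      + (if k = c + r - i then (if i = d then - M i j (c + r - i) else 0) else 0))"
    by (rule sum.cong) (use i j less in \<open>auto simp: lookup_edge shift_def\<close>)
  also have "\<dots> = (if d - i \<in> {1..j} \<and> i = c then M i j (d - i) else 0)
      + (if c + r - i \<in> {1..j} \<and> i = d then - M i j (c + r - i) else 0)"
    using less by (cases "i = c"; cases "i = d") simp_all
  also have "\<dots> = param_entry r M (i, j) (c, d)"
    using i j less by (auto simp: param_entry_def)
  finally show ?thesis .
qed

text \<open>Row q of a left inverse lists the coefficients that express the q-th basis vector
  through the rows of the matrix.\<close>

lemma row_lattice_full_iff_left_inverse:
  fixes r M
  defines "A \<equiv> parameter_matrix r M" and "R \<equiv> length (row_labels r)" and "n \<equiv> length (col_labels r)"
  shows "row_lattice_full r M \<longleftrightarrow> (\<exists>B\<in>carrier_mat n R. B * A = 1\<^sub>m n)"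
proof -
  define row_vec where "row_vec p = (\<lambda>(i, j). edge_map r i (relator (M i) j)) (row_labels r ! p)" for p
  have A: "A \<in> carrier_mat R n" by (simp add: A_def R_def n_def parameter_matrix_def)
  have row_label: "row_labels r ! p \<in> {1..r} \<times> {1..<r}" if "p < R" for p
    using nth_mem[of p "row_labels r"] that by (simp add: R_def set_row_labels)
  have col_label: "col_labels r ! q \<in> pairs r" if "q < n" for q
    using nth_mem[of q "col_labels r"] that by (simp add: n_def set_col_labels)
  have entry: "lookup (row_vec p) (col_labels r ! q) = A $$ (p, q)" if p: "p < R" and q: "q < n" for p q
  proof -
    obtain i j where ij: "row_labels r ! p = (i, j)" "i \<in> {1..r}" "j \<in> {1..<r}" using row_label[OF p] by blast
    obtain c d where cd: "col_labels r ! q = (c, d)" by fastforce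
    have "(c, d) \<in> pairs r" using col_label[OF q] cd by simp
    from lookup_edge_map_relator[OF ij(2,3) this] show ?thesis
      using p q by (simp add: row_vec_def ij(1) cd A_def parameter_matrix_def R_def n_def)
  qed
  have keys_row: "keys (row_vec p) \<subseteq> pairs r" if p: "p < R" for p
  proof -
    obtain i j where ij: "row_labels r ! p = (i, j)" "i \<in> {1..r}" "j \<in> {1..<r}" using row_label[OF p] by blast
    have "keys (relator (M i) j) \<subseteq> {1..<r}" using keys_relator[of "M i" j] ij by fastforce
    then show ?thesis using keys_edge_map[OF ij(2)] by (simp add: row_vec_def ij(1))
  qed
  have image: "row_vec ` {..<R} = (\<lambda>(i, j). edge_map r i (relator (M i) j)) ` ({1..r} \<times> {1..<r})"
  proof -
    have "(\<lambda>p. row_labels r ! p) ` {..<R} = {1..r} \<times> {1..<r}"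
      unfolding set_row_labels[symmetric] R_def by (auto simp: set_conv_nth)
    then show ?thesis unfolding row_vec_def image_image[symmetric, of _ "\<lambda>p. row_labels r ! p"] by simp
  qed
  \<comment> \<open>Both sides are supported on the columns, so comparing them at the column labels
    is enough; distinctness of the labels gives the unit vector.\<close>
  have combination: "frag_of (col_labels r ! q) = (\<Sum>p<R. frag_cmul (b p) (row_vec p)) \<longleftrightarrow>
      (\<forall>q'<n. (\<Sum>p<R. b p * A $$ (p, q')) = (if q = q' then 1 else 0))" if q: "q < n" for b q
  proof -
    have lookup_sum_row: "lookup (\<Sum>p<R. frag_cmul (b p) (row_vec p)) (col_labels r ! q') = (\<Sum>p<R. b p * A $$ (p, q'))"
      if "q' < n" for q'
      unfolding lookup_sum by (rule sum.cong) (use entry that in auto)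
    have frag: "lookup (frag_of (col_labels r ! q)) (col_labels r ! q') = (if q = q' then 1 else 0)" if "q' < n" for q'
      using that q distinct_col_labels by (simp add: lookup_frag_of nth_eq_iff_index_eq n_def)
    show ?thesis
    proof
      assume "frag_of (col_labels r ! q) = (\<Sum>p<R. frag_cmul (b p) (row_vec p))"
      then show "\<forall>q'<n. (\<Sum>p<R. b p * A $$ (p, q')) = (if q = q' then 1 else 0)"
        using lookup_sum_row frag by metis
    next
      assume eq: "\<forall>q'<n. (\<Sum>p<R. b p * A $$ (p, q')) = (if q = q' then 1 else 0)"
      show "frag_of (col_labels r ! q) = (\<Sum>p<R. frag_cmul (b p) (row_vec p))"
      proof (rule poly_mapping_eqI)
        fix x
        show "lookup (frag_of (col_labels r ! q)) x = lookup (\<Sum>p<R. frag_cmul (b p) (row_vec p)) x"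
        proof (cases "x \<in> pairs r")
          case True
          then obtain q' where "q' < n" "x = col_labels r ! q'"
            by (metis in_set_conv_nth n_def set_col_labels)
          then show ?thesis using lookup_sum_row frag eq by simp
        next
          case False
          then have "x \<noteq> col_labels r ! q" using col_label[OF q] by blast
          moreover have "lookup (row_vec p) x = 0" if "p < R" for p
            using keys_row[OF that] False by (auto simp: in_keys_iff)
          ultimately show ?thesis by (simp add: lookup_sum lookup_frag_of)
        qed
      qed
    qed
  qed
  show ?thesis
  proof
    assume full: "row_lattice_full r M"
    have "\<exists>b. \<forall>q'<n. (\<Sum>p<R. b p * A $$ (p, q')) = (if q = q' then 1 else 0)" if q: "q < n" for q
    proof -
      have "frag_of (col_labels r ! q) \<in> group_closure (row_vec ` {..<R})"
        using full col_label[OF q] unfolding row_lattice_full_def row_lattice_def image by blast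
      then obtain b where "frag_of (col_labels r ! q) = (\<Sum>p<R. frag_cmul (b p) (row_vec p))"
        using group_closure_image_frag[of "{..<R}" _ row_vec] by blast
      then show ?thesis using combination[OF q] by blast
    qed
    then have "\<forall>q\<in>{..<n}. \<exists>b. \<forall>q'<n. (\<Sum>p<R. b p * A $$ (p, q')) = (if q = q' then 1 else 0)" by simp
    from bchoice[OF this] obtain b where
      b: "\<forall>q\<in>{..<n}. \<forall>q'<n. (\<Sum>p<R. b q p * A $$ (p, q')) = (if q = q' then 1 else 0)" ..
    have "mat n R (\<lambda>(q, p). b q p) * A = 1\<^sub>m n"
      using b A by (intro eq_matI) (auto simp: scalar_prod_def atLeast0LessThan)
    then show "\<exists>B\<in>carrier_mat n R. B * A = 1\<^sub>m n" by (intro bexI[of _ "mat n R (\<lambda>(q, p). b q p)"]) simp_all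
  next
    assume "\<exists>B\<in>carrier_mat n R. B * A = 1\<^sub>m n"
    then obtain B where B: "B \<in> carrier_mat n R" "B * A = 1\<^sub>m n" by blast
    show "row_lattice_full r M"
      unfolding row_lattice_full_def
    proof
      fix x assume "x \<in> pairs r"
      then obtain q where q: "q < n" "x = col_labels r ! q"
        by (metis in_set_conv_nth n_def set_col_labels)
      have "(\<Sum>p<R. B $$ (q, p) * A $$ (p, q')) = (if q = q' then 1 else 0)" if "q' < n" for q'
      proof -
        have "(\<Sum>p<R. B $$ (q, p) * A $$ (p, q')) = (B * A) $$ (q, q')"
          using B(1) A q(1) that by (simp add: scalar_prod_def atLeast0LessThan)
        then show ?thesis using B(2) q(1) that by simp
      qed
      then have "frag_of x = (\<Sum>p<R. frag_cmul (B $$ (q, p)) (row_vec p))"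
        unfolding q(2) combination[OF q(1), of "\<lambda>p. B $$ (q, p)"] by blast
      moreover have "(\<Sum>p<R. frag_cmul (B $$ (q, p)) (row_vec p)) \<in> group_closure (row_vec ` {..<R})"
        by (intro group_closure_sum_in group_closure_frag_cmul group_closure.base insertI2 imageI) simp
      ultimately show "frag_of x \<in> row_lattice r M" unfolding row_lattice_def image[symmetric] by simp
    qed
  qed
qed

lemma row_lattice_full_iff_Gcd_minors:
  "row_lattice_full r M \<longleftrightarrow> Gcd (minors (r * (r - 1) div 2) (parameter_matrix r M)) = 1"
  unfolding row_lattice_full_iff_left_inverse length_col_labels[symmetric]
  by (rule Gcd_minors_eq_1_iff[symmetric]) (simp add: parameter_matrix_def)

theorem theorem4p2:
  fixes X :: "'a set" and tr :: "'a \<Rightarrow> 'a \<Rightarrow> 'a" and r :: nat and Os :: "nat \<Rightarrow> 'a set"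
  assumes "quandle X tr" and "finite X" and "ordered_orbits X tr r Os"
  shows "(comm_group (structure_group X tr) \<longleftrightarrow>
            abelian_quandle X tr \<and> trivial_group (parameter_group r (parameters X tr r Os))) \<and>
         (comm_group (structure_group X tr) \<longleftrightarrow>
            abelian_quandle X tr \<and>
            Gcd (minors (r * (r - 1) div 2) (parameter_matrix r (parameters X tr r Os))) = 1)"
proof (cases "abelian_quandle X tr")
  case True
  then have "abelian_quandle_orbits X tr r Os"
    using assms by (simp add: abelian_quandle_orbits_def)
  then obtain pt where "quandle_chart X tr r (parameters X tr r Os) pt"
    using abelian_quandle_orbits.chart_parameters by blast
  then have "comm_group (structure_group X tr) \<longleftrightarrow> row_lattice_full r (parameters X tr r Os)"
    using quandle_chart.row_lattice_full_if_comm quandle_chart.comm_if_row_lattice_full by blast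
  then show ?thesis
    using True row_lattice_full_iff_Gcd_minors row_lattice_full_if_trivial trivial_if_row_lattice_full by blast
next
  case False
  \<comment> \<open>All three conditions fail: the last two by their first conjunct, the first
    because it would make the quandle abelian.\<close>
  then show ?thesis using abelian_quandle_if_comm_structure_group[OF assms(1)] by blast
qed

end
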